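(* Consider the system on the unstable manifold, in normal form up to degree $N$, $$\frac{d\boldsymbol{Y}}{dt}=J_u\boldsymbol{Y}+\boldsymbol{G}_1(\boldsymbol{Y},Z,\varepsilon)+\boldsymbol{G}_2(\boldsymbol{Y},Z,\varepsilon),\qquad \frac{dZ}{dt}=rZ+\varepsilon F_{m+1},\qquad \frac{d\varepsilon}{dt}=s\varepsilon,$$ with $J_u=\mathrm{diag}(\lambda_{k+1},\dots,\lambda_m)$ and $\lambda_{k+1},\dots,\lambda_m$ positive integers, and the weighted blow-up $$Y_i=u_iw^{\lambda_i}\ (i=k+1,\dots,m),\qquad Z=\zeta w^r,\qquad \varepsilon=w^s,\qquad\text{where }\zeta=z,$$ which transforms it into $$\frac{du_i}{dz}=w^{-1-\lambda_i}(G_{1,i}+G_{2,i})/F_{m+1}\quad(i=k+1,\dots,m),\qquad \frac{dw}{dz}=1/F_{m+1}.\qquad( * )$$ If $N$ is sufficiently large, then the function $w^{-1-\lambda_i}G_{2,i}$ is holomorphic in $u_{k+1},\dots,u_m,w,z$ (near $w=0$), while $w^{-1-\lambda_i}G_{1,i}$ is of the form $$w^{-1-\lambda_i}G_{1,i}=w^{-1}\times(\text{polynomial of }u_{k+1},\dots,u_m,z).$$ If, moreover, the original system has an $(m-k+1)$-parameter family of convergent Laurent series solutions $x_i(z)=c_i(z-z_0)^{-p_i}+\sum_{n\ge1}a_{i,n}(z-z_0)^{-p_i+n}$ with $m-k$ free parameters other than $z_0$, equivalently if $\lambda_{k+1},\dots,\lambda_m$ are positive integers, the linear part of the system on the unstable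 manifold is semisimple and that system is linearizable by a local analytic transformation, then $\boldsymbol{G}_1=0$ and the right-hand side of $( * )$ is holomorphic in $u_{k+1},\dots,u_m,w,z$ (near $w=0$). Further, $1/F_{m+1}\ne0$ when $w=0$. Hence there are no singularities of the foliation (defined by the integral curves) on the exceptional divisor $\{w=0\}$.
   Context: Consider the system $\frac{dx_i}{dz}=f_i(x_1,\dots,x_m,z)+g_i(x_1,\dots,x_m,z)$, $i=1,\dots,m$, with $f_i,g_i$ polynomials on $\mathbb{C}^{m+1}$, satisfying: (A1) there are positive integers $p_1,\dots,p_m,r$ with $f_i(\lambda^{p_1}x_1,\dots,\lambda^{p_m}x_m,\lambda^rz)=\lambda^{p_i+1}f_i(x_1,\dots,x_m,z)$ for all $\lambda\in\mathbb{C}$ and all $i$; (A2) $g_i(\lambda^{p_1}x_1,\dots,\lambda^{p_m}x_m,\lambda^rz)=o(\lambda^{p_i+1})$ as $|\lambda|\to\infty$; (A3) with $s=r+1$ and $\omega=e^{2\pi i/s}$, the system is invariant under $(x_1,\dots,x_m,z)\mapsto(\omega^{p_1}x_1,\dots,\omega^{p_m}x_m,\omega^rz)$. Put $f_i^A(x):=f_i(x,0)$ and let $(c_1,\dots,c_m)$ be a root of $-p_ic_i=f_i^A(c_1,\dots,c_m)$ with $c_j\neq0$ for a fixed $j$; fix a branch of $c_j^{1/p_j}$. The Kovalevskaya exponents $\lambda_1=-1,\lambda_2,\dots,\lambda_m$ are the eigenvalues of $\left(\frac{\partial f_i^A}{\partial x_l}(c)+p_i\delta_{il}\right)_{i,l}$,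 numbered so that $\mathrm{Re}\,\lambda_i\le0$ for $2\le i\le k$ and $\mathrm{Re}\,\lambda_i>0$ for $i\ge k+1$. In the coordinates given by $x_i=X_i\varepsilon^{-p_i/s}$ $(i\ne j)$, $x_j=\varepsilon^{-p_j/s}$, $z=Z\varepsilon^{-r/s}$, the system becomes $$\frac{dX_i}{dt}=p_iX_i-p_j\frac{f_i+\varepsilon G_i}{f_j+\varepsilon G_j}\ (i\neq j),\qquad \frac{dZ}{dt}=rZ+\varepsilon F_{m+1},\qquad \frac{d\varepsilon}{dt}=s\varepsilon,\qquad F_{m+1}:=-\frac{p_j}{f_j+\varepsilon G_j},$$ where $f_i$ means $f_i(X_1,\dots,1,\dots,X_m,Z)$ with $1$ in the $j$-th slot and $G_i$ is the polynomial in $(X,Z,\varepsilon)$ determined by $g_i(X_1\varepsilon^{-p_1/s},\dots,\varepsilon^{-p_j/s},\dots,X_m\varepsilon^{-p_m/s},Z\varepsilon^{-r/s})=\varepsilon^{1-(1+p_i)/s}G_i$. The point $X_i=c_ic_j^{-p_i/p_j}$, $Z=\varepsilon=0$ is a fixed point, whose Jacobi matrix has eigenvalues $\lambda_2,\dots,\lambda_m,r,s$. Translate it to the origin, and by a linear change of the variables $X_i-c_ic_j^{-p_i/p_j}$ split them into $\boldsymbol{X}_s\in\mathbb{C}^{k-1}$ and $\boldsymbol{X}_u\in\mathbb{C}^{m-k}$ corresponding to the eigenvalues $\lambda_2,\dots,\lambda_k$ and $\lambda_{k+1},\dots,\lambda_m$. It is assumed that $\lambda_{k+1},\dots,\lambda_m$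 are positive integers and that the block on $\boldsymbol{X}_u$ is $J_u=\mathrm{diag}(\lambda_{k+1},\dots,\lambda_m)$. The unstable manifold of the origin is the analytic graph $\boldsymbol{X}_s=\varphi(\boldsymbol{X}_u,Z,\varepsilon)$; restricting to it gives a system in $(\boldsymbol{X}_u,Z,\varepsilon)\in\mathbb{C}^{m-k+2}$, called the system on the unstable manifold. A polynomial near-identity change $\boldsymbol{X}_u\mapsto\boldsymbol{Y}=h_1(\boldsymbol{X}_u,Z,\varepsilon)$ of degree $N$, with $h_1(0)=0$ and derivative with respect to $\boldsymbol{X}_u$ at $0$ equal to the identity, with $Z,\varepsilon$ unchanged, brings this system to the displayed form, where $\boldsymbol{Y}=(Y_{k+1},\dots,Y_m)$, $\boldsymbol{G}_l=(G_{l,k+1},\dots,G_{l,m})$, $\boldsymbol{G}_2=O(\|(\boldsymbol{Y},Z,\varepsilon)\|^{N+1})$ is analytic, and $\boldsymbol{G}_1$ is a polynomial of degree at most $N$ consisting only of resonance terms, i.e. each monomial $Y_{k+1}^{n_{k+1}}\cdots Y_m^{n_m}Z^{n_{m+1}}\varepsilon^{n_{m+2}}$ in $G_{1,i}$ satisfies $\lambda_{k+1}n_{k+1}+\cdots+\lambda_mn_m+rn_{m+1}+sn_{m+2}=\lambda_i$. In $( * )$, $F_{m+1}$, $G_{1,i}$, $G_{2,i}$ are expressed in the variables $(u_{k+1},\dots,u_m,z,w)$ through the blow-up. *)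

theory Defs
  imports "HOL-Analysis.Analysis" "HOL-Library.Landau_Symbols" "HOL-Library.Poly_Mapping"
begin

section \<open>Polynomials and holomorphic functions of several variables\<close>

type_synonym 'x mpoly = "('x \<Rightarrow>\<^sub>0 nat) \<Rightarrow>\<^sub>0 complex"

definition peval :: "'x mpoly \<Rightarrow> ('x \<Rightarrow> complex) \<Rightarrow> complex" where
  "peval P x = (\<Sum>n\<in>Poly_Mapping.keys P. Poly_Mapping.lookup P n *
     (\<Prod>v\<in>Poly_Mapping.keys n. x v ^ Poly_Mapping.lookup n v))"

definition degree_le :: "'x mpoly \<Rightarrow> nat \<Rightarrow> bool" where
  "degree_le P N \<longleftrightarrow>
     (\<forall>n\<in>Poly_Mapping.keys P. (\<Sum>v\<in>Poly_Mapping.keys n. Poly_Mapping.lookup n v) \<le> N)"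

text \<open>Holomorphic on an open set: Frechet differentiable with complex-linear derivative.\<close>

definition holo_on :: "(complex^'n::finite \<Rightarrow> complex) \<Rightarrow> (complex^'n) set \<Rightarrow> bool" where
  "holo_on h S \<longleftrightarrow> open S \<and>
     (\<forall>x\<in>S. \<exists>L. (h has_derivative L) (at x) \<and> (\<forall>k y. L (k *s y) = k * L y))"


section \<open>The data\<close>

text \<open>
  The type \<open>'m\<close> indexes \<open>x\<^sub>1, \<dots>, x\<^sub>m\<close>.  The variables \<open>X\<^sub>i\<close> with
  \<open>i \<noteq> j\<close> and the exponents \<open>\<lambda>\<^sub>2, \<dots>, \<lambda>\<^sub>m\<close> are both indexed by the elements of \<open>'m\<close>
  other than \<open>j\<close>; the exponent \<open>\<lambda>\<^sub>1 = -1\<close> carries the index \<open>j\<close>.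

  The type \<open>'v\<close> indexes the \<open>m - k + 2\<close> coordinates \<open>(X\<^sub>u, Z, \<epsilon>)\<close> on the unstable manifold:
  \<open>zc\<close> is the slot of \<open>Z\<close>, \<open>ec\<close> is the slot of \<open>\<epsilon>\<close>, and \<open>idx\<close> maps the indices of the
  exponents with positive real part bijectively onto the other slots.  The same slots are used for
  \<open>(Y, Z, \<epsilon>)\<close>, and for \<open>(u, z, w)\<close> with \<open>z\<close> in the slot \<open>zc\<close> and \<open>w\<close> in the slot \<open>ec\<close>.
\<close>

datatype 'm var = VX 'm | VZ | VE

record ('m, 'v) kov =
  fP :: "'m \<Rightarrow> 'm option mpoly"   \<comment> \<open>\<open>f\<^sub>i\<close>; \<open>Some l\<close> stands for \<open>x\<^sub>l\<close> and \<open>None\<close> for \<open>z\<close>\<close>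
  gP :: "'m \<Rightarrow> 'm option mpoly"
  GP :: "'m \<Rightarrow> 'm var mpoly"
  pw :: "'m \<Rightarrow> nat"
  rw :: nat
  cc :: "complex^'m"
  jj :: 'm
  beta :: complex                \<comment> \<open>the chosen branch of \<open>c\<^sub>j\<^bsup>1/p\<^sub>j\<^esup>\<close>\<close>
  lam :: "'m \<Rightarrow> complex"
  TT :: "complex^'m^'m"          \<comment> \<open>the linear change \<open>X = X\<^sup>* + T \<xi>\<close>, \<open>\<xi> = (X\<^sub>s, X\<^sub>u)\<close>\<close>
  phi :: "complex^'v \<Rightarrow> complex^'m"   \<comment> \<open>only the components in \<open>Sset\<close> below are used\<close>
  idx :: "'m \<Rightarrow> 'v"
  zc :: 'v
  ec :: 'v
  wt :: "'v \<Rightarrow> nat"               \<comment> \<open>the weights \<open>\<lambda>\<^sub>i\<close>, \<open>r\<close>, \<open>s\<close> of \<open>Y\<^sub>i\<close>, \<open>Z\<close>, \<open>\<epsilon>\<close>\<close>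

definition sw :: "('m::finite, 'v::finite) kov \<Rightarrow> nat" where "sw D = rw D + 1"

definition fval :: "('m::finite, 'v::finite) kov \<Rightarrow> 'm \<Rightarrow> complex^'m \<Rightarrow> complex \<Rightarrow> complex" where
  "fval D i x z = peval (fP D i) (case_option z (\<lambda>l. x $ l))"

definition gval :: "('m::finite, 'v::finite) kov \<Rightarrow> 'm \<Rightarrow> complex^'m \<Rightarrow> complex \<Rightarrow> complex" where
  "gval D i x z = peval (gP D i) (case_option z (\<lambda>l. x $ l))"

definition Gval :: "('m::finite, 'v::finite) kov \<Rightarrow> 'm \<Rightarrow> complex^'m \<Rightarrow> complex \<Rightarrow> complex \<Rightarrow> complex" where
  "Gval D i X Z e = peval (GP D i) (case_var (\<lambda>l. X $ l) Z e)"

definition wscale :: "('m::finite, 'v::finite) kov \<Rightarrow> complex \<Rightarrow> complex^'m \<Rightarrow> complex^'m" where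
  "wscale D k x = (\<chi> i. k ^ pw D i * x $ i)"


section \<open>Assumptions on the original system\<close>

definition assumption_A1 :: "('m::finite, 'v::finite) kov \<Rightarrow> bool" where
  "assumption_A1 D \<longleftrightarrow> (\<forall>i. 0 < pw D i) \<and> 0 < rw D \<and>
     (\<forall>i k x z. fval D i (wscale D k x) (k ^ rw D * z) = k ^ (pw D i + 1) * fval D i x z)"

definition assumption_A2 :: "('m::finite, 'v::finite) kov \<Rightarrow> bool" where
  "assumption_A2 D \<longleftrightarrow>
     (\<forall>i x z. (\<lambda>k. gval D i (wscale D k x) (k ^ rw D * z)) \<in> o[at_infinity](\<lambda>k. k ^ (pw D i + 1)))"

text \<open>Substituting \<open>(\<omega>\<^bsup>p\<^esup> x, \<omega>\<^sup>r z)\<close> multiplies \<open>dx\<^sub>i/dz\<close> by \<open>\<omega>\<^bsup>p\<^sub>i\<^esup> / \<omega>\<^sup>r\<close>.\<close>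

definition assumption_A3 :: "('m::finite, 'v::finite) kov \<Rightarrow> bool" where
  "assumption_A3 D \<longleftrightarrow> (let om = exp (2 * of_real pi * \<i> / of_nat (sw D)) in
     \<forall>i x z. om ^ rw D * (fval D i (wscale D om x) (om ^ rw D * z)
                           + gval D i (wscale D om x) (om ^ rw D * z))
           = om ^ pw D i * (fval D i x z + gval D i x z))"

definition indicial_root :: "('m::finite, 'v::finite) kov \<Rightarrow> bool" where
  "indicial_root D \<longleftrightarrow>
     (\<forall>i. - of_nat (pw D i) * cc D $ i = fval D i (cc D) 0) \<and> cc D $ jj D \<noteq> 0 \<and>
     beta D ^ pw D (jj D) = cc D $ jj D"

definition kov_matrix :: "('m::finite, 'v::finite) kov \<Rightarrow> complex^'m^'m" where
  "kov_matrix D = (\<chi> i l. deriv (\<lambda>t. fval D i (\<chi> n. if n = l then t else cc D $ n) 0) (cc D $ l)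
                         + (if i = l then of_nat (pw D i) else 0))"

definition kov_exponents :: "('m::finite, 'v::finite) kov \<Rightarrow> bool" where
  "kov_exponents D \<longleftrightarrow>
     (\<forall>t. det (mat t - kov_matrix D) = (\<Prod>l\<in>UNIV. t - lam D l)) \<and> lam D (jj D) = - 1"

definition Sset :: "('m::finite, 'v::finite) kov \<Rightarrow> 'm set" where
  "Sset D = {l. l \<noteq> jj D \<and> Re (lam D l) \<le> 0}"

definition Uset :: "('m::finite, 'v::finite) kov \<Rightarrow> 'm set" where
  "Uset D = {l. l \<noteq> jj D \<and> Re (lam D l) > 0}"

definition Uslots :: "('m::finite, 'v::finite) kov \<Rightarrow> 'v set" where
  "Uslots D = - {zc D, ec D}"

definition unstable_slots :: "('m::finite, 'v::finite) kov \<Rightarrow> bool" where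
  "unstable_slots D \<longleftrightarrow> zc D \<noteq> ec D \<and> bij_betw (idx D) (Uset D) (Uslots D) \<and>
     wt D (zc D) = rw D \<and> wt D (ec D) = sw D"

definition positive_integer_exponents :: "('m::finite, 'v::finite) kov \<Rightarrow> bool" where
  "positive_integer_exponents D \<longleftrightarrow>
     (\<forall>l\<in>Uset D. 0 < wt D (idx D l) \<and> lam D l = of_nat (wt D (idx D l)))"


section \<open>The chart at infinity\<close>

text \<open>
  The parameter \<open>w = \<epsilon>\<^bsup>1/s\<^esup>\<close> runs through all branches of the fractional powers.
\<close>

definition G_determined :: "('m::finite, 'v::finite) kov \<Rightarrow> bool" where
  "G_determined D \<longleftrightarrow> (\<forall>i X Z w. X $ jj D = 1 \<longrightarrow> w \<noteq> 0 \<longrightarrow>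
     gval D i (\<chi> l. X $ l * w powi (- int (pw D l))) (Z * w powi (- int (rw D)))
       = w powi (int (sw D) - (1 + int (pw D i))) * Gval D i X Z (w ^ sw D))"

definition fixed_point :: "('m::finite, 'v::finite) kov \<Rightarrow> complex^'m" where
  "fixed_point D = (\<chi> i. cc D $ i * beta D powi (- int (pw D i)))"

definition slot_one :: "('m::finite, 'v::finite) kov \<Rightarrow> complex^'m \<Rightarrow> complex^'m" where
  "slot_one D X = (\<chi> l. if l = jj D then 1 else X $ l)"

definition numer :: "('m::finite, 'v::finite) kov \<Rightarrow> 'm \<Rightarrow> complex^'m \<Rightarrow> complex \<Rightarrow> complex \<Rightarrow> complex" where
  "numer D i X Z e = fval D i (slot_one D X) Z + e * Gval D i (slot_one D X) Z e"

definition Fm1 :: "('m::finite, 'v::finite) kov \<Rightarrow> complex^'m \<Rightarrow> complex \<Rightarrow> complex \<Rightarrow> complex" where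
  "Fm1 D X Z e = - of_nat (pw D (jj D)) / numer D (jj D) X Z e"

text \<open>
  There is no variable \<open>X\<^sub>j\<close>.  To stay inside \<open>complex^'m\<close> the slot \<open>j\<close> is kept as a dummy:
  nothing depends on it, and the component \<open>j\<close> of the field is \<open>0\<close>.
\<close>

definition X_field :: "('m::finite, 'v::finite) kov \<Rightarrow> complex^'m \<Rightarrow> complex \<Rightarrow> complex \<Rightarrow> complex^'m" where
  "X_field D X Z e = (\<chi> i. if i = jj D then 0 else
     of_nat (pw D i) * X $ i - of_nat (pw D (jj D)) * (numer D i X Z e / numer D (jj D) X Z e))"

definition X_of :: "('m::finite, 'v::finite) kov \<Rightarrow> complex^'m \<Rightarrow> complex^'m" where
  "X_of D \<xi> = fixed_point D + TT D *v \<xi>"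

text \<open>The system in the coordinates \<open>(\<xi>, Z, \<epsilon>)\<close>, with the fixed point at the origin.\<close>

definition full_field ::
  "('m::finite, 'v::finite) kov \<Rightarrow> (complex^'m) \<times> complex \<times> complex \<Rightarrow> (complex^'m) \<times> complex \<times> complex" where
  "full_field D = (\<lambda>(\<xi>, Z, e).
     (matrix_inv (TT D) *v X_field D (X_of D \<xi>) Z e,
      of_nat (rw D) * Z + e * Fm1 D (X_of D \<xi>) Z e,
      of_nat (sw D) * e))"

definition linear_part ::
  "('m::finite, 'v::finite) kov \<Rightarrow> (complex^'m) \<times> complex \<times> complex \<Rightarrow> (complex^'m) \<times> complex \<times> complex" where
  "linear_part D = frechet_derivative (full_field D) (at 0)"

text \<open>
  \<open>T\<close> mixes only the slots other than \<open>j\<close>, and it makes the Jacobi matrix block diagonal with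
  \<open>J\<^sub>u\<close> diagonal.  By \<open>kov_exponents\<close> the eigenvalues of the block on \<open>X\<^sub>s\<close> are then the
  \<open>\<lambda>\<^sub>l\<close> with \<open>l\<close> in \<open>Sset\<close>.
\<close>

definition splitting :: "('m::finite, 'v::finite) kov \<Rightarrow> bool" where
  "splitting D \<longleftrightarrow> invertible (TT D) \<and>
     (\<forall>l. TT D $ jj D $ l = (if l = jj D then 1 else 0) \<and>
          TT D $ l $ jj D = (if l = jj D then 1 else 0)) \<and>
     (\<forall>l\<in>Uset D. fst (linear_part D (axis l 1, 0, 0)) = axis l (lam D l)) \<and>
     (\<forall>l\<in>Sset D. \<forall>i\<in>Uset D. fst (linear_part D (axis l 1, 0, 0)) $ i = 0)"


section \<open>The unstable manifold\<close>

definition cscale :: "complex \<Rightarrow> (complex^'m::finite) \<times> complex \<times> complex \<Rightarrow> (complex^'m) \<times> complex \<times> complex" where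
  "cscale k = (\<lambda>(\<xi>, Z, e). (k *s \<xi>, k * Z, k * e))"

text \<open>
  The sum of the generalised eigenspaces for the eigenvalues with positive real part.  The real span
  is the complex one, since each generalised eigenspace is a complex subspace.
\<close>

definition unstable_space :: "('m::finite, 'v::finite) kov \<Rightarrow> ((complex^'m) \<times> complex \<times> complex) set" where
  "unstable_space D = span {y. \<exists>\<mu> n. 0 < Re \<mu> \<and> ((\<lambda>x. linear_part D x - cscale \<mu> x) ^^ n) y = 0}"

text \<open>The point of the graph \<open>X\<^sub>s = \<phi>(X\<^sub>u, Z, \<epsilon>)\<close> over \<open>q = (X\<^sub>u, Z, \<epsilon>)\<close>.\<close>

definition graph_point ::
  "('m::finite, 'v::finite) kov \<Rightarrow> complex^'v \<Rightarrow> (complex^'m) \<times> complex \<times> complex" where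
  "graph_point D q =
     ((\<chi> l. if l \<in> Uset D then q $ idx D l else if l \<in> Sset D then phi D q $ l else 0),
      q $ zc D, q $ ec D)"

definition F_on :: "('m::finite, 'v::finite) kov \<Rightarrow> complex^'v \<Rightarrow> complex" where
  "F_on D q = (case graph_point D q of (\<xi>, Z, e) \<Rightarrow> Fm1 D (X_of D \<xi>) Z e)"

text \<open>The system on the unstable manifold.\<close>

definition red_field :: "('m::finite, 'v::finite) kov \<Rightarrow> complex^'v \<Rightarrow> complex^'v" where
  "red_field D q = (case full_field D (graph_point D q) of (\<xi>', Z', e') \<Rightarrow>
     (\<chi> v. if v = zc D then Z' else if v = ec D then e' else \<xi>' $ inv_into (Uset D) (idx D) v))"

text \<open>
  A local unstable manifold of the origin: an invariant manifold tangent to the unstable space, here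
  an analytic graph over a neighbourhood \<open>B\<close> of \<open>0\<close> on which the field has no pole.
\<close>

definition unstable_manifold :: "('m::finite, 'v::finite) kov \<Rightarrow> (complex^'v) set \<Rightarrow> bool" where
  "unstable_manifold D B \<longleftrightarrow> open B \<and> 0 \<in> B \<and>
     (\<forall>l\<in>Sset D. holo_on (\<lambda>q. phi D q $ l) B \<and> phi D 0 $ l = 0) \<and>
     (\<forall>q\<in>B. case graph_point D q of (\<xi>, Z, e) \<Rightarrow> numer D (jj D) (X_of D \<xi>) Z e \<noteq> 0) \<and>
     (\<forall>q\<in>B. frechet_derivative (graph_point D) (at q) (red_field D q) = full_field D (graph_point D q)) \<and>
     range (frechet_derivative (graph_point D) (at 0)) = unstable_space D"


section \<open>Normal form up to degree N\<close>

definition near_id :: "('m::finite, 'v::finite) kov \<Rightarrow> ('v \<Rightarrow> 'v mpoly) \<Rightarrow> complex^'v \<Rightarrow> complex^'v" where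
  "near_id D h q = (\<chi> v. if v \<in> Uslots D then peval (h v) (\<lambda>a. q $ a) else q $ v)"

definition resonant :: "('m::finite, 'v::finite) kov \<Rightarrow> 'v \<Rightarrow> ('v \<Rightarrow>\<^sub>0 nat) \<Rightarrow> bool" where
  "resonant D v n \<longleftrightarrow> (\<Sum>a\<in>UNIV. wt D a * Poly_Mapping.lookup n a) = wt D v"

text \<open>
  \<open>Y = h\<^sub>1(X\<^sub>u, Z, \<epsilon>)\<close>, defined on the neighbourhood \<open>B\<close> of \<open>0\<close>, turns the system on the unstable
  manifold into \<open>dY/dt = J\<^sub>u Y + G\<^sub>1 + G\<^sub>2\<close>.  Only the components of \<open>h\<close>, \<open>G1\<close>, \<open>G2\<close> in \<open>Uslots\<close>
  are meaningful.
\<close>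

definition normal_form ::
  "('m::finite, 'v::finite) kov \<Rightarrow> nat \<Rightarrow> ('v \<Rightarrow> 'v mpoly) \<Rightarrow> ('v \<Rightarrow> 'v mpoly) \<Rightarrow>
   ('v \<Rightarrow> complex^'v \<Rightarrow> complex) \<Rightarrow> (complex^'v) set \<Rightarrow> bool" where
  "normal_form D N h G1 G2 B \<longleftrightarrow> open B \<and> 0 \<in> B \<and> inj_on (near_id D h) B \<and>
     (\<forall>v\<in>Uslots D.
        degree_le (h v) N \<and> peval (h v) (\<lambda>_. 0) = 0 \<and>
        (\<forall>a\<in>Uslots D. frechet_derivative (\<lambda>q. near_id D h q $ v) (at 0) (axis a 1)
                        = (if a = v then 1 else 0)) \<and>
        degree_le (G1 v) N \<and> (\<forall>n\<in>Poly_Mapping.keys (G1 v). resonant D v n) \<and>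
        holo_on (G2 v) (near_id D h ` B) \<and>
        (\<lambda>y. norm (G2 v y)) \<in> O[nhds 0](\<lambda>y. norm y ^ (N + 1)) \<and>
        (\<forall>q\<in>B. let y = near_id D h q in
           frechet_derivative (\<lambda>q. near_id D h q $ v) (at q) (red_field D q)
             = of_nat (wt D v) * y $ v + peval (G1 v) (\<lambda>a. y $ a) + G2 v y))"

text \<open>\<open>F\<^bsub>m+1\<^esub>\<close> as a function of \<open>(Y, Z, \<epsilon>)\<close>.\<close>

definition F_normal ::
  "('m::finite, 'v::finite) kov \<Rightarrow> ('v \<Rightarrow> 'v mpoly) \<Rightarrow> (complex^'v) set \<Rightarrow> complex^'v \<Rightarrow> complex" where
  "F_normal D h B y = F_on D (inv_into B (near_id D h) y)"

definition normal_field ::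
  "('m::finite, 'v::finite) kov \<Rightarrow> ('v \<Rightarrow> 'v mpoly) \<Rightarrow> ('v \<Rightarrow> 'v mpoly) \<Rightarrow>
   ('v \<Rightarrow> complex^'v \<Rightarrow> complex) \<Rightarrow> (complex^'v) set \<Rightarrow> complex^'v \<Rightarrow> complex^'v" where
  "normal_field D h G1 G2 B y = (\<chi> v.
     if v = zc D then of_nat (rw D) * y $ zc D + y $ ec D * F_normal D h B y
     else if v = ec D then of_nat (sw D) * y $ ec D
     else of_nat (wt D v) * y $ v + peval (G1 v) (\<lambda>a. y $ a) + G2 v y)"


section \<open>The weighted blow-up\<close>

definition blowup :: "('m::finite, 'v::finite) kov \<Rightarrow> complex^'v \<Rightarrow> complex^'v" where
  "blowup D a = (\<chi> v. if v = ec D then a $ ec D ^ sw D else a $ v * a $ ec D ^ wt D v)"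

definition divisor :: "('m::finite, 'v::finite) kov \<Rightarrow> (complex^'v) set" where
  "divisor D = {a. a $ ec D = 0}"

definition blowup_domain ::
  "('m::finite, 'v::finite) kov \<Rightarrow> ('v \<Rightarrow> 'v mpoly) \<Rightarrow> (complex^'v) set \<Rightarrow> (complex^'v) set" where
  "blowup_domain D h B = {a. blowup D a \<in> near_id D h ` B}"

definition F_blowup ::
  "('m::finite, 'v::finite) kov \<Rightarrow> ('v \<Rightarrow> 'v mpoly) \<Rightarrow> (complex^'v) set \<Rightarrow> complex^'v \<Rightarrow> complex" where
  "F_blowup D h B a = F_normal D h B (blowup D a)"

text \<open>
  The right-hand side of the blown-up system, as the direction
  \<open>(du/dz, dz/dz, dw/dz)\<close>; meaningful for \<open>w \<noteq> 0\<close>.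
\<close>

definition blowup_rhs ::
  "('m::finite, 'v::finite) kov \<Rightarrow> ('v \<Rightarrow> 'v mpoly) \<Rightarrow> ('v \<Rightarrow> 'v mpoly) \<Rightarrow>
   ('v \<Rightarrow> complex^'v \<Rightarrow> complex) \<Rightarrow> (complex^'v) set \<Rightarrow> complex^'v \<Rightarrow> complex^'v" where
  "blowup_rhs D h G1 G2 B a = (\<chi> v.
     if v = zc D then 1
     else if v = ec D then 1 / F_blowup D h B a
     else a $ ec D powi (- 1 - int (wt D v)) *
          (peval (G1 v) (\<lambda>b. blowup D a $ b) + G2 v (blowup D a)) / F_blowup D h B a)"

text \<open>
  Curves \<open>\<gamma> = (u, z, w)\<close> off the divisor: the image curve solves the normal form at time \<open>t\<close> iff
  \<open>\<gamma>\<close> satisfies \<open>du/dz\<close>, \<open>dw/dz\<close> as prescribed, where time is given by \<open>dz/dt = w F\<^bsub>m+1\<^esub>\<close>.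
\<close>

definition transforms_into_blowup_system ::
  "('m::finite, 'v::finite) kov \<Rightarrow> ('v \<Rightarrow> 'v mpoly) \<Rightarrow> ('v \<Rightarrow> 'v mpoly) \<Rightarrow>
   ('v \<Rightarrow> complex^'v \<Rightarrow> complex) \<Rightarrow> (complex^'v) set \<Rightarrow> bool" where
  "transforms_into_blowup_system D h G1 G2 B \<longleftrightarrow>
     (\<forall>(\<gamma> :: complex \<Rightarrow> complex^'v) d t.
        (\<forall>v. ((\<lambda>\<tau>. \<gamma> \<tau> $ v) has_field_derivative d $ v) (at t)) \<longrightarrow>
        \<gamma> t \<in> blowup_domain D h B - divisor D \<longrightarrow>
        ((\<forall>v. ((\<lambda>\<tau>. blowup D (\<gamma> \<tau>) $ v) has_field_derivative
                normal_field D h G1 G2 B (blowup D (\<gamma> t)) $ v) (at t))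
         \<longleftrightarrow> d $ zc D = \<gamma> t $ ec D * F_blowup D h B (\<gamma> t) \<and>
             d = d $ zc D *s blowup_rhs D h G1 G2 B (\<gamma> t)))"

text \<open>
  A function given off the divisor extends holomorphically to a neighbourhood of the whole divisor
  (all \<open>u\<close> and \<open>z\<close>, with \<open>w\<close> near \<open>0\<close>).
\<close>

definition holo_near_divisor ::
  "('m::finite, 'v::finite) kov \<Rightarrow> (complex^'v) set \<Rightarrow> (complex^'v \<Rightarrow> complex) \<Rightarrow> bool" where
  "holo_near_divisor D S h \<longleftrightarrow> (\<exists>W H. divisor D \<subseteq> W \<and> W \<subseteq> S \<and> holo_on H W \<and>
     (\<forall>a\<in>W - divisor D. H a = h a))"

text \<open>
  The foliation defined by the direction field \<open>V\<close> off the divisor is nonsingular at the point \<open>a\<close>: near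
  \<open>a\<close> its leaves are tangent to a holomorphic vector field that does not vanish at \<open>a\<close>.
\<close>

definition foliation_nonsingular_at ::
  "('m::finite, 'v::finite) kov \<Rightarrow> (complex^'v) set \<Rightarrow> (complex^'v \<Rightarrow> complex^'v) \<Rightarrow> complex^'v \<Rightarrow> bool" where
  "foliation_nonsingular_at D S V a \<longleftrightarrow> (\<exists>W K. a \<in> W \<and> W \<subseteq> S \<and>
     (\<forall>v. holo_on (\<lambda>b. K b $ v) W) \<and> K a \<noteq> 0 \<and>
     (\<forall>b\<in>W - divisor D. \<exists>k. k \<noteq> 0 \<and> K b = k *s V b))"


section \<open>Laurent series solutions and linearizability\<close>

definition laurent_solution ::
  "('m::finite, 'v::finite) kov \<Rightarrow> complex \<Rightarrow> ('m \<Rightarrow> nat \<Rightarrow> complex) \<Rightarrow> bool" where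
  "laurent_solution D z0 A \<longleftrightarrow>
     (let x = (\<lambda>i z. cc D $ i * (z - z0) powi (- int (pw D i)) +
                     suminf (\<lambda>n. A i (Suc n) * (z - z0) powi (- int (pw D i) + int (Suc n))))
      in \<exists>\<rho>>0. \<forall>z i. 0 < norm (z - z0) \<and> norm (z - z0) < \<rho> \<longrightarrow>
           summable (\<lambda>n. A i (Suc n) * (z - z0) powi (- int (pw D i) + int (Suc n))) \<and>
           (x i has_field_derivative
              (fval D i (\<chi> l. x l z) z + gval D i (\<chi> l. x l z) z)) (at z))"

text \<open>
  A family with \<open>m - k + 1\<close> parameters, one of which (the slot \<open>q0\<close>) is \<open>z\<^sub>0\<close>: parameters range over a
  nonempty open set, the coefficients depend holomorphically on them, and the parameters are free
  in that distinct values give distinct series.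
\<close>

definition has_laurent_family :: "('m::finite, 'v::finite) kov \<Rightarrow> 'q::finite itself \<Rightarrow> bool" where
  "has_laurent_family D Q \<longleftrightarrow> CARD('q) = card (Uset D) + 1 \<and>
     (\<exists>(q0 :: 'q) (\<Omega> :: (complex^'q) set) A.
        open \<Omega> \<and> \<Omega> \<noteq> {} \<and>
        (\<forall>i n. 1 \<le> n \<longrightarrow> holo_on (\<lambda>\<theta>. A \<theta> i n) \<Omega>) \<and>
        (\<forall>\<theta>\<in>\<Omega>. laurent_solution D (\<theta> $ q0) (A \<theta>)) \<and>
        (\<forall>\<theta>\<in>\<Omega>. \<forall>\<theta>'\<in>\<Omega>. \<theta> $ q0 = \<theta>' $ q0 \<and> (\<forall>i n. 1 \<le> n \<longrightarrow> A \<theta> i n = A \<theta>' i n) \<longrightarrow> \<theta> = \<theta>'))"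

definition red_matrix :: "('m::finite, 'v::finite) kov \<Rightarrow> complex^'v^'v" where
  "red_matrix D = matrix (frechet_derivative (red_field D) (at 0))"

definition semisimple :: "complex^'n::finite^'n \<Rightarrow> bool" where
  "semisimple A \<longleftrightarrow> (\<exists>(P :: complex^'n^'n) (\<Delta> :: complex^'n^'n). invertible P \<and> (\<forall>a b. a \<noteq> b \<longrightarrow> \<Delta> $ a $ b = 0) \<and> A ** P = P ** \<Delta>)"

definition analytically_linearizable :: "('m::finite, 'v::finite) kov \<Rightarrow> bool" where
  "analytically_linearizable D \<longleftrightarrow> (\<exists>(W :: (complex^'v) set) (\<Theta> :: complex^'v \<Rightarrow> complex^'v).
     open W \<and> 0 \<in> W \<and> (\<forall>v. holo_on (\<lambda>q. \<Theta> q $ v) W) \<and> \<Theta> 0 = 0 \<and>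
     invertible (matrix (frechet_derivative \<Theta> (at 0))) \<and>
     (\<forall>q\<in>W. frechet_derivative \<Theta> (at q) (red_field D q) = red_matrix D *v \<Theta> q))"

end

theory Submission
  imports Defs "HOL-Complex_Analysis.Complex_Analysis"
begin

text \<open>
  Measured by \<open>\<tau> = e\<^sup>t\<close>, a solution emanating from the fixed point is a holomorphic curve \<open>q\<close> with
  \<open>q(0) = 0\<close> and \<open>\<tau> q' = V(q)\<close>, so its leading Taylor coefficient, of order \<open>n\<close>, is an eigenvector of
  \<open>DV(0)\<close> for the eigenvalue \<open>n\<close>.  Three facts follow.  Applied to the distance to the graph, this
  shows that such a curve lies on the unstable manifold, because the stable block has no positive
  eigenvalue.  Applied to the difference of two curves, it shows that a curve on the unstable
  manifold is determined by the coefficients \<open>u\<^sub>v\<close> of \<open>\<tau>\<^bsup>wt v\<^esup>\<close> in \<open>Y\<^sub>v\<close>.  Finally \<open>Y\<^sub>v\<close> vanishes to order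
  \<open>wt v\<close>, and comparing the coefficients of \<open>\<tau>\<^bsup>wt v\<^esup>\<close> in the normal form leaves \<open>G\<^sub>1(u) = 0\<close>: a resonance
  term would produce a logarithm.

  Both a linearization (a conjugation to \<open>\<tau>\<^sup>A\<close> with \<open>A\<close> diagonalizable) and a full family of Laurent
  solutions (with \<open>w = x\<^sub>j\<^bsup>-1/p\<^sub>j\<^esup>\<close> as the new time) supply families of such curves.  The
  coefficients \<open>u\<close> depend continuously and injectively on the parameters, so by invariance of
  domain they fill an open set, on which the weighted homogeneous polynomial \<open>G\<^sub>1\<close> vanishes.

  For \<open>N\<close> large, \<open>w\<^bsup>-1-\<lambda>\<^esup> G\<^sub>2\<close> is \<open>O(w\<^sup>2)\<close> near the divisor, hence its extension by \<open>0\<close> is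
  differentiable there with derivative \<open>0\<close>, and no removable singularity theorem is needed.
\<close>

section \<open>Complex differentiable maps\<close>

text \<open>In the variable \<tau> only the integer order of vanishing matters, and that order would
  have to be an eigenvalue. The analytic input is strict differentiability: for two points a, b near
  the fixed point, V(a) - V(b) - DV(0)(a - b) is a small multiple of a - b. Hence a difference
  \<delta> of two curves satisfies \<tau> \<delta>' = DV(0) \<delta> up to a term that is small
  compared with \<delta> itself, and the leading coefficients can be compared without an exact
  equation for \<delta>. The Laurent curves share one and the same coefficient in the slot of
  \<epsilon>, fixed by the chosen root of c_j. Their coefficients therefore fill an open subset of a
  slice \<epsilon> = const only; weighted homogeneity of G_1 carries the vanishing to the other
  slices.\<close>

no_notation fps_nth (infixl \<open>$\<close> 75)

text \<open>\<open>sa\<close> and \<open>sb\<close> are the complex scalings of the two real normed spaces.\<close>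

definition cdiff :: "(complex \<Rightarrow> 'a \<Rightarrow> 'a) \<Rightarrow> (complex \<Rightarrow> 'b \<Rightarrow> 'b) \<Rightarrow>
    ('a::real_normed_vector \<Rightarrow> 'b::real_normed_vector) \<Rightarrow> 'a \<Rightarrow> bool" where
  "cdiff sa sb f x \<longleftrightarrow> (\<exists>L. (f has_derivative L) (at x) \<and> (\<forall>k y. L (sa k y) = sb k (L y)))"

lemma holo_on_iff: "holo_on h S \<longleftrightarrow> open S \<and> (\<forall>x\<in>S. cdiff (*s) (*) h x)"
  unfolding holo_on_def cdiff_def by auto

lemma cdiff_frechet:
  assumes "cdiff sa sb f x"
  shows "(f has_derivative frechet_derivative f (at x)) (at x)"
    and "frechet_derivative f (at x) (sa k y) = sb k (frechet_derivative f (at x) y)"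
proof -
  obtain L where L: "(f has_derivative L) (at x)" "\<forall>k y. L (sa k y) = sb k (L y)"
    using assms unfolding cdiff_def by blast
  have eq: "L = frechet_derivative f (at x)"
    using frechet_derivative_at[OF L(1)] .
  show "(f has_derivative frechet_derivative f (at x)) (at x)"
    and "frechet_derivative f (at x) (sa k y) = sb k (frechet_derivative f (at x) y)"
    using L unfolding eq by auto
qed

lemma cdiff_continuous: "cdiff sa sb f x \<Longrightarrow> continuous (at x) f"
  unfolding cdiff_def using has_derivative_continuous by blast

lemma cdiff_compose:
  assumes "cdiff sa sb f x" "cdiff sb sc g (f x)"
  shows "cdiff sa sc (\<lambda>x. g (f x)) x"
proof -
  obtain L M where "(f has_derivative L) (at x)" "\<forall>k y. L (sa k y) = sb k (L y)"
    "(g has_derivative M) (at (f x))" "\<forall>k y. M (sb k y) = sc k (M y)"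
    using assms unfolding cdiff_def by blast
  then show ?thesis
    unfolding cdiff_def using has_derivative_compose[of f L x UNIV g M]
    by (intro exI[of _ "\<lambda>y. M (L y)"]) auto
qed

lemma cdiff_const: "cdiff sa (*) (\<lambda>_. c) x"
  unfolding cdiff_def by (intro exI[of _ "\<lambda>_. 0"]) auto

lemma cdiff_id: "cdiff sa sa (\<lambda>x. x) x"
  unfolding cdiff_def by (intro exI[of _ "\<lambda>y. y"]) auto

lemma cdiff_add:
  assumes "cdiff sa (*) f x" "cdiff sa (*) g x"
  shows "cdiff sa (*) (\<lambda>x. f x + g x) x"
proof -
  obtain L M where "(f has_derivative L) (at x)" "\<forall>k y. L (sa k y) = k * (L y)"
    "(g has_derivative M) (at x)" "\<forall>k y. M (sa k y) = k * (M y)"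
    using assms unfolding cdiff_def by blast
  then show ?thesis
    unfolding cdiff_def by (intro exI[of _ "\<lambda>y. L y + M y"]) (auto intro: has_derivative_add simp: algebra_simps)
qed

lemma cdiff_mult:
  assumes "cdiff sa (*) f x" "cdiff sa (*) g x"
  shows "cdiff sa (*) (\<lambda>x. f x * g x) x"
proof -
  obtain L M where "(f has_derivative L) (at x)" "\<forall>k y. L (sa k y) = k * (L y)"
    "(g has_derivative M) (at x)" "\<forall>k y. M (sa k y) = k * (M y)"
    using assms unfolding cdiff_def by blast
  then show ?thesis
    unfolding cdiff_def by (intro exI[of _ "\<lambda>y. f x * M y + L y * g x"]) (simp add: has_derivative_mult distrib_left mult.left_commute mult.assoc)
qed

lemma cdiff_inverse:
  assumes "cdiff sa (*) f x" "f x \<noteq> 0"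
  shows "cdiff sa (*) (\<lambda>x. inverse (f x)) x"
proof -
  obtain L where "(f has_derivative L) (at x)" "\<forall>k y. L (sa k y) = k * (L y)"
    using assms unfolding cdiff_def by blast
  then have "((\<lambda>x. inverse (f x)) has_derivative (\<lambda>y. - (inverse (f x) * L y * inverse (f x)))) (at x)"
    "\<forall>k y. - (inverse (f x) * L (sa k y) * inverse (f x)) = k * - (inverse (f x) * L y * inverse (f x))"
    using assms(2) by (auto intro: Deriv.has_derivative_inverse)
  then show ?thesis
    unfolding cdiff_def by blast
qed

lemma cdiff_divide:
  assumes "cdiff sa (*) f x" "cdiff sa (*) g x" "g x \<noteq> 0"
  shows "cdiff sa (*) (\<lambda>x. f x / g x) x"
  unfolding divide_inverse by (intro cdiff_mult cdiff_inverse assms)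

lemma cdiff_diff:
  assumes "cdiff sa (*) f x" "cdiff sa (*) g x"
  shows "cdiff sa (*) (\<lambda>x. f x - g x) x"
  using cdiff_add[OF assms(1) cdiff_mult[OF cdiff_const assms(2), of "-1"]] by simp

lemma cdiff_power:
  assumes "cdiff sa (*) f x"
  shows "cdiff sa (*) (\<lambda>x. f x ^ n) x"
  by (induction n) (auto intro: cdiff_mult cdiff_const assms)

lemma cdiff_sum:
  assumes "\<And>i. i \<in> I \<Longrightarrow> cdiff sa (*) (\<lambda>x. f i x) x"
  shows "cdiff sa (*) (\<lambda>x. \<Sum>i\<in>I. f i x) x"
  using assms by (induction I rule: infinite_finite_induct) (auto intro: cdiff_add cdiff_const)

lemma cdiff_prod:
  assumes "\<And>i. i \<in> I \<Longrightarrow> cdiff sa (*) (\<lambda>x. f i x) x"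
  shows "cdiff sa (*) (\<lambda>x. \<Prod>i\<in>I. f i x) x"
  using assms by (induction I rule: infinite_finite_induct) (auto intro: cdiff_mult cdiff_const)

lemma cdiff_peval:
  assumes "\<And>v. cdiff sa (*) (\<lambda>x. f x v) x"
  shows "cdiff sa (*) (\<lambda>x. peval P (f x)) x"
  unfolding peval_def by (intro cdiff_sum cdiff_prod cdiff_mult cdiff_power cdiff_const assms)

lemma cdiff_nth: "cdiff (*s) (*) (\<lambda>x. x $ i) x"
  unfolding cdiff_def
  by (intro exI[of _ "\<lambda>x. x $ i"]) (auto intro: bounded_linear_imp_has_derivative bounded_linear_vec_nth)

lemma cdiff_vec_iff: "cdiff sa (*s) f x \<longleftrightarrow> (\<forall>i. cdiff sa (*) (\<lambda>x. f x $ i) x)"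
proof
  assume "cdiff sa (*s) f x"
  then show "\<forall>i. cdiff sa (*) (\<lambda>x. f x $ i) x"
    using cdiff_compose cdiff_nth by blast
next
  assume R: "\<forall>i. cdiff sa (*) (\<lambda>x. f x $ i) x"
  then obtain L where L: "\<And>i. ((\<lambda>x. f x $ i) has_derivative L i) (at x)" "\<And>i k y. L i (sa k y) = k * L i y"
    unfolding cdiff_def by metis
  have eq: "y = (\<Sum>i\<in>UNIV. axis i (y $ i))" for y :: "complex^'b"
    by (simp add: vec_eq_iff axis_def sum.delta' if_distrib[of "\<lambda>z. z $ _"] cong: if_cong)
  have bl: "bounded_linear (axis i :: complex \<Rightarrow> complex^'b)" for i
  proof (rule bounded_linear_intro[where K = 1])
    fix x :: complex
    have "(\<Sum>j\<in>UNIV. (norm (if j = i then x else 0))\<^sup>2) = (\<Sum>j\<in>UNIV. if j = i then (norm x)\<^sup>2 else 0)"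
      by (intro sum.cong) auto
    then show "norm (axis i x :: complex^'b) \<le> norm x * 1"
      by (simp add: axis_def norm_vec_def L2_set_def)
  qed (auto simp: axis_def vec_eq_iff)
  have "((\<lambda>x. \<Sum>i\<in>UNIV. axis i (f x $ i)) has_derivative (\<lambda>y. \<Sum>i\<in>UNIV. axis i (L i y))) (at x)"
    by (intro has_derivative_sum bounded_linear.has_derivative[OF bl] L)
  then have "(f has_derivative (\<lambda>y. \<Sum>i\<in>UNIV. axis i (L i y))) (at x)"
    by (simp flip: eq)
  moreover have "(\<Sum>i\<in>UNIV. axis i (L i (sa k y))) = k *s (\<Sum>i\<in>UNIV. axis i (L i y))" for k y
    by (simp add: vec_eq_iff axis_def L(2) sum_distrib_left if_distrib cong: if_cong)
  ultimately show "cdiff sa (*s) f x"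
    unfolding cdiff_def by blast
qed

lemma cdiff_Pair:
  assumes "cdiff sa (*s) f x" "cdiff sa (*) g x" "cdiff sa (*) h x"
  shows "cdiff sa cscale (\<lambda>x. (f x, g x, h x)) x"
proof -
  obtain L M K where "(f has_derivative L) (at x)" "\<forall>k y. L (sa k y) = k *s (L y)"
    "(g has_derivative M) (at x)" "\<forall>k y. M (sa k y) = k * (M y)"
    "(h has_derivative K) (at x)" "\<forall>k y. K (sa k y) = k * (K y)"
    using assms unfolding cdiff_def by blast
  then show ?thesis
    unfolding cdiff_def by (intro exI[of _ "\<lambda>y. (L y, M y, K y)"]) (auto intro!: has_derivative_Pair simp: cscale_def)
qed

lemma cdiff_cscale_comps:
  "cdiff cscale (*s) fst p" "cdiff cscale (*) (\<lambda>p. fst (snd p)) p" "cdiff cscale (*) (\<lambda>p. snd (snd p)) p"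
  unfolding cdiff_def
  by (rule exI conjI allI bounded_linear_imp_has_derivative
    bounded_linear_fst bounded_linear_compose[OF bounded_linear_fst bounded_linear_snd]
    bounded_linear_compose[OF bounded_linear_snd bounded_linear_snd] | force simp: cscale_def)+

text \<open>A complex-linear map of the complex line is multiplication by its value at 1. This is
  the passage to the library notion, and so to Cauchy estimates and power series.\<close>

lemma cdiff_field: "cdiff (*) (*) f x \<longleftrightarrow> f field_differentiable (at x)"
proof
  assume "cdiff (*) (*) f x"
  then obtain L where L: "(f has_derivative L) (at x)" "\<And>k y. L (k * y) = k * L y"
    unfolding cdiff_def by blast
  then have "L = (*) (L 1)"
    by (metis L(2) mult.right_neutral mult.commute ext)
  then show "f field_differentiable (at x)"
    using L(1) unfolding field_differentiable_def has_field_derivative_def by metis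
next
  assume "f field_differentiable (at x)"
  then show "cdiff (*) (*) f x"
    unfolding field_differentiable_def has_field_derivative_def cdiff_def
    by (metis mult.left_commute)
qed

lemma cdiff_cong_open:
  assumes "cdiff sa sb f x" "open S" "x \<in> S" "\<And>y. y \<in> S \<Longrightarrow> f y = g y"
  shows "cdiff sa sb g x"
  using assms has_derivative_transform_within_open unfolding cdiff_def by blast

text \<open>The Cauchy estimate along the complex line through the two points suffices.\<close>

lemma strict_derivative:
  fixes f :: "'a::real_normed_vector \<Rightarrow> complex"
  assumes S: "open S" "x0 \<in> S" and holo: "\<And>x. x \<in> S \<Longrightarrow> cdiff sc (*) f x"
    and sc: "\<And>y. bounded_linear (\<lambda>k. sc k y)" "\<And>y. sc 1 y = y" "\<And>k y. norm (sc k y) = norm k * norm y"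
      "\<And>k l y. sc (k * l) y = sc k (sc l y)"
    and "e > 0"
  shows "\<exists>d>0. ball x0 d \<subseteq> S \<and> (\<forall>x\<in>ball x0 d. \<forall>y\<in>ball x0 d.
     norm (f x - f y - frechet_derivative f (at x0) (x - y)) \<le> e * norm (x - y))"
proof -
  define L where "L = frechet_derivative f (at x0)"
  have L: "(f has_derivative L) (at x0)" "\<And>k y. L (sc k y) = k * L y"
    using cdiff_frechet[OF holo[OF S(2)]] unfolding L_def by auto
  then interpret L: bounded_linear L by (simp add: has_derivative_bounded_linear)
  \<comment> \<open>Subtracting the affine part leaves a map with derivative 0 at \<open>x0\<close>;
    what is needed is a Lipschitz bound for it with small constant.\<close>
  define g where "g x = f x - f x0 - L (x - x0)" for x
  have holog: "cdiff sc (*) g x" if "x \<in> S" for x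
  proof -
    have "cdiff sc (*) (\<lambda>x. L (x - x0)) x"
      unfolding cdiff_def
      by (rule exI[of _ L]) (auto simp: L(2) L.diff intro!: has_derivative_eq_rhs[OF has_derivative_diff[OF L.has_derivative[OF has_derivative_ident] has_derivative_const]])
    then show ?thesis
      unfolding g_def by (intro cdiff_diff cdiff_const holo that)
  qed
  obtain r0 where r0: "r0 > 0" "ball x0 r0 \<subseteq> S"
    using S by (meson open_contains_ball)
  obtain r1 where r1: "r1 > 0" "\<And>y. norm (y - x0) < r1 \<Longrightarrow> norm (g y) \<le> e / 8 * norm (y - x0)"
  proof -
    have "e / 8 > 0" using \<open>e > 0\<close> by simp
    then show ?thesis
      using that L(1) unfolding has_derivative_at_alt g_def by blast
  qed
  define r where "r = min r0 r1 / 2"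
  have r: "r > 0" "2 * r \<le> r0" "2 * r \<le> r1" using r0 r1 by (auto simp: r_def)
  show ?thesis unfolding L_def[symmetric]
  proof (intro exI[of _ "r/4"] conjI ballI)
    show "r / 4 > 0" using r by simp
    show "ball x0 (r / 4) \<subseteq> S"
      using r by (intro order.trans[OF subset_ball r0(2)]) auto
    fix x y assume x: "x \<in> ball x0 (r / 4)" and y: "y \<in> ball x0 (r / 4)"
    show "norm (f x - f y - L (x - y)) \<le> e * norm (x - y)"
    proof (cases "x = y")
      case True then show ?thesis by (simp add: L.zero)
    next
      case False
      define n where "n = norm (x - y)"
      have n: "n > 0" "n < r / 2"
        using False x y norm_triangle_ineq4[of "x - x0" "y - x0"] unfolding n_def by (auto simp: dist_norm norm_minus_commute)
      \<comment> \<open>The direction \<open>x - y\<close> is rescaled to norm r. For |s| \<le> 1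
        the point \<open>y + sc s u\<close> stays within 2r of \<open>x0\<close>, and x is reached
        at s = n/r < 1/2, inside the disc where Cauchy's inequality bounds the derivative.\<close>
      define u where "u = sc (complex_of_real (r / n)) (x - y)"
      have nu: "norm u = r" using n r(1) unfolding u_def sc(3) n_def[symmetric] norm_of_real by simp
      have pt: "norm (y + sc s u - x0) < 2 * r" if "norm s \<le> 1" for s
      proof -
        have "norm (y + sc s u - x0) \<le> norm (y - x0) + norm (sc s u)"
          using norm_triangle_ineq[of "y - x0" "sc s u"] by (simp add: algebra_simps)
        also have "\<dots> < r / 4 + 1 * r"
        proof -
          have "norm s * r \<le> r" using that r(1) by simp
          moreover have "norm (y - x0) < r / 4" using y by (simp add: dist_norm norm_minus_commute)
          ultimately show ?thesis unfolding sc(3) nu by linarith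
        qed
        also have "\<dots> < 2 * r" using r(1) by simp
        finally show ?thesis .
      qed
      define \<phi> where "\<phi> s = g (y + sc s u)" for s
      have hol: "\<phi> field_differentiable (at s)" if "norm s \<le> 1" for s
      proof -
        have "cdiff (*) sc (\<lambda>s. y + sc s u) s"
          unfolding cdiff_def
          by (rule exI[of _ "\<lambda>s. sc s u"]) (auto simp: sc(4) intro!: has_derivative_eq_rhs[OF has_derivative_add[OF has_derivative_const bounded_linear.has_derivative[OF sc(1) has_derivative_ident]]])
        moreover have "y + sc s u \<in> S" using pt[OF that] r r0 by (auto simp: dist_norm norm_minus_commute)
        ultimately show ?thesis
          unfolding \<phi>_def cdiff_field[symmetric] using cdiff_compose holog by blast
      qed
      have bd: "norm (\<phi> s) \<le> e / 4 * r" if "norm s \<le> 1" for s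
      proof -
        have "norm (\<phi> s) \<le> e / 8 * norm (y + sc s u - x0)"
          unfolding \<phi>_def using pt[OF that] r by (intro r1) auto
        also have "\<dots> \<le> e / 8 * (2 * r)"
          using pt[OF that] \<open>e > 0\<close> by (intro mult_left_mono) auto
        finally show ?thesis by simp
      qed
      have der: "norm (deriv \<phi> s) \<le> e * r" if "s \<in> ball 0 (1/2)" for s
      proof -
        have sub: "norm z \<le> 1" if "z \<in> cball s (1/2)" for z
          using that \<open>s \<in> ball 0 (1/2)\<close> norm_triangle_ineq[of "z - s" s] by (auto simp: dist_norm norm_minus_commute)
        \<comment> \<open>Cauchy's inequality on a disc of radius 1/2 doubles the bound e r /
          4.\<close>
        have "norm ((deriv ^^ 1) \<phi> s) \<le> fact 1 * (e / 4 * r) / (1/2) ^ 1"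
        proof (rule Cauchy_inequality)
          show "\<phi> holomorphic_on ball s (1/2)"
            unfolding holomorphic_on_def using hol sub by (auto intro: field_differentiable_at_within)
          show "continuous_on (cball s (1/2)) \<phi>"
            using hol sub by (meson continuous_at_imp_continuous_on field_differentiable_imp_continuous_at)
          show "norm (\<phi> x) \<le> e / 4 * r" if "norm (s - x) = 1/2" for x
            using bd sub that by (simp add: dist_norm)
        qed simp
        also have "\<dots> \<le> e * r" using \<open>e > 0\<close> r by simp
        finally show ?thesis by simp
      qed
      have "norm (\<phi> (of_real (n / r)) - \<phi> 0) \<le> e * r * norm (complex_of_real (n / r) - 0)"
      proof (rule field_differentiable_bound[where S = "ball 0 (1/2)" and f' = "deriv \<phi>"])
        show "(\<phi> has_field_derivative deriv \<phi> z) (at z within ball 0 (1/2))" if "z \<in> ball 0 (1/2)" for z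
          using hol[of z] that by (auto intro: has_field_derivative_at_within field_differentiable_derivI)
        show "complex_of_real (n / r) \<in> ball 0 (1/2)"
          using n r(1) by (simp add: norm_divide)
      qed (use der in auto)
      also have "\<dots> = e * n" using n r(1) by (simp add: norm_divide)
      also have "\<phi> (of_real (n / r)) = g x"
        using n r(1) sc(2)[of "x - y"] by (simp add: \<phi>_def u_def flip: sc(4))
      also have "\<phi> 0 = g y"
        using sc(3)[of 0 u] by (simp add: \<phi>_def)
      also have "g x - g y = f x - f y - L (x - y)"
        by (simp add: g_def L.diff)
      finally show ?thesis by (simp add: n_def)
    qed
  qed
qed

lemma norm_vector_smult: "norm (k *s y :: complex^'n::finite) = norm k * norm y"
  unfolding norm_vec_def by (simp add: norm_mult L2_set_right_distrib)

lemma bounded_linear_vector_smult: "bounded_linear (\<lambda>k. k *s (y :: complex^'n::finite))"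
  by (rule bounded_linear_intro[where K = "norm y"])
     (auto simp: norm_vector_smult vec_eq_iff algebra_simps)

lemma norm_cscale: "norm (cscale k p) = norm k * norm p"
proof -
  obtain x Z e where p: "p = (x, Z, e)" by (cases p)
  have "norm (cscale k p) = sqrt ((norm k)\<^sup>2 * ((norm x)\<^sup>2 + ((norm Z)\<^sup>2 + (norm e)\<^sup>2)))"
    by (simp add: p cscale_def norm_Pair norm_vector_smult norm_mult power_mult_distrib algebra_simps)
  then show ?thesis
    by (simp add: p norm_Pair real_sqrt_mult)
qed

lemma bounded_linear_cscale: "bounded_linear (\<lambda>k. cscale k p)"
  by (rule bounded_linear_intro[where K = "norm p"])
     (auto simp: norm_cscale, auto simp: cscale_def vec_eq_iff algebra_simps split: prod.splits)

text \<open>Both points vary. This is what lets the difference of two solutions be compared with the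
  linear equation, with an error proportional to that difference.\<close>

definition strictly_differentiable ::
  "('a::real_normed_vector \<Rightarrow> 'b::real_normed_vector) \<Rightarrow> ('a \<Rightarrow> 'b) \<Rightarrow> 'a \<Rightarrow> bool" where
  "strictly_differentiable f L x0 \<longleftrightarrow> (\<forall>e>0. \<exists>d>0. \<forall>x\<in>ball x0 d. \<forall>y\<in>ball x0 d.
     norm (f x - f y - L (x - y)) \<le> e * norm (x - y))"

lemma norm_vec_le_sum: "norm (z :: complex^'n::finite) \<le> (\<Sum>i\<in>UNIV. norm (z $ i))"
  unfolding norm_vec_def by (rule L2_set_le_sum) auto

lemma strictly_differentiable_vec:
  fixes f :: "'a::real_normed_vector \<Rightarrow> complex^'n::finite"
  assumes "\<And>i. strictly_differentiable (\<lambda>x. f x $ i) (\<lambda>y. L y $ i) x0"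
  shows "strictly_differentiable f L x0"
  unfolding strictly_differentiable_def
proof (intro allI impI)
  fix e :: real assume "e > 0"
  define c where "c = e / CARD('n)"
  have c: "c > 0" using \<open>e > 0\<close> by (simp add: c_def)
  have "\<forall>i. \<exists>d. d > 0 \<and> (\<forall>x\<in>ball x0 d. \<forall>y\<in>ball x0 d.
      norm (f x $ i - f y $ i - L (x - y) $ i) \<le> c * norm (x - y))"
    using assms c unfolding strictly_differentiable_def by blast
  from choice[OF this] obtain d where d: "\<And>i. d i > 0" "\<And>i x y. x \<in> ball x0 (d i) \<Longrightarrow> y \<in> ball x0 (d i) \<Longrightarrow>
      norm (f x $ i - f y $ i - L (x - y) $ i) \<le> c * norm (x - y)"
    by blast
  show "\<exists>d>0. \<forall>x\<in>ball x0 d. \<forall>y\<in>ball x0 d. norm (f x - f y - L (x - y)) \<le> e * norm (x - y)"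
  proof (intro exI[of _ "Min (range d)"] conjI ballI)
    show "Min (range d) > 0" using d(1) by (subst Min_gr_iff) auto
    fix x y assume xy: "x \<in> ball x0 (Min (range d))" "y \<in> ball x0 (Min (range d))"
    have le: "Min (range d) \<le> d i" for i by simp
    have "norm (f x - f y - L (x - y)) \<le> (\<Sum>i\<in>(UNIV::'n set). norm ((f x - f y - L (x - y)) $ i))"
      by (rule norm_vec_le_sum)
    also have "\<dots> \<le> (\<Sum>i\<in>(UNIV::'n set). c * norm (x - y))"
      using xy le by (intro sum_mono) (simp, rule d(2), auto intro: less_le_trans)
    also have "\<dots> = e * norm (x - y)" by (simp add: c_def)
    finally show "norm (f x - f y - L (x - y)) \<le> e * norm (x - y)" .
  qed
qed

lemma frechet_derivative_nth:
  fixes f :: "'a::real_normed_vector \<Rightarrow> complex^'n::finite"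
  assumes "f differentiable (at x)"
  shows "frechet_derivative (\<lambda>x. f x $ i) (at x) y = frechet_derivative f (at x) y $ i"
proof -
  have "((\<lambda>x. f x $ i) has_derivative (\<lambda>y. frechet_derivative f (at x) y $ i)) (at x)"
    using assms unfolding frechet_derivative_works
    by (rule bounded_linear.has_derivative[OF bounded_linear_vec_nth])
  from frechet_derivative_at[OF this] show ?thesis by metis
qed

lemma cdiff_differentiable: "cdiff sa sb f x \<Longrightarrow> f differentiable (at x)"
  unfolding cdiff_def differentiable_def by blast

text \<open>The scaling \<open>sc\<close> of the domain stays a parameter because the result is used
  on vectors with \<open>*s\<close> and on the chart space with \<open>cscale\<close>.\<close>

lemma holomorphic_strictly_differentiable:
  fixes f :: "'a::real_normed_vector \<Rightarrow> complex^'n::finite"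
  assumes S: "open S" "x0 \<in> S" and holo: "\<And>x. x \<in> S \<Longrightarrow> cdiff sc (*s) f x"
    and sc: "\<And>y. bounded_linear (\<lambda>k. sc k y)" "\<And>y. sc 1 y = y" "\<And>k y. norm (sc k y) = norm k * norm y"
      "\<And>k l y. sc (k * l) y = sc k (sc l y)"
  shows "strictly_differentiable f (frechet_derivative f (at x0)) x0"
proof (rule strictly_differentiable_vec)
  fix i
  have "strictly_differentiable (\<lambda>x. f x $ i) (frechet_derivative (\<lambda>x. f x $ i) (at x0)) x0"
    unfolding strictly_differentiable_def
    using strict_derivative[OF S, of sc "\<lambda>x. f x $ i", OF _ sc] holo unfolding cdiff_vec_iff by blast
  moreover have "frechet_derivative (\<lambda>x. f x $ i) (at x0) = (\<lambda>y. frechet_derivative f (at x0) y $ i)"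
    by (rule ext) (rule frechet_derivative_nth[OF cdiff_differentiable[OF holo[OF S(2)]]])
  ultimately show "strictly_differentiable (\<lambda>x. f x $ i) (\<lambda>y. frechet_derivative f (at x0) y $ i) x0"
    by simp
qed

lemma holo_vec_strictly_differentiable:
  fixes f :: "complex^'a::finite \<Rightarrow> complex^'n::finite"
  assumes "open S" "x0 \<in> S" and "\<And>x. x \<in> S \<Longrightarrow> cdiff (*s) (*s) f x"
  shows "strictly_differentiable f (frechet_derivative f (at x0)) x0"
  by (rule holomorphic_strictly_differentiable[OF assms])
     (auto simp: norm_vector_smult bounded_linear_vector_smult vector_smult_assoc)

lemma strictly_differentiable_lipschitz:
  assumes "strictly_differentiable f L x0" "bounded_linear L"
  obtains d K where "d > 0" "K > 0" "\<And>x y. x \<in> ball x0 d \<Longrightarrow> y \<in> ball x0 d \<Longrightarrow> norm (f x - f y) \<le> K * norm (x - y)"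
proof -
  obtain d where d: "d > 0" "\<And>x y. x \<in> ball x0 d \<Longrightarrow> y \<in> ball x0 d \<Longrightarrow> norm (f x - f y - L (x - y)) \<le> 1 * norm (x - y)"
    using assms(1) unfolding strictly_differentiable_def by (meson zero_less_one)
  obtain K where K: "K > 0" "\<And>x. norm (L x) \<le> norm x * K"
    using bounded_linear.pos_bounded[OF assms(2)] by blast
  have "norm (f x - f y) \<le> (K + 1) * norm (x - y)" if "x \<in> ball x0 d" "y \<in> ball x0 d" for x y
    using d(2)[OF that] K(2)[of "x - y"] norm_triangle_ineq[of "f x - f y - L (x - y)" "L (x - y)"]
    by (simp add: algebra_simps)
  then show ?thesis using that d(1) K(1) by (metis add_pos_pos zero_less_one)
qed

text \<open>Testing strict differentiability at x and x + t y for small t bounds the difference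
  quotient, hence the derivative at x itself. This plays the role of continuity of the
  derivative.\<close>

lemma strictly_differentiable_derivative:
  assumes f: "strictly_differentiable f L x0" and "bounded_linear L" and "e > 0"
  shows "\<exists>d>0. \<forall>x\<in>ball x0 d. \<forall>L'. (f has_derivative L') (at x) \<longrightarrow> (\<forall>y. norm (L' y - L y) \<le> e * norm y)"
proof -
  interpret L: bounded_linear L by fact
  obtain d where d: "d > 0" "\<And>x y. x \<in> ball x0 d \<Longrightarrow> y \<in> ball x0 d \<Longrightarrow> norm (f x - f y - L (x - y)) \<le> e/2 * norm (x - y)"
    using f \<open>e > 0\<close> unfolding strictly_differentiable_def by (meson half_gt_zero)
  have "norm (L' y - L y) \<le> e * norm y" if x: "x \<in> ball x0 d" and L': "(f has_derivative L') (at x)" for x L' y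
  proof -
    interpret L': bounded_linear L' using L' has_derivative_bounded_linear by blast
    obtain r where r: "r > 0" "\<And>z. norm (z - x) < r \<Longrightarrow> norm (f z - f x - L' (z - x)) \<le> e/2 * norm (z - x)"
      using L' \<open>e > 0\<close> unfolding has_derivative_at_alt by (meson half_gt_zero)
    obtain r' where r': "r' > 0" "ball x r' \<subseteq> ball x0 d"
      using x by (meson open_ball open_contains_ball)
    define t where "t = min r r' / 2 / (norm y + 1)"
    have t: "t > 0" using r r' by (simp add: t_def add_nonneg_pos)
    have "t * norm y \<le> t * (norm y + 1)" using t by simp
    also have "\<dots> = min r r' / 2"
      unfolding t_def by (simp add: add_nonneg_eq_0_iff divide_simps)
    finally have ty: "t * norm y < r" "t * norm y < r'" using r(1) r'(1) by auto
    define z where "z = x + t *\<^sub>R y"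
    have "z \<in> ball x0 d" using ty r'(2) t by (auto simp: z_def dist_norm subset_iff)
    from d(2)[OF this x] have 1: "norm (f z - f x - t *\<^sub>R L y) \<le> e/2 * (t * norm y)"
      using t by (simp add: z_def L.scaleR)
    have 2: "norm (f z - f x - t *\<^sub>R L' y) \<le> e/2 * (t * norm y)"
      using r(2)[of z] ty t by (simp add: z_def L'.scaleR)
    have "t * norm (L' y - L y) = norm ((f z - f x - t *\<^sub>R L y) - (f z - f x - t *\<^sub>R L' y))"
      using t by (simp flip: scaleR_diff_right)
    also have "\<dots> \<le> e/2 * (t * norm y) + e/2 * (t * norm y)"
      by (intro order.trans[OF norm_triangle_ineq4] add_mono 1 2)
    also have "\<dots> = t * (e * norm y)" by simp
    finally show ?thesis using t by simp
  qed
  then show ?thesis using d(1) by blast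
qed

text \<open>An injective derivative satisfies |L x| \<ge> B |x|, and strict differentiability hands
  half of this lower bound to f near \<open>x0\<close>. So f is injective there with Lipschitz
  inverse, its image is open by invariance of domain, and the inverse is differentiable with
  complex-linear derivative.\<close>

lemma holomorphic_inverse_function:
  fixes f :: "complex^'n::finite \<Rightarrow> complex^'n"
  assumes W: "open W" "x0 \<in> W" and holo: "\<And>x. x \<in> W \<Longrightarrow> cdiff (*s) (*s) f x"
    and inj: "\<And>y. frechet_derivative f (at x0) y = 0 \<Longrightarrow> y = 0"
  obtains V c where "open V" "x0 \<in> V" "V \<subseteq> W" "inj_on f V" "open (f ` V)" "c > 0"
    "\<And>x y. x \<in> V \<Longrightarrow> y \<in> V \<Longrightarrow> norm (x - y) \<le> c * norm (f x - f y)"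
    "\<And>y. y \<in> f ` V \<Longrightarrow> cdiff (*s) (*s) (inv_into V f) y"
proof -
  define L where "L = frechet_derivative f (at x0)"
  have "(f has_derivative L) (at x0)"
    unfolding L_def by (rule cdiff_frechet(1)[OF holo[OF W(2)]])
  then interpret L: bounded_linear L by (rule has_derivative_bounded_linear)
  have strict: "strictly_differentiable f L x0"
    unfolding L_def by (rule holo_vec_strictly_differentiable[OF W holo])
  have "inj L"
    using inj L.diff by (intro injI) (metis L_def right_minus_eq)
  then obtain B where B: "B > 0" "\<And>x. norm x * B \<le> norm (L x)"
    using linear_inj_bounded_below_pos[OF L.linear] by (metis mult.commute)
  obtain d0 where d0: "d0 > 0" "ball x0 d0 \<subseteq> W" using W open_contains_ball by blast
  obtain d1 where d1: "d1 > 0" "\<And>x y. x \<in> ball x0 d1 \<Longrightarrow> y \<in> ball x0 d1 \<Longrightarrow>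
      norm (f x - f y - L (x - y)) \<le> B / 2 * norm (x - y)"
    using strict B(1) unfolding strictly_differentiable_def by (meson half_gt_zero)
  define V where "V = ball x0 (min d0 d1)"
  have V: "open V" "x0 \<in> V" "V \<subseteq> W" "V \<subseteq> ball x0 d1"
    using d0 d1(1) by (auto simp: V_def)
  have low: "norm (x - y) \<le> 2 / B * norm (f x - f y)" if "x \<in> V" "y \<in> V" for x y
  proof -
    have "norm (f x - f y - L (x - y)) \<le> B / 2 * norm (x - y)"
      using d1(2) that V(4) by blast
    then have "B / 2 * norm (x - y) \<le> norm (f x - f y)"
      using B(2)[of "x - y"] norm_triangle_ineq2[of "L (x - y)" "L (x - y) - (f x - f y)"]
      by (simp add: norm_minus_commute algebra_simps)
    then show ?thesis using B(1) by (simp add: field_simps)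
  qed
  have injV: "inj_on f V"
    by (rule inj_onI) (use low in fastforce)
  have "continuous_on V f"
    using holo V(3) by (meson cdiff_continuous continuous_at_imp_continuous_on subsetD)
  then have opn: "open (f ` V)"
    using V(1) injV by (rule invariance_of_domain)
  have "cdiff (*s) (*s) (inv_into V f) y" if y: "y \<in> f ` V" for y
  proof -
    define g where "g = inv_into V f"
    have gV: "g z \<in> V" "f (g z) = z" if "z \<in> f ` V" for z
      using that unfolding g_def by (auto intro: inv_into_into f_inv_into_f)
    have glip: "norm (g z - g z') \<le> 2 / B * norm (z - z')" if "z \<in> f ` V" "z' \<in> f ` V" for z z'
      using low[of "g z" "g z'"] gV that by auto
    define M where "M = frechet_derivative f (at (g y))"
    have M: "(f has_derivative M) (at (g y))" "\<And>k x. M (k *s x) = k *s M x"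
      unfolding M_def using gV[OF y] V(3) by (blast intro: cdiff_frechet[OF holo])+
    then interpret M: bounded_linear M using has_derivative_bounded_linear by blast
    \<comment> \<open>The lower bound for f on \<open>V\<close> passes to its derivative at every
      point of \<open>V\<close>; this makes the derivative injective, hence invertible in finite
      dimension.\<close>
    have Mlow: "B / 2 * norm x \<le> norm (M x)" for x
    proof -
      have "B / 2 * norm x - norm (M x) \<le> e" if "e > 0" for e
      proof -
        define e' where "e' = e / (norm x + 1)"
        have e': "e' > 0" "e' * norm x \<le> e"
        proof -
          have pos: "norm x + 1 > 0" by (simp add: add_nonneg_pos)
          then show "e' > 0" using that by (simp add: e'_def)
          then have "e' * norm x \<le> e' * (norm x + 1)" by simp
          also have "\<dots> = e" using pos by (simp add: e'_def)
          finally show "e' * norm x \<le> e" .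
        qed
        obtain r where r: "r > 0" "\<And>z. norm (z - g y) < r \<Longrightarrow> norm (f z - f (g y) - M (z - g y)) \<le> e' * norm (z - g y)"
          using M(1) e'(1) unfolding has_derivative_at_alt by blast
        obtain r' where r': "r' > 0" "ball (g y) r' \<subseteq> V"
          using gV(1)[OF y] V(1) by (meson open_contains_ball)
        define t where "t = min r r' / 2 / (norm x + 1)"
        have t: "t > 0" using r r' by (simp add: t_def add_nonneg_pos)
        have "t * norm x \<le> t * (norm x + 1)" using t by simp
        also have "\<dots> = min r r' / 2"
          unfolding t_def by (simp add: add_nonneg_eq_0_iff divide_simps)
        finally have tx: "t * norm x < r" "t * norm x < r'" using r(1) r'(1) by auto
        define z where "z = g y + t *\<^sub>R x"
        have "z \<in> V" using tx r'(2) t by (auto simp: z_def dist_norm subset_iff)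
        from low[OF this gV(1)[OF y]] have "B / 2 * (t * norm x) \<le> norm (f z - f (g y))"
          using t B(1) by (simp add: z_def field_simps)
        moreover have "norm (f z - f (g y) - t *\<^sub>R M x) \<le> e' * (t * norm x)"
          using r(2)[of z] tx t by (simp add: z_def M.scaleR)
        ultimately have "B / 2 * (t * norm x) \<le> t * norm (M x) + e' * (t * norm x)"
          using t norm_triangle_ineq[of "f z - f (g y) - t *\<^sub>R M x" "t *\<^sub>R M x"] by simp
        then have "t * (B / 2 * norm x) \<le> t * (norm (M x) + e' * norm x)" by (simp add: algebra_simps)
        then show ?thesis using t e'(2) by simp
      qed
      then show ?thesis by (meson diff_le_0_iff_le field_le_epsilon add_0 less_eq_real_def dense_ge)
    qed
    have injM: "inj M"
    proof (rule injI)
      fix a b assume "M a = M b"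
      then have "M (a - b) = 0" by (simp add: M.diff)
      with Mlow[of "a - b"] B(1) show "a = b" by (simp add: mult_le_0_iff)
    qed
    then obtain M' where M': "linear M'" "M' \<circ> M = id" "M \<circ> M' = id"
      using linear_injective_isomorphism[OF M.linear] by (metis comp_apply eq_id_iff)
    have "(g has_derivative M') (at y)"
    proof (rule has_derivative_inverse_basic[OF M(1) _ M'(2) _ opn y gV(2)])
      show "bounded_linear M'" using M'(1) linear_conv_bounded_linear by blast
      show "continuous (at y) g"
      proof -
        have "(2 / B)-lipschitz_on (f ` V) g"
          using glip B(1) by (intro lipschitz_onI) (auto simp: dist_norm)
        then show ?thesis
          using lipschitz_on_continuous_on opn y continuous_on_eq_continuous_at by blast
      qed
    qed auto
    moreover have "M' (k *s x) = k *s M' x" for k x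
      using M(2)[of k "M' x"] M'(2,3) by (metis comp_apply id_apply)
    ultimately show ?thesis unfolding cdiff_def g_def by blast
  qed
  then show ?thesis
    using that[of V "2 / B"] V injV opn low B(1) by auto
qed

section \<open>Polynomials and leading coefficients\<close>

lemma peval_UNIV:
  fixes P :: "'v::finite mpoly"
  shows "peval P y = (\<Sum>n\<in>Poly_Mapping.keys P. Poly_Mapping.lookup P n * (\<Prod>v\<in>UNIV. y v ^ Poly_Mapping.lookup n v))"
  unfolding peval_def
  by (intro sum.cong refl arg_cong2[of _ _ _ _ "(*)"] prod.mono_neutral_left) (auto simp: not_in_keys_iff_lookup_eq_zero)

text \<open>Replacing y_a by 2 y_a multiplies the monomial l by 2^(l a). Subtracting 2^(n a) times
  the relation removes the monomial n and multiplies the coefficient of k by a factor that is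
  nonzero when k and n differ at a. Induction on the number of monomials kills all coefficients but
  that of n.\<close>

lemma monomials_independent:
  fixes c :: "('v::finite \<Rightarrow>\<^sub>0 nat) \<Rightarrow> complex"
  assumes "finite K" and "\<And>y. (\<Sum>n\<in>K. c n * (\<Prod>v\<in>UNIV. y v ^ Poly_Mapping.lookup n v)) = 0" and "n \<in> K"
  shows "c n = 0"
  using assms
proof (induction "card K" arbitrary: K c n rule: less_induct)
  case less
  let ?m = "\<lambda>n y. (\<Prod>v\<in>UNIV. y v ^ Poly_Mapping.lookup n v) :: complex"
  have others: "c k = 0" if k: "k \<in> K" "k \<noteq> n" for k
  proof -
    obtain a where a: "Poly_Mapping.lookup k a \<noteq> Poly_Mapping.lookup n a"
      using k(2) poly_mapping_eqI by metis
    define c' where "c' l = c l * (2 ^ Poly_Mapping.lookup l a - 2 ^ Poly_Mapping.lookup n a)" for l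
    have "(\<Sum>l\<in>K - {n}. c' l * ?m l y) = 0" for y
    proof -
      define y' where "y' = y(a := 2 * y a)"
      have m': "?m l y' = 2 ^ Poly_Mapping.lookup l a * ?m l y" for l
        using prod.remove[of UNIV a "\<lambda>v. y' v ^ Poly_Mapping.lookup l v"]
          prod.remove[of UNIV a "\<lambda>v. y v ^ Poly_Mapping.lookup l v"]
        by (simp add: y'_def power_mult_distrib)
      have "(\<Sum>l\<in>K. c' l * ?m l y) = (\<Sum>l\<in>K. c l * ?m l y') - 2 ^ Poly_Mapping.lookup n a * (\<Sum>l\<in>K. c l * ?m l y)"
        unfolding c'_def m' sum_distrib_left sum_subtractf[symmetric]
        by (intro sum.cong refl) (simp add: algebra_simps)
      also have "\<dots> = 0" using less.prems(2) by simp
      finally show ?thesis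
        using less.prems(1,3) by (simp add: sum.remove c'_def)
    qed
    moreover have "card (K - {n}) < card K"
      using less.prems(1,3) by (rule card_Diff1_less)
    ultimately have "c' k = 0"
      using less.prems(1) k by (intro less.hyps[of "K - {n}" c' k]) simp_all
    moreover have "(2::complex) ^ Poly_Mapping.lookup k a \<noteq> 2 ^ Poly_Mapping.lookup n a"
    proof -
      have "(of_nat (2 ^ Poly_Mapping.lookup k a) :: complex) \<noteq> of_nat (2 ^ Poly_Mapping.lookup n a)"
        using a by (simp only: of_nat_eq_iff) simp
      then show ?thesis by simp
    qed
    ultimately show ?thesis by (simp add: c'_def)
  qed
  \<comment> \<open>At the point with all coordinates 1 only the coefficient of n is left.\<close>
  have "(\<Sum>k\<in>K. c k * ?m k (\<lambda>_. 1)) = 0" by (rule less.prems(2))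
  then show "c n = 0"
    using less.prems(1,3) others by (simp add: sum.remove)
qed

lemma peval_eq_0_imp_eq_0:
  fixes P :: "'v::finite mpoly"
  assumes "\<And>y. peval P y = 0"
  shows "P = 0"
proof (rule poly_mapping_eqI)
  fix n
  show "Poly_Mapping.lookup P n = Poly_Mapping.lookup 0 n"
    using monomials_independent[of "Poly_Mapping.keys P" "Poly_Mapping.lookup P" n] assms
    by (cases "n \<in> Poly_Mapping.keys P") (auto simp: peval_UNIV in_keys_iff)
qed

text \<open>As a function of t this is entire and vanishes near 0, so the identity theorem
  applies.\<close>

lemma peval_line:
  fixes P :: "'v::finite mpoly"
  assumes "\<forall>\<^sub>F t in nhds 0. peval P (\<lambda>v. y v + t * d v) = 0"
  shows "peval P (\<lambda>v. y v + t * d v) = 0"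
proof -
  obtain U where U: "open U" "0 \<in> U" "\<And>t. t \<in> U \<Longrightarrow> peval P (\<lambda>v. y v + t * d v) = 0"
    using assms unfolding eventually_nhds by blast
  have "(\<lambda>t. peval P (\<lambda>v. y v + t * d v)) holomorphic_on UNIV"
    unfolding peval_def by (intro holomorphic_intros)
  from analytic_continuation_open[OF U(1) open_UNIV _ _ _ this, of "\<lambda>_. 0" t]
  show ?thesis
    using U by auto
qed

lemma peval_weighted_scale:
  fixes P :: "'v::finite mpoly"
  assumes "\<And>n. n \<in> Poly_Mapping.keys P \<Longrightarrow> (\<Sum>a\<in>UNIV. w a * Poly_Mapping.lookup n a) = W"
  shows "peval P (\<lambda>a. k ^ w a * y a) = k ^ W * peval P y"
proof -
  have "(\<Prod>a\<in>UNIV. (k ^ w a * y a) ^ Poly_Mapping.lookup n a) = k ^ W * (\<Prod>a\<in>UNIV. y a ^ Poly_Mapping.lookup n a)"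
    if "n \<in> Poly_Mapping.keys P" for n
  proof -
    have "(\<Prod>a\<in>UNIV. (k ^ w a) ^ Poly_Mapping.lookup n a) = k ^ W"
      unfolding assms[OF that, symmetric] by (simp add: power_sum power_mult)
    then show ?thesis by (simp add: power_mult_distrib prod.distrib)
  qed
  then show ?thesis
    unfolding peval_UNIV sum_distrib_left by (intro sum.cong refl) simp
qed

lemma peval_eq_0_on_slice:
  fixes P :: "'v::finite mpoly" and y0 :: "complex^'v"
  assumes r: "r > 0"
    and zero: "\<And>y. norm (y - y0) < r \<Longrightarrow> y $ c = y0 $ c \<Longrightarrow> peval P (\<lambda>a. y $ a) = 0"
    and y: "y c = y0 $ c"
  shows "peval P y = 0"
proof -
  define d where "d = (\<chi> a. y a - y0 $ a)"
  have "((\<lambda>t::complex. norm t * norm d) \<longlongrightarrow> norm (0::complex) * norm d) (nhds 0)"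
    by (intro tendsto_mult tendsto_norm tendsto_const filterlim_ident)
  moreover have "norm (0::complex) * norm d < r" using r by simp
  ultimately have "\<forall>\<^sub>F t in nhds (0::complex). norm t * norm d < r"
    by (rule order_tendstoD(2))
  then have "\<forall>\<^sub>F t in nhds 0. peval P (\<lambda>a. y0 $ a + t * d $ a) = 0"
  proof eventually_elim
    case (elim t)
    then show ?case
      using zero[of "y0 + t *s d"] y by (simp add: d_def norm_vector_smult)
  qed
  then have "peval P (\<lambda>a. y0 $ a + 1 * d $ a) = 0"
    by (rule peval_line)
  then show ?thesis by (simp add: d_def)
qed

lemma peval_eq_0_on_hyperplane_complement:
  fixes P :: "'v::finite mpoly"
  assumes "\<And>y. y c \<noteq> 0 \<Longrightarrow> peval P y = 0"
  shows "P = 0"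
proof (rule peval_eq_0_imp_eq_0)
  fix y :: "'v \<Rightarrow> complex"
  define d where "d = (\<lambda>a. if a = c then 1 else (0::complex))"
  define y1 where "y1 = y(c := 1 :: complex)"
  have "\<forall>\<^sub>F t in nhds (0::complex). t \<noteq> -1"
    by (rule t1_space_nhds) simp
  then have "\<forall>\<^sub>F t in nhds 0. peval P (\<lambda>v. y1 v + t * d v) = 0"
  proof eventually_elim
    case (elim t)
    then have "1 + t \<noteq> 0" by (metis add.commute eq_neg_iff_add_eq_0)
    then show ?case by (intro assms) (simp add: y1_def d_def)
  qed
  then have "peval P (\<lambda>v. y1 v + (y c - 1) * d v) = 0"
    by (rule peval_line)
  moreover have "(\<lambda>v. y1 v + (y c - 1) * d v) = y"
    by (auto simp: fun_eq_iff y1_def d_def)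
  ultimately show "peval P y = 0"
    by simp
qed

text \<open>Vanishing is assumed only where slot \<open>c\<close> keeps its nonzero value
  \<open>y0 $ c\<close>. A weighted dilation by k with k^(w c) = y c / y0 c maps this slice onto the
  one through y, and homogeneity transports the zero.\<close>

lemma weighted_homogeneous_eq_0:
  fixes P :: "'v::finite mpoly" and y0 :: "complex^'v"
  assumes hom: "\<And>n. n \<in> Poly_Mapping.keys P \<Longrightarrow> (\<Sum>a\<in>UNIV. w a * Poly_Mapping.lookup n a) = W"
    and c: "w c > 0" "y0 $ c \<noteq> 0" and r: "r > 0"
    and zero: "\<And>y. norm (y - y0) < r \<Longrightarrow> y $ c = y0 $ c \<Longrightarrow> peval P (\<lambda>a. y $ a) = 0"
  shows "P = 0"
proof (rule peval_eq_0_on_hyperplane_complement[of c])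
  fix y :: "'v \<Rightarrow> complex" assume y: "y c \<noteq> 0"
  obtain k where k: "k ^ w c = y c / y0 $ c"
    using exists_complex_root[of "w c" "y c / y0 $ c"] c(1) by (metis less_numeral_extra(3))
  have kw: "k ^ w c \<noteq> 0"
    using k y c(2) by (metis divide_eq_0_iff)
  have k0: "k ^ n \<noteq> 0" for n
    using kw c(1) by (metis power_eq_0_iff)
  have "peval P (\<lambda>a. k ^ w a * (y a / k ^ w a)) = k ^ W * peval P (\<lambda>a. y a / k ^ w a)"
    by (rule peval_weighted_scale[OF hom])
  also have "peval P (\<lambda>a. y a / k ^ w a) = 0"
  proof (rule peval_eq_0_on_slice[OF r zero])
    have "y c = y0 $ c * k ^ w c" using k c(2) by simp
    then show "y c / k ^ w c = y0 $ c" using kw by simp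
  qed
  also have "(\<lambda>a. k ^ w a * (y a / k ^ w a)) = y" using k0 by simp
  finally show "peval P y = 0" by simp
qed

section \<open>Leading Taylor coefficients\<close>

text \<open>The operator \<open>t * deriv\<close> multiplies the k-th coefficient by k and so
  preserves the order of vanishing; both limits are instances of one statement on the shifted
  series.\<close>

lemma has_fps_expansion_leading:
  fixes f :: "complex \<Rightarrow> complex"
  assumes f: "f has_fps_expansion F" and F: "\<And>k. k < n \<Longrightarrow> fps_nth F k = 0"
  shows "((\<lambda>t. f t / t ^ n) \<longlongrightarrow> fps_nth F n) (at 0)"
    and "((\<lambda>t. t * deriv f t / t ^ n) \<longlongrightarrow> of_nat n * fps_nth F n) (at 0)"
proof -
  have *: "((\<lambda>t. g t / t ^ n) \<longlongrightarrow> fps_nth G n) (at 0)"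
    if g: "g has_fps_expansion G" and G: "\<And>k. k < n \<Longrightarrow> fps_nth G k = 0" for g :: "complex \<Rightarrow> complex" and G
  \<comment> \<open>The zero series has subdegree 0 by convention, so the shift by n is available
    for nonzero series only.\<close>
  proof (cases "G = 0")
    case True
    then have "\<forall>\<^sub>F t in at 0. g t = 0"
      using g by (auto simp: has_fps_expansion_0_iff eventually_at_filter elim: eventually_mono)
    then have "\<forall>\<^sub>F t in at 0. g t / t ^ n = fps_nth G n"
      by eventually_elim (simp add: True)
    then show ?thesis by (rule tendsto_eventually)
  next
    case False
    have "n \<le> subdegree G" using False G by (intro subdegree_geI) auto
    from has_fps_expansion_shift[OF g this refl]
    have "(\<lambda>t. if t = 0 then fps_nth G n else g t / t ^ n) has_fps_expansion fps_shift n G" .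
    from has_fps_expansion_imp_tendsto_0[OF this]
    have "((\<lambda>t. if t = 0 then fps_nth G n else g t / t ^ n) \<longlongrightarrow> fps_nth G n) (at 0)"
      by (intro tendsto_mono[of "at 0" "nhds 0"]) (simp_all add: at_within_def)
    then show ?thesis
      by (rule Lim_transform_eventually) (auto simp: eventually_at_filter)
  qed
  show "((\<lambda>t. f t / t ^ n) \<longlongrightarrow> fps_nth F n) (at 0)"
    by (rule *[OF f F])
  have "(\<lambda>t. t * deriv f t) has_fps_expansion fps_X * fps_deriv F"
    by (intro fps_expansion_intros f)
  moreover have "fps_nth (fps_X * fps_deriv F) k = of_nat k * fps_nth F k" for k
    by (cases k) auto
  ultimately show "((\<lambda>t. t * deriv f t / t ^ n) \<longlongrightarrow> of_nat n * fps_nth F n) (at 0)"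
    using *[of "\<lambda>t. t * deriv f t" "fps_X * fps_deriv F"] F by simp
qed

text \<open>A finite limit of f / t^n makes f / t^k tend to 0 for k < n, so the lower coefficients
  vanish one after the other.\<close>

lemma has_fps_expansion_leading_unique:
  fixes f :: "complex \<Rightarrow> complex"
  assumes f: "f has_fps_expansion F" and lim: "((\<lambda>t. f t / t ^ n) \<longlongrightarrow> l) (at 0)"
  shows "k < n \<Longrightarrow> fps_nth F k = 0" and "fps_nth F n = l"
proof -
  have z: "fps_nth F k = 0" if "k < n" for k
    using that
  proof (induction k rule: less_induct)
    case (less k)
    have l1: "((\<lambda>t. f t / t ^ k) \<longlongrightarrow> fps_nth F k) (at 0)"
      using less by (intro has_fps_expansion_leading[OF f]) auto
    have "((\<lambda>t. f t / t ^ n * t ^ (n - k)) \<longlongrightarrow> l * 0 ^ (n - k)) (at 0)"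
      by (intro tendsto_mult tendsto_power tendsto_ident_at lim)
    moreover have "f t / t ^ n * t ^ (n - k) = f t / t ^ k" if "t \<noteq> 0" for t
    proof -
      have "t ^ n = t ^ k * t ^ (n - k)" using less.prems by (simp flip: power_add)
      then show ?thesis using that by simp
    qed
    then have "\<forall>\<^sub>F t in at 0. f t / t ^ n * t ^ (n - k) = f t / t ^ k"
      by (simp add: eventually_at_filter)
    ultimately have "((\<lambda>t. f t / t ^ k) \<longlongrightarrow> l * 0 ^ (n - k)) (at 0)"
      by (rule Lim_transform_eventually)
    from tendsto_unique[OF at_neq_bot l1 this] have "fps_nth F k = l * 0 ^ (n - k)" .
    then show ?case using less.prems by simp
  qed
  then show "k < n \<Longrightarrow> fps_nth F k = 0" by auto
  show "fps_nth F n = l"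
    by (rule tendsto_unique[OF at_neq_bot has_fps_expansion_leading(1)[OF f z] lim])
qed

text \<open>With n the least order that occurs in any component, division by t^n turns the estimate
  into |n x - M x| \<le> e |x| in the limit, for every e > 0. Assuming an estimate instead of an
  equation admits nonlinear remainders.\<close>

lemma leading_coefficient_eigenvector:
  fixes \<delta> :: "complex \<Rightarrow> complex^'n::finite" and M :: "complex^'n \<Rightarrow> complex^'n"
  assumes an: "\<And>i. (\<lambda>t. \<delta> t $ i) analytic_on {0}"
    and M: "bounded_linear M" "\<And>k y. M (k *s y) = k *s M y"
    and ev: "\<And>e. e > 0 \<Longrightarrow> \<forall>\<^sub>F t in at 0. norm ((\<chi> i. t * deriv (\<lambda>t. \<delta> t $ i) t) - M (\<delta> t)) \<le> e * norm (\<delta> t)"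
  shows "(\<forall>\<^sub>F t in nhds 0. \<delta> t = 0) \<or>
    (\<exists>n x. x \<noteq> 0 \<and> ((\<lambda>t. inverse (t ^ n) *s \<delta> t) \<longlongrightarrow> x) (at 0) \<and> M x = of_nat n *s x)"
proof -
  define D where "D i = fps_expansion (\<lambda>t. \<delta> t $ i) 0" for i
  have D: "(\<lambda>t. \<delta> t $ i) has_fps_expansion D i" for i
    unfolding D_def by (rule analytic_at_imp_has_fps_expansion_0[OF an])
  show ?thesis
  proof (cases "\<forall>i. D i = 0")
    case True
    then have "\<forall>\<^sub>F t in nhds 0. \<delta> t $ i = 0" for i
      using D[of i] by (simp add: has_fps_expansion_0_iff)
    then have "\<forall>\<^sub>F t in nhds 0. \<forall>i. \<delta> t $ i = 0"
      by (simp add: eventually_all_finite)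
    then show ?thesis by (auto simp: vec_eq_iff)
  next
    case False
    then have "\<exists>n i. fps_nth (D i) n \<noteq> 0" by (metis fps_nonzero_nth)
    then obtain n where n: "\<exists>i. fps_nth (D i) n \<noteq> 0" "\<And>k i. k < n \<Longrightarrow> fps_nth (D i) k = 0"
      using exists_least_iff[of "\<lambda>n. \<exists>i. fps_nth (D i) n \<noteq> 0"] by blast
    define x where "x = (\<chi> i. fps_nth (D i) n)"
    have x: "x \<noteq> 0" using n(1) by (auto simp: x_def vec_eq_iff)
    let ?s = "\<lambda>t. inverse (t ^ n)"
    have l1: "((\<lambda>t. ?s t *s \<delta> t) \<longlongrightarrow> x) (at 0)"
    proof (rule vec_tendstoI)
      fix i show "((\<lambda>t. (?s t *s \<delta> t) $ i) \<longlongrightarrow> x $ i) (at 0)"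
        using has_fps_expansion_leading(1)[of "\<lambda>t. \<delta> t $ i", OF D n(2)] by (simp add: x_def divide_inverse mult.commute)
    qed
    have l2: "((\<lambda>t. ?s t *s (\<chi> i. t * deriv (\<lambda>t. \<delta> t $ i) t)) \<longlongrightarrow> of_nat n *s x) (at 0)"
    proof (rule vec_tendstoI)
      fix i show "((\<lambda>t. (?s t *s (\<chi> i. t * deriv (\<lambda>t. \<delta> t $ i) t)) $ i) \<longlongrightarrow> (of_nat n *s x) $ i) (at 0)"
        using has_fps_expansion_leading(2)[of "\<lambda>t. \<delta> t $ i", OF D n(2)] by (simp add: x_def divide_inverse mult.commute)
    qed
    have l3: "((\<lambda>t. M (?s t *s \<delta> t)) \<longlongrightarrow> M x) (at 0)"
      by (rule bounded_linear.tendsto[OF M(1) l1])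
    have "norm (of_nat n *s x - M x) \<le> e * norm x" if "e > 0" for e
    proof (rule tendsto_le[OF at_neq_bot])
      show "((\<lambda>t. norm (?s t *s (\<chi> i. t * deriv (\<lambda>t. \<delta> t $ i) t) - M (?s t *s \<delta> t))) \<longlongrightarrow> norm (of_nat n *s x - M x)) (at 0)"
        by (intro tendsto_norm tendsto_diff l2 l3)
      show "((\<lambda>t. e * norm (?s t *s \<delta> t)) \<longlongrightarrow> e * norm x) (at 0)"
        by (intro tendsto_mult tendsto_norm l1 tendsto_const)
      show "\<forall>\<^sub>F t in at 0. norm (?s t *s (\<chi> i. t * deriv (\<lambda>t. \<delta> t $ i) t) - M (?s t *s \<delta> t)) \<le> e * norm (?s t *s \<delta> t)"
        using ev[OF that]
      proof eventually_elim
        case (elim t)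
        have "?s t *s (\<chi> i. t * deriv (\<lambda>t. \<delta> t $ i) t) - M (?s t *s \<delta> t) = ?s t *s ((\<chi> i. t * deriv (\<lambda>t. \<delta> t $ i) t) - M (\<delta> t))"
          unfolding M(2) by (simp add: vec_eq_iff algebra_simps)
        then show ?case
          using mult_left_mono[OF elim, of "norm (?s t)"] by (simp only: norm_vector_smult) (simp add: mult_ac)
      qed
    qed
    note bound = this
    have "norm (of_nat n *s x - M x) \<le> 0"
    proof (rule field_le_epsilon)
      fix e :: real assume "e > 0"
      then show "norm (of_nat n *s x - M x) \<le> 0 + e"
        using bound[of "e / norm x"] x by simp
    qed
    then have "M x = of_nat n *s x" by simp
    with x l1 show ?thesis by blast
  qed
qed

text \<open>Comparison of the coefficients of t^n. For n below the weight c, the value l = 0 forces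
  the coefficient to vanish; for n = c the left side is 0 whatever the coefficient is, and the
  solvability condition l = 0 remains.\<close>

lemma scalar_leading_coefficient:
  fixes y :: "complex \<Rightarrow> complex"
  assumes y: "y has_fps_expansion F" "\<And>k. k < n \<Longrightarrow> fps_nth F k = 0"
    and ode: "\<forall>\<^sub>F t in at 0. t * deriv y t = c * y t + R t"
    and R: "((\<lambda>t. R t / t ^ n) \<longlongrightarrow> l) (at 0)"
  shows "(of_nat n - c) * fps_nth F n = l"
proof -
  have "((\<lambda>t. t * deriv y t / t ^ n - c * (y t / t ^ n)) \<longlongrightarrow> of_nat n * fps_nth F n - c * fps_nth F n) (at 0)"
    by (intro tendsto_diff tendsto_mult tendsto_const has_fps_expansion_leading[OF y])
  moreover have "\<forall>\<^sub>F t in at 0. t * deriv y t / t ^ n - c * (y t / t ^ n) = R t / t ^ n"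
    using ode by eventually_elim (simp add: add_divide_distrib)
  ultimately have "((\<lambda>t. R t / t ^ n) \<longlongrightarrow> of_nat n * fps_nth F n - c * fps_nth F n) (at 0)"
    by (rule Lim_transform_eventually)
  from tendsto_unique[OF at_neq_bot this R] show ?thesis
    by (simp add: algebra_simps)
qed

section \<open>The unstable manifold\<close>

lemma frechet_derivative_eqI:
  "(f has_derivative f') (at x) \<Longrightarrow> frechet_derivative f (at x) = f'"
  using frechet_derivative_at by metis

lemma cdiff_peval_case_option:
  assumes "\<And>l. cdiff sa (*) (\<lambda>x. f x l) x" "cdiff sa (*) g x"
  shows "cdiff sa (*) (\<lambda>x. peval P (case_option (g x) (f x))) x"
proof (rule cdiff_peval)
  fix v show "cdiff sa (*) (\<lambda>x. case_option (g x) (f x) v) x"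
    by (cases v) (auto intro: assms)
qed

lemma cdiff_peval_case_var:
  assumes "\<And>l. cdiff sa (*) (\<lambda>x. f x l) x" "cdiff sa (*) g x" "cdiff sa (*) h x"
  shows "cdiff sa (*) (\<lambda>x. peval P (case_var (f x) (g x) (h x))) x"
proof (rule cdiff_peval)
  fix v show "cdiff sa (*) (\<lambda>x. case_var (f x) (g x) (h x) v) x"
    by (cases v) (auto intro: assms)
qed

lemma cdiff_matrix_mult:
  fixes A :: "complex^'n::finite^'m::finite"
  assumes "cdiff sa (*s) f x"
  shows "cdiff sa (*s) (\<lambda>x. A *v f x) x"
  using assms unfolding cdiff_vec_iff
  by (auto simp: matrix_vector_mult_def intro!: cdiff_sum cdiff_mult cdiff_const)

section \<open>The field in the chart at infinity and its linear part at the fixed point\<close>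

locale kov_system =
  fixes D :: "('m::finite, 'v::finite) kov" and B0 :: "(complex^'v) set"
  assumes A1: "assumption_A1 D"
    and root: "indicial_root D"
    and G_det: "G_determined D"
    and slots: "unstable_slots D"
    and pos_exp: "positive_integer_exponents D"
    and split: "splitting D"
    and manifold: "unstable_manifold D B0"
begin

lemma pw_pos: "pw D i > 0" and rw_pos: "rw D > 0"
  using A1 unfolding assumption_A1_def by auto

lemma slots_facts:
  "zc D \<noteq> ec D" "wt D (zc D) = rw D" "wt D (ec D) = sw D" "bij_betw (idx D) (Uset D) (Uslots D)"
  using slots unfolding unstable_slots_def by auto

lemma slot_cases:
  obtains "v = zc D" | "v = ec D" | l where "l \<in> Uset D" "v = idx D l" "v \<in> Uslots D"
proof (cases "v \<in> Uslots D")
  case True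
  then have "v \<in> idx D ` Uset D" using slots_facts(4) by (simp add: bij_betw_def)
  then show ?thesis using that(3) True by blast
next
  case False
  then show ?thesis using that(1,2) by (auto simp: Uslots_def)
qed

lemma inv_idx: "l \<in> Uset D \<Longrightarrow> inv_into (Uset D) (idx D) (idx D l) = l"
  using slots_facts(4) by (simp add: bij_betw_def)

lemma idx_Uslots: "l \<in> Uset D \<Longrightarrow> idx D l \<in> Uslots D"
  using slots_facts(4) by (auto simp: bij_betw_def)

lemma Uslots_neq: "v \<in> Uslots D \<Longrightarrow> v \<noteq> zc D" "v \<in> Uslots D \<Longrightarrow> v \<noteq> ec D"
  by (auto simp: Uslots_def)

lemma inv_idx_slot:
  assumes "v \<in> Uslots D"
  shows "inv_into (Uset D) (idx D) v \<in> Uset D" "idx D (inv_into (Uset D) (idx D) v) = v"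
proof -
  have "v \<in> idx D ` Uset D" using assms slots_facts(4) by (simp add: bij_betw_def)
  then show "inv_into (Uset D) (idx D) v \<in> Uset D" "idx D (inv_into (Uset D) (idx D) v) = v"
    by (rule inv_into_into, rule f_inv_into_f)
qed

lemma wt_pos: "wt D v > 0"
proof (cases v rule: slot_cases)
  case (3 l)
  then show ?thesis using pos_exp unfolding positive_integer_exponents_def by blast
qed (use slots_facts rw_pos in \<open>auto simp: sw_def\<close>)

lemma lam_idx: "l \<in> Uset D \<Longrightarrow> lam D l = of_nat (wt D (idx D l))"
  using pos_exp unfolding positive_integer_exponents_def by blast

lemma jj_notin: "jj D \<notin> Uset D" "jj D \<notin> Sset D" "Uset D \<inter> Sset D = {}"
  by (auto simp: Uset_def Sset_def)

lemma index_cases: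
  obtains "l = jj D" | "l \<in> Uset D" "l \<notin> Sset D" "l \<noteq> jj D" | "l \<in> Sset D" "l \<notin> Uset D" "l \<noteq> jj D"
  unfolding Uset_def Sset_def by force

lemma B0: "open B0" "0 \<in> B0" using manifold unfolding unstable_manifold_def by auto

lemma TT_inverse: "TT D ** matrix_inv (TT D) = mat 1" "matrix_inv (TT D) ** TT D = mat 1"
proof -
  have "invertible (TT D)"
    using split unfolding splitting_def by (rule conjunct1)
  then have "TT D ** matrix_inv (TT D) = mat 1 \<and> matrix_inv (TT D) ** TT D = mat 1"
    unfolding matrix_inv_def invertible_def by (rule someI_ex)
  then show "TT D ** matrix_inv (TT D) = mat 1" "matrix_inv (TT D) ** TT D = mat 1"
    by blast+
qed

text \<open>Row \<open>jj D\<close> of \<open>TT D\<close> is a unit row, so the dummy slot is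
  passed through unchanged.\<close>

lemma matrix_inv_TT_jj: "(matrix_inv (TT D) *v y) $ jj D = y $ jj D"
proof -
  define z where "z = matrix_inv (TT D) *v y"
  have "y = TT D *v z" unfolding z_def by (simp add: matrix_vector_mul_assoc TT_inverse)
  then have "y $ jj D = (\<Sum>l\<in>UNIV. TT D $ jj D $ l * z $ l)" by (simp add: matrix_vector_mult_def)
  also have "\<dots> = (\<Sum>l\<in>UNIV. if l = jj D then z $ l else 0)"
    using split unfolding splitting_def by (intro sum.cong) auto
  finally show ?thesis by (simp add: z_def)
qed

lemma cdiff_X_of: "cdiff sa (*s) \<xi> x \<Longrightarrow> cdiff sa (*s) (\<lambda>x. X_of D (\<xi> x)) x"
  unfolding X_of_def using cdiff_matrix_mult[of sa \<xi> x "TT D"]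
  by (auto simp: cdiff_vec_iff intro!: cdiff_add cdiff_const)

lemma cdiff_numer:
  assumes "cdiff sa (*s) X x" "cdiff sa (*) Z x" "cdiff sa (*) E x"
  shows "cdiff sa (*) (\<lambda>x. numer D i (X x) (Z x) (E x)) x"
proof -
  have s: "cdiff sa (*) (\<lambda>x. slot_one D (X x) $ l) x" for l
    using assms(1) by (cases "l = jj D") (auto simp: slot_one_def cdiff_vec_iff intro: cdiff_const)
  show ?thesis
    unfolding numer_def fval_def Gval_def
    by (intro cdiff_add cdiff_mult cdiff_peval_case_option cdiff_peval_case_var s assms)
qed

definition regular_set :: "((complex^'m) \<times> complex \<times> complex) set" where
  "regular_set = {p. numer D (jj D) (X_of D (fst p)) (fst (snd p)) (snd (snd p)) \<noteq> 0}"

lemma cdiff_numer_chart: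
  "cdiff cscale (*) (\<lambda>p. numer D i (X_of D (fst p)) (fst (snd p)) (snd (snd p))) p"
  by (intro cdiff_numer cdiff_X_of cdiff_cscale_comps)

lemma open_regular_set: "open regular_set"
proof -
  have "continuous_on UNIV (\<lambda>p. numer D (jj D) (X_of D (fst p)) (fst (snd p)) (snd (snd p)))"
    by (rule continuous_at_imp_continuous_on) (blast intro: cdiff_continuous cdiff_numer_chart)
  moreover have "open (- {0::complex})" by (simp add: open_Compl)
  ultimately have "open ((\<lambda>p. numer D (jj D) (X_of D (fst p)) (fst (snd p)) (snd (snd p))) -` (- {0}))"
    using open_vimage by blast
  then show ?thesis
    by (simp add: regular_set_def vimage_def)
qed

lemma graph_regular: "q \<in> B0 \<Longrightarrow> graph_point D q \<in> regular_set"
  using manifold unfolding unstable_manifold_def regular_set_def by (auto split: prod.splits)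

lemma full_field_eq:
  "full_field D p = (matrix_inv (TT D) *v X_field D (X_of D (fst p)) (fst (snd p)) (snd (snd p)),
      of_nat (rw D) * fst (snd p) + snd (snd p) * Fm1 D (X_of D (fst p)) (fst (snd p)) (snd (snd p)),
      of_nat (sw D) * snd (snd p))"
  by (simp add: full_field_def split: prod.splits)

lemma cdiff_Fm1:
  assumes "p \<in> regular_set"
  shows "cdiff cscale (*) (\<lambda>p. Fm1 D (X_of D (fst p)) (fst (snd p)) (snd (snd p))) p"
  unfolding Fm1_def using assms
  by (intro cdiff_divide cdiff_const cdiff_numer_chart) (simp add: regular_set_def)

lemma cdiff_full_field:
  assumes p: "p \<in> regular_set"
  shows "cdiff cscale cscale (full_field D) p"
proof -
  have X: "cdiff cscale (*s) (\<lambda>p. X_field D (X_of D (fst p)) (fst (snd p)) (snd (snd p))) p"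
    unfolding cdiff_vec_iff
  proof
    fix i
    have "cdiff cscale (*) (\<lambda>p. X_of D (fst p) $ i) p"
      using cdiff_X_of[OF cdiff_cscale_comps(1)] unfolding cdiff_vec_iff by blast
    then have "cdiff cscale (*) (\<lambda>p. of_nat (pw D i) * X_of D (fst p) $ i - of_nat (pw D (jj D)) *
       (numer D i (X_of D (fst p)) (fst (snd p)) (snd (snd p)) /
        numer D (jj D) (X_of D (fst p)) (fst (snd p)) (snd (snd p)))) p"
      using p by (intro cdiff_diff cdiff_mult cdiff_divide cdiff_const cdiff_numer_chart) (simp_all add: regular_set_def)
    then show "cdiff cscale (*) (\<lambda>p. X_field D (X_of D (fst p)) (fst (snd p)) (snd (snd p)) $ i) p"
      by (cases "i = jj D") (simp_all add: X_field_def cdiff_const)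
  qed
  show ?thesis
    unfolding full_field_eq[abs_def]
    by (intro cdiff_Pair cdiff_matrix_mult X cdiff_add cdiff_mult cdiff_const cdiff_cscale_comps cdiff_Fm1 p)
qed

lemma graph_point_nth:
  "fst (graph_point D q) $ l = (if l \<in> Uset D then q $ idx D l else if l \<in> Sset D then phi D q $ l else 0)"
  "fst (snd (graph_point D q)) = q $ zc D" "snd (snd (graph_point D q)) = q $ ec D"
  by (simp_all add: graph_point_def)

lemma cdiff_phi: "q \<in> B0 \<Longrightarrow> l \<in> Sset D \<Longrightarrow> cdiff (*s) (*) (\<lambda>q. phi D q $ l) q"
  using manifold unfolding unstable_manifold_def holo_on_iff by blast

lemma cdiff_graph_point:
  assumes "q \<in> B0"
  shows "cdiff (*s) cscale (graph_point D) q"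
proof -
  have "cdiff (*s) (*) (\<lambda>q. fst (graph_point D q) $ l) q" for l
    using cdiff_phi[OF assms, of l]
    by (cases "l \<in> Uset D"; cases "l \<in> Sset D") (simp_all add: graph_point_nth cdiff_nth cdiff_const)
  then have "cdiff (*s) (*s) (\<lambda>q. fst (graph_point D q)) q" by (simp add: cdiff_vec_iff)
  from cdiff_Pair[OF this cdiff_nth[of "zc D"] cdiff_nth[of "ec D"]]
  have "cdiff (*s) cscale (\<lambda>q. (fst (graph_point D q), q $ zc D, q $ ec D)) q" .
  moreover have "(\<lambda>q. (fst (graph_point D q), q $ zc D, q $ ec D)) = graph_point D"
    by (auto simp: graph_point_def)
  ultimately show ?thesis by (simp only:)
qed

lemma graph_point_0: "graph_point D 0 = 0"
  using manifold unfolding unstable_manifold_def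
  by (auto simp: graph_point_def zero_prod_def vec_eq_iff)

lemma zero_regular: "0 \<in> regular_set"
  using graph_regular[OF B0(2)] by (simp add: graph_point_0)

lemma fixed_point_jj: "fixed_point D $ jj D = 1" and beta_nz: "beta D \<noteq> 0"
proof -
  have b: "beta D ^ pw D (jj D) = cc D $ jj D" "cc D $ jj D \<noteq> 0"
    using root unfolding indicial_root_def by auto
  show "beta D \<noteq> 0"
  proof
    assume "beta D = 0"
    then show False using b pw_pos[of "jj D"] by (simp add: power_0_left)
  qed
  then have "beta D ^ pw D (jj D) * inverse (beta D ^ pw D (jj D)) = 1" by simp
  then show "fixed_point D $ jj D = 1"
    unfolding b(1) by (simp add: fixed_point_def power_int_minus b(1))
qed

text \<open>The fixed point is c dilated by 1/beta. Homogeneity and the indicial equation give f_i =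
  - p_i X_i / beta there, hence p_j f_i / f_j = p_i X_i because X_j = 1.\<close>

lemma full_field_0: "full_field D 0 = 0"
proof -
  let ?X = "fixed_point D"
  have X0: "X_of D 0 = ?X" by (simp add: X_of_def)
  have num: "numer D i ?X 0 0 = - of_nat (pw D i) * inverse (beta D) * ?X $ i" for i
  proof -
    have "slot_one D ?X = wscale D (inverse (beta D)) (cc D)"
      using fixed_point_jj
      by (auto simp: vec_eq_iff slot_one_def wscale_def fixed_point_def power_int_minus power_inverse mult.commute)
    then have "numer D i ?X 0 0 = fval D i (wscale D (inverse (beta D)) (cc D)) (inverse (beta D) ^ rw D * 0)"
      by (simp add: numer_def)
    also have "\<dots> = inverse (beta D) ^ (pw D i + 1) * fval D i (cc D) 0"
      using A1 unfolding assumption_A1_def by blast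
    also have "fval D i (cc D) 0 = - of_nat (pw D i) * cc D $ i"
      using root unfolding indicial_root_def by metis
    finally show ?thesis by (simp add: fixed_point_def power_int_minus power_inverse)
  qed
  have "X_field D ?X 0 0 = 0"
    unfolding vec_eq_iff
  proof
    fix i
    show "X_field D ?X 0 0 $ i = 0 $ i"
      using beta_nz pw_pos[of "jj D"] by (simp add: X_field_def num fixed_point_jj)
  qed
  then show ?thesis
    by (simp add: full_field_eq X0 zero_prod_def)
qed

lemma linear_part_derivative: "(full_field D has_derivative linear_part D) (at 0)"
  and linear_part_cscale: "linear_part D (cscale k p) = cscale k (linear_part D p)"
  unfolding linear_part_def by (rule cdiff_frechet[OF cdiff_full_field[OF zero_regular]])+

text \<open>The entry of the linear part in the row of Z and the column of \<epsilon>.\<close>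

definition F0 :: complex where "F0 = F_on D 0"

lemma F_on_eq: "F_on D q = Fm1 D (X_of D (fst (graph_point D q))) (q $ zc D) (q $ ec D)"
  by (simp add: F_on_def graph_point_def)

lemma linear_part_snd:
  "fst (snd (linear_part D p)) = of_nat (rw D) * fst (snd p) + snd (snd p) * F0"
  "snd (snd (linear_part D p)) = of_nat (sw D) * snd (snd p)"
  "fst (linear_part D p) $ jj D = 0"
proof -
  have lp: "((\<lambda>p. T (full_field D p)) has_derivative (\<lambda>p. T (linear_part D p))) (at 0)" if "bounded_linear T" for T :: "_ \<Rightarrow> complex"
    using bounded_linear.has_derivative[OF that linear_part_derivative] .
  have bl: "bounded_linear (\<lambda>p::(complex^'m) \<times> complex \<times> complex. fst (snd p))"
    "bounded_linear (\<lambda>p::(complex^'m) \<times> complex \<times> complex. snd (snd p))"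
    "bounded_linear (\<lambda>p::(complex^'m) \<times> complex \<times> complex. fst p $ jj D)"
    by (intro bounded_linear_compose[OF bounded_linear_fst bounded_linear_snd]
      bounded_linear_compose[OF bounded_linear_snd bounded_linear_snd]
      bounded_linear_compose[OF bounded_linear_vec_nth bounded_linear_fst])+
  obtain F' where F': "((\<lambda>p. Fm1 D (X_of D (fst p)) (fst (snd p)) (snd (snd p))) has_derivative F') (at 0)"
    using cdiff_frechet(1)[OF cdiff_Fm1[OF zero_regular]] by blast
  have F0: "Fm1 D (X_of D 0) 0 0 = F0" by (simp add: F0_def F_on_eq graph_point_0)
  have "((\<lambda>p::(complex^'m) \<times> complex \<times> complex. of_nat (rw D) * fst (snd p)) has_derivative (\<lambda>p. of_nat (rw D) * fst (snd p))) (at 0)"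
    by (intro has_derivative_mult_right bounded_linear_imp_has_derivative bl)
  \<comment> \<open>At \<epsilon> = 0 the derivative of the product \<epsilon> F keeps only the term
    F(0) d\<epsilon>.\<close>
  moreover have "((\<lambda>p. snd (snd p) * Fm1 D (X_of D (fst p)) (fst (snd p)) (snd (snd p)))
      has_derivative (\<lambda>p. snd (snd 0) * F' p + snd (snd p) * Fm1 D (X_of D (fst 0)) (fst (snd 0)) (snd (snd 0)))) (at 0)"
    by (rule has_derivative_eq_rhs[OF has_derivative_mult[OF bounded_linear_imp_has_derivative[OF bl(2)] F']]) simp
  ultimately have "((\<lambda>p. of_nat (rw D) * fst (snd p) + snd (snd p) * Fm1 D (X_of D (fst p)) (fst (snd p)) (snd (snd p)))
      has_derivative (\<lambda>p. of_nat (rw D) * fst (snd p) + (snd (snd 0) * F' p + snd (snd p) * Fm1 D (X_of D (fst 0)) (fst (snd 0)) (snd (snd 0))))) (at 0)"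
    by (rule has_derivative_add)
  moreover have "((\<lambda>p. of_nat (rw D) * fst (snd p) + snd (snd p) * Fm1 D (X_of D (fst p)) (fst (snd p)) (snd (snd p)))
      has_derivative (\<lambda>p. fst (snd (linear_part D p)))) (at 0)"
    using lp[OF bl(1)] by (simp add: full_field_eq)
  ultimately have "(\<lambda>p. fst (snd (linear_part D p))) = (\<lambda>p. of_nat (rw D) * fst (snd p) + snd (snd p) * F0)"
    by (simp add: F0 has_derivative_unique)
  then show "fst (snd (linear_part D p)) = of_nat (rw D) * fst (snd p) + snd (snd p) * F0" by meson
  have "((\<lambda>p::(complex^'m) \<times> complex \<times> complex. of_nat (sw D) * snd (snd p)) has_derivative (\<lambda>p. of_nat (sw D) * snd (snd p))) (at 0)"
    by (intro has_derivative_mult_right bounded_linear_imp_has_derivative bl)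
  moreover have "((\<lambda>p::(complex^'m) \<times> complex \<times> complex. of_nat (sw D) * snd (snd p)) has_derivative (\<lambda>p. snd (snd (linear_part D p)))) (at 0)"
    using lp[OF bl(2)] by (simp add: full_field_eq)
  ultimately have "(\<lambda>p. snd (snd (linear_part D p))) = (\<lambda>p. of_nat (sw D) * snd (snd p))"
    by (rule has_derivative_unique[rotated])
  then show "snd (snd (linear_part D p)) = of_nat (sw D) * snd (snd p)" by meson
  have "((\<lambda>p::(complex^'m) \<times> complex \<times> complex. 0::complex) has_derivative (\<lambda>p. fst (linear_part D p) $ jj D)) (at 0)"
    using lp[OF bl(3)] by (simp add: full_field_eq matrix_inv_TT_jj X_field_def)
  then have "(\<lambda>p. fst (linear_part D p) $ jj D) = (\<lambda>p. 0)"
    by (rule has_derivative_unique) (rule has_derivative_const)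
  then show "fst (linear_part D p) $ jj D = 0" by meson
qed

lemma vec_axis_sum: "(y :: complex^'n::finite) = (\<Sum>i\<in>UNIV. y $ i *s axis i 1)"
  by (simp add: vec_eq_iff axis_def sum.delta' if_distrib cong: if_cong)

lemma linear_part_axis_sum:
  "linear_part D (y, 0, 0) = (\<Sum>l\<in>UNIV. cscale (y $ l) (linear_part D (axis l 1, 0, 0)))"
proof -
  interpret bounded_linear "linear_part D"
    using linear_part_derivative by (rule has_derivative_bounded_linear)
  have "(y, 0::complex, 0::complex) = (\<Sum>l\<in>UNIV. cscale (y $ l) (axis l 1, 0, 0))"
    by (subst vec_axis_sum[of y]) (simp add: cscale_def prod_eq_iff fst_sum snd_sum)
  then show ?thesis by (simp add: sum linear_part_cscale)
qed

text \<open>By \<open>splitting\<close> the unstable block is diagonal and stable directions do not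
  act on it; the condition on slot \<open>jj D\<close> discards the column of the dummy
  variable.\<close>

lemma fst_linear_part_U:
  assumes "y $ jj D = 0" "i \<in> Uset D"
  shows "fst (linear_part D (y, 0, 0)) $ i = lam D i * y $ i"
proof -
  have "fst (linear_part D (y, 0, 0)) $ i = (\<Sum>l\<in>UNIV. y $ l * fst (linear_part D (axis l 1, 0, 0)) $ i)"
    by (subst linear_part_axis_sum) (simp add: fst_sum cscale_def split_beta)
  also have "\<dots> = (\<Sum>l\<in>UNIV. if l = i then lam D i * y $ i else 0)"
  proof (rule sum.cong[OF refl])
    fix l
    show "y $ l * fst (linear_part D (axis l 1, 0, 0)) $ i = (if l = i then lam D i * y $ i else 0)"
    proof (cases l rule: index_cases)
      case 1 then show ?thesis using assms jj_notin by auto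
    next
      case 2
      have "fst (linear_part D (axis l 1, 0, 0)) = axis l (lam D l)"
        using 2(1) by (rule bspec[OF split[unfolded splitting_def, THEN conjunct2, THEN conjunct2, THEN conjunct1]])
      then show ?thesis by (simp add: axis_def)
    next
      case 3
      have "fst (linear_part D (axis l 1, 0, 0)) $ i = 0"
        using 3(1) assms(2)
        by (rule bspec[OF bspec[OF split[unfolded splitting_def, THEN conjunct2, THEN conjunct2, THEN conjunct2]]])
      moreover have "l \<noteq> i" using 3 assms(2) by blast
      ultimately show ?thesis by simp
    qed
  qed
  finally show ?thesis by simp
qed

lemma graph_derivative:
  assumes "(graph_point D has_derivative G') (at q)"
  shows "fst (snd (G' u)) = u $ zc D" "snd (snd (G' u)) = u $ ec D"
    "l \<in> Uset D \<Longrightarrow> fst (G' u) $ l = u $ idx D l" "fst (G' u) $ jj D = 0"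
proof -
  have nth: "((\<lambda>q. q $ v) has_derivative (\<lambda>u. u $ v)) (at q)" for v :: 'v
    by (intro bounded_linear_imp_has_derivative bounded_linear_vec_nth)
  have "((\<lambda>q. q $ zc D) has_derivative (\<lambda>u. fst (snd (G' u)))) (at q)"
    using has_derivative_fst[OF has_derivative_snd[OF assms]] by (simp add: graph_point_nth)
  from has_derivative_unique[OF this nth] show "fst (snd (G' u)) = u $ zc D" by meson
  have "((\<lambda>q. q $ ec D) has_derivative (\<lambda>u. snd (snd (G' u)))) (at q)"
    using has_derivative_snd[OF has_derivative_snd[OF assms]] by (simp add: graph_point_nth)
  from has_derivative_unique[OF this nth] show "snd (snd (G' u)) = u $ ec D" by meson
  have G: "((\<lambda>q. fst (graph_point D q) $ l) has_derivative (\<lambda>u. fst (G' u) $ l)) (at q)" for l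
    by (rule bounded_linear.has_derivative[OF bounded_linear_vec_nth has_derivative_fst[OF assms]])
  show "fst (G' u) $ l = u $ idx D l" if "l \<in> Uset D"
  proof -
    have "((\<lambda>q. q $ idx D l) has_derivative (\<lambda>u. fst (G' u) $ l)) (at q)"
      using G[of l] that by (simp add: graph_point_nth)
    from has_derivative_unique[OF this nth] show ?thesis by meson
  qed
  have "((\<lambda>q. 0) has_derivative (\<lambda>u. fst (G' u) $ jj D)) (at q)"
    using G[of "jj D"] jj_notin by (simp add: graph_point_nth)
  from has_derivative_unique[OF this has_derivative_const] show "fst (G' u) $ jj D = 0" by meson
qed

text \<open>An eigenvector for a positive eigenvalue lies in the unstable space, which is the
  tangent space of the graph; a tangent vector whose unstable, Z and \<epsilon> components all
  vanish is 0. The eigenvalues of the stable block need not be computed.\<close>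

lemma no_positive_stable_eigenvalue:
  assumes y: "\<And>l. l \<notin> Sset D \<Longrightarrow> y $ l = 0" and ev: "fst (linear_part D (y, 0, 0)) = of_nat n *s y" and "n > 0"
  shows "y = 0"
proof -
  have "linear_part D (y, 0, 0) = (of_nat n *s y, 0, 0)"
    using ev linear_part_snd[of "(y, 0, 0)"] by (auto simp: prod_eq_iff)
  then have "((\<lambda>x. linear_part D x - cscale (of_nat n) x) ^^ 1) (y, 0, 0) = 0"
    by (simp add: cscale_def zero_prod_def)
  then have "(y, 0, 0) \<in> {y. \<exists>\<mu> n. 0 < Re \<mu> \<and> ((\<lambda>x. linear_part D x - cscale \<mu> x) ^^ n) y = 0}"
    using \<open>n > 0\<close> by (intro CollectI exI[of _ "of_nat n"] exI[of _ 1]) auto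
  then have "(y, 0, 0) \<in> unstable_space D"
    unfolding unstable_space_def by (rule span_base)
  then obtain u where u: "frechet_derivative (graph_point D) (at 0) u = (y, 0, 0)"
    using manifold unfolding unstable_manifold_def by (metis rangeE)
  have der: "(graph_point D has_derivative frechet_derivative (graph_point D) (at 0)) (at 0)"
    by (rule cdiff_frechet[OF cdiff_graph_point[OF B0(2)]])
  have "u $ v = 0" for v
  proof (cases v rule: slot_cases)
    case (3 l)
    then have "u $ v = y $ l" using graph_derivative(3)[OF der, of l u] u by simp
    then show ?thesis using y[of l] 3(1) jj_notin(3) by auto
  qed (use graph_derivative(1,2)[OF der, of u] u in simp_all)
  then have "u = 0" by (simp add: vec_eq_iff)
  then have "(y, 0::complex, 0::complex) = 0"
    using u linear_0[OF has_derivative_linear[OF der]] by simp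
  then show "y = 0" by (simp add: zero_prod_def)
qed

end

section \<open>Analytic curves through the fixed point\<close>

lemma isCont_tendsto_nhds: "isCont f a \<Longrightarrow> (f \<longlongrightarrow> f a) (nhds a)"
  by (simp add: isCont_def tendsto_at_iff_tendsto_nhds)

lemma analytic_vec_tendsto:
  fixes q :: "complex \<Rightarrow> complex^'n::finite"
  assumes "\<And>v. (\<lambda>t. q t $ v) analytic_on {0}"
  shows "(q \<longlongrightarrow> q 0) (nhds 0)"
proof (rule vec_tendstoI)
  fix v
  have "isCont (\<lambda>t. q t $ v) 0"
    using assms analytic_at_imp_isCont by blast
  then show "((\<lambda>t. q t $ v) \<longlongrightarrow> q 0 $ v) (nhds 0)"
    by (rule isCont_tendsto_nhds)
qed

lemma analytic_vec_eventually:
  fixes q :: "complex \<Rightarrow> complex^'n::finite"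
  assumes "\<And>v. (\<lambda>t. q t $ v) analytic_on {0}" "open S" "q 0 \<in> S"
  shows "\<forall>\<^sub>F t in nhds 0. q t \<in> S"
  using analytic_vec_tendsto[OF assms(1)] assms(2,3) by (rule topological_tendstoD)

lemma eventually_nhds_imp_at: "eventually P (nhds a) \<Longrightarrow> eventually P (at a)"
  by (auto simp: eventually_at_filter elim: eventually_mono)

lemma analytic_eventually_has_derivative:
  assumes "f analytic_on {0::complex}"
  shows "\<forall>\<^sub>F t in nhds 0. (f has_field_derivative deriv f t) (at t)"
proof -
  obtain e where e: "e > 0" "f holomorphic_on ball 0 e"
    using assms unfolding analytic_on_def by blast
  have "\<forall>\<^sub>F t in nhds 0. t \<in> ball (0::complex) e"
    using e(1) by (intro eventually_nhds_in_open) auto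
  then show ?thesis
    by eventually_elim (use e(2) holomorphic_derivI in blast)
qed

lemma analytic_chain:
  fixes q :: "complex \<Rightarrow> complex^'n::finite" and f :: "complex^'n \<Rightarrow> complex"
  assumes an: "\<And>v. (\<lambda>t. q t $ v) analytic_on {0}" and S: "open S" "q 0 \<in> S"
    and f: "\<And>x. x \<in> S \<Longrightarrow> cdiff (*s) (*) f x"
  shows "(\<lambda>t. f (q t)) analytic_on {0}"
    and "\<forall>\<^sub>F t in nhds 0. deriv (\<lambda>t. f (q t)) t = frechet_derivative f (at (q t)) (\<chi> v. deriv (\<lambda>t. q t $ v) t)"
proof -
  have "\<forall>\<^sub>F t in nhds 0. \<forall>v. ((\<lambda>t. q t $ v) has_field_derivative deriv (\<lambda>t. q t $ v) t) (at t)"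
    by (intro eventually_all_finite analytic_eventually_has_derivative an)
  then have ev: "\<forall>\<^sub>F t in nhds 0. ((\<lambda>t. f (q t)) has_field_derivative
      frechet_derivative f (at (q t)) (\<chi> v. deriv (\<lambda>t. q t $ v) t)) (at t)"
    using analytic_vec_eventually[OF an S]
  proof eventually_elim
    case (elim t)
    define d where "d = (\<chi> v. deriv (\<lambda>t. q t $ v) t)"
    have "(q has_derivative (\<lambda>s. s *s d)) (at t)"
    proof -
      have "cdiff (*) (*s) q t"
        unfolding cdiff_vec_iff cdiff_field field_differentiable_def using elim(1) by blast
      then have q': "(q has_derivative frechet_derivative q (at t)) (at t)"
        and lin: "\<And>k. frechet_derivative q (at t) (k * 1) = k *s frechet_derivative q (at t) 1"
        by (rule cdiff_frechet)+
      have "frechet_derivative q (at t) 1 $ v = d $ v" for v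
      proof -
        have "((\<lambda>t. q t $ v) has_derivative (\<lambda>s. frechet_derivative q (at t) s $ v)) (at t)"
          by (rule bounded_linear.has_derivative[OF bounded_linear_vec_nth q'])
        moreover have "((\<lambda>t. q t $ v) has_derivative (*) (deriv (\<lambda>t. q t $ v) t)) (at t)"
          using elim(1) by (simp add: has_field_derivative_def)
        ultimately have "(\<lambda>s. frechet_derivative q (at t) s $ v) = (*) (deriv (\<lambda>t. q t $ v) t)"
          by (rule has_derivative_unique)
        from fun_cong[OF this, of 1] show ?thesis by (simp add: d_def)
      qed
      then have "frechet_derivative q (at t) 1 = d" by (simp add: vec_eq_iff)
      then have "frechet_derivative q (at t) = (\<lambda>s. s *s d)"
        using lin by (intro ext) (metis mult.right_neutral)
      then show ?thesis using q' by simp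
    qed
    then have "((\<lambda>t. f (q t)) has_derivative (\<lambda>s. frechet_derivative f (at (q t)) (s *s d))) (at t)"
      using cdiff_frechet(1)[OF f[OF elim(2)]] by (rule has_derivative_compose)
    then show ?case
      unfolding has_field_derivative_def d_def[symmetric] cdiff_frechet(2)[OF f[OF elim(2)]]
      by (rule has_derivative_eq_rhs) (auto simp: mult.commute)
  qed
  show "\<forall>\<^sub>F t in nhds 0. deriv (\<lambda>t. f (q t)) t = frechet_derivative f (at (q t)) (\<chi> v. deriv (\<lambda>t. q t $ v) t)"
    using ev by eventually_elim (rule DERIV_imp_deriv)
  obtain U where U: "open U" "0 \<in> U" "\<And>t. t \<in> U \<Longrightarrow> ((\<lambda>t. f (q t)) has_field_derivative
      frechet_derivative f (at (q t)) (\<chi> v. deriv (\<lambda>t. q t $ v) t)) (at t)"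
    using ev unfolding eventually_nhds by blast
  have "(\<lambda>t. f (q t)) holomorphic_on U"
    unfolding holomorphic_on_def field_differentiable_def using U(3) has_field_derivative_at_within by blast
  then show "(\<lambda>t. f (q t)) analytic_on {0}"
    using U(1,2) unfolding analytic_at by blast
qed

lemma strictly_differentiableE:
  assumes "strictly_differentiable f L x0" "e > 0"
  obtains d where "d > 0" "\<And>x y. x \<in> ball x0 d \<Longrightarrow> y \<in> ball x0 d \<Longrightarrow> norm (f x - f y - L (x - y)) \<le> e * norm (x - y)"
proof -
  obtain d where "d > 0" "\<forall>x\<in>ball x0 d. \<forall>y\<in>ball x0 d. norm (f x - f y - L (x - y)) \<le> e * norm (x - y)"
    using assms unfolding strictly_differentiable_def by blast
  then show ?thesis by (intro that) auto
qed

context kov_system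
begin

text \<open>Forgets the stable components; a left inverse of \<open>graph_point D\<close>.\<close>

definition proj :: "(complex^'m) \<times> complex \<times> complex \<Rightarrow> complex^'v" where
  "proj p = (\<chi> v. if v = zc D then fst (snd p) else if v = ec D then snd (snd p)
     else fst p $ inv_into (Uset D) (idx D) v)"

lemma proj_nth:
  "proj p $ zc D = fst (snd p)" "proj p $ ec D = snd (snd p)"
  "l \<in> Uset D \<Longrightarrow> proj p $ idx D l = fst p $ l"
  using slots_facts(1) Uslots_neq[OF idx_Uslots[of l]] by (auto simp: proj_def inv_idx)

lemma proj_0: "proj 0 = 0"
  by (simp add: proj_def vec_eq_iff)

lemma red_field_eq: "red_field D q = proj (full_field D (graph_point D q))"
  by (simp add: red_field_def proj_def split_beta)

lemma cdiff_proj: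
  assumes "cdiff sa cscale f x"
  shows "cdiff sa (*s) (\<lambda>x. proj (f x)) x"
  unfolding cdiff_vec_iff
proof
  fix v
  have c: "cdiff sa (*s) (\<lambda>x. fst (f x)) x" "cdiff sa (*) (\<lambda>x. fst (snd (f x))) x" "cdiff sa (*) (\<lambda>x. snd (snd (f x))) x"
    by (rule cdiff_compose[OF assms], rule cdiff_cscale_comps)+
  show "cdiff sa (*) (\<lambda>x. proj (f x) $ v) x"
  proof (cases v rule: slot_cases)
    case (3 l)
    then show ?thesis using c(1) unfolding cdiff_vec_iff by (simp add: proj_nth)
  qed (use c in \<open>simp_all add: proj_nth\<close>)
qed

lemma cdiff_red_field: "q \<in> B0 \<Longrightarrow> cdiff (*s) (*s) (red_field D) q"
  unfolding red_field_eq[abs_def]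
  by (intro cdiff_proj cdiff_compose[OF cdiff_graph_point cdiff_full_field[OF graph_regular]])

lemma red_field_nth:
  "red_field D q $ ec D = of_nat (sw D) * q $ ec D"
  "red_field D q $ zc D = of_nat (rw D) * q $ zc D + q $ ec D * F_on D q"
  by (simp_all add: red_field_eq proj_nth full_field_eq F_on_eq graph_point_nth)

lemma red_field_0: "red_field D 0 = 0"
  by (simp add: red_field_eq graph_point_0 full_field_0 proj_0)

lemma cdiff_F_on: "q \<in> B0 \<Longrightarrow> cdiff (*s) (*) (F_on D) q"
  using cdiff_compose[OF cdiff_graph_point cdiff_Fm1[OF graph_regular]]
  by (simp add: F_on_eq[abs_def] graph_point_nth)

lemma F_on_nz: "q \<in> B0 \<Longrightarrow> F_on D q \<noteq> 0"
  using graph_regular[of q] pw_pos[of "jj D"] by (simp add: F_on_eq Fm1_def regular_set_def graph_point_nth)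

definition red_deriv :: "complex^'v \<Rightarrow> complex^'v" where
  "red_deriv = frechet_derivative (red_field D) (at 0)"

lemma red_deriv: "(red_field D has_derivative red_deriv) (at 0)" "red_deriv (k *s x) = k *s red_deriv x"
  unfolding red_deriv_def by (rule cdiff_frechet[OF cdiff_red_field[OF B0(2)]])+

lemma bounded_linear_red_deriv: "bounded_linear red_deriv"
  using red_deriv(1) by (rule has_derivative_bounded_linear)

text \<open>The unstable rows may contain first-order terms in Z and \<epsilon>, so they are
  diagonal only on vectors without these components. The triangular shape is enough: eigenvectors
  are later analysed in the order \<epsilon>, Z, unstable slots.\<close>

lemma red_deriv_nth:
  "red_deriv x $ ec D = of_nat (sw D) * x $ ec D"
  "red_deriv x $ zc D = of_nat (rw D) * x $ zc D + x $ ec D * F0"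
  "v \<in> Uslots D \<Longrightarrow> x $ zc D = 0 \<Longrightarrow> x $ ec D = 0 \<Longrightarrow> red_deriv x $ v = of_nat (wt D v) * x $ v"
proof -
  define G' where "G' = frechet_derivative (graph_point D) (at 0)"
  have G': "(graph_point D has_derivative G') (at 0)"
    unfolding G'_def by (rule cdiff_frechet[OF cdiff_graph_point[OF B0(2)]])
  have comp: "((\<lambda>q. full_field D (graph_point D q)) has_derivative (\<lambda>u. linear_part D (G' u))) (at 0)"
    by (rule has_derivative_compose[OF G']) (simp add: graph_point_0 linear_part_derivative)
  have *: "red_deriv x $ v = T (linear_part D (G' x))"
    if "bounded_linear T" "\<And>p. proj p $ v = T p" for T v
  proof -
    have "((\<lambda>q. T (full_field D (graph_point D q))) has_derivative (\<lambda>u. T (linear_part D (G' u)))) (at 0)"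
      by (rule bounded_linear.has_derivative[OF that(1) comp])
    moreover have "((\<lambda>q. T (full_field D (graph_point D q))) has_derivative (\<lambda>u. red_deriv u $ v)) (at 0)"
      using bounded_linear.has_derivative[OF bounded_linear_vec_nth[of v] red_deriv(1)]
      by (simp add: red_field_eq that(2))
    ultimately have "(\<lambda>u. red_deriv u $ v) = (\<lambda>u. T (linear_part D (G' u)))"
      by (rule has_derivative_unique[rotated])
    then show ?thesis by meson
  qed
  show "red_deriv x $ ec D = of_nat (sw D) * x $ ec D"
    using *[of "\<lambda>p. snd (snd p)" "ec D"] graph_derivative(2)[OF G', of x]
    by (simp add: proj_nth linear_part_snd bounded_linear_compose[OF bounded_linear_snd bounded_linear_snd])
  show "red_deriv x $ zc D = of_nat (rw D) * x $ zc D + x $ ec D * F0"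
    using *[of "\<lambda>p. fst (snd p)" "zc D"] graph_derivative(1,2)[OF G', of x]
    by (simp add: proj_nth linear_part_snd bounded_linear_compose[OF bounded_linear_fst bounded_linear_snd])
  assume v: "v \<in> Uslots D" and x: "x $ zc D = 0" "x $ ec D = 0"
  obtain l where l: "l \<in> Uset D" "v = idx D l" using inv_idx_slot[OF v] by metis
  have "G' x = (fst (G' x), 0, 0)"
    using graph_derivative(1,2)[OF G', of x] x by (simp add: prod_eq_iff)
  then have "fst (linear_part D (G' x)) $ l = lam D l * fst (G' x) $ l"
    using fst_linear_part_U[OF graph_derivative(4)[OF G', of x] l(1)] by metis
  then show "red_deriv x $ v = of_nat (wt D v) * x $ v"
    using *[of "\<lambda>p. fst p $ l" v] graph_derivative(3)[OF G' l(1), of x] lam_idx[OF l(1)] l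
    by (simp add: proj_nth bounded_linear_compose[OF bounded_linear_vec_nth bounded_linear_fst])
qed

text \<open>\<open>t\<close> is the exponential of the time, so \<open>t * deriv\<close> is the
  derivative in time and t = 0 stands for time minus infinity. At t = 0 the equation says that the
  field vanishes at the origin.\<close>

definition solution :: "(complex \<Rightarrow> complex^'v) \<Rightarrow> bool" where
  "solution q \<longleftrightarrow> (\<forall>v. (\<lambda>t. q t $ v) analytic_on {0}) \<and> q 0 = 0 \<and>
     (\<forall>\<^sub>F t in nhds 0. \<forall>v. t * deriv (\<lambda>t. q t $ v) t = red_field D (q t) $ v)"

lemma invariant_graph:
  assumes "q \<in> B0"
  shows "frechet_derivative (graph_point D) (at q) (red_field D q) = full_field D (graph_point D q)"
  using manifold assms unfolding unstable_manifold_def by (elim conjE) (rule bspec)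

text \<open>The deviation \<delta> from the graph over the projected point has stable components
  only. Its equation contains the difference of the field at \<open>P t\<close> and on the graph,
  which is M \<delta> + o(\<delta>), and the drift of the foot point, which is o(\<delta>) because
  stable displacements do not change the unstable rows to first order. A leading coefficient of
  \<delta> would be a stable eigenvector for a positive integer.\<close>

lemma solution_on_unstable_manifold:
  fixes \<xi> :: "complex \<Rightarrow> complex^'m" and Z E :: "complex \<Rightarrow> complex"
  defines "P \<equiv> \<lambda>t. (\<xi> t, Z t, E t)"
  assumes an: "\<And>l. (\<lambda>t. \<xi> t $ l) analytic_on {0}" "Z analytic_on {0}" "E analytic_on {0}"
    and P0: "P 0 = 0" and jj0: "\<And>t. \<xi> t $ jj D = 0"
    and ode: "\<forall>\<^sub>F t in nhds 0. (\<forall>l. t * deriv (\<lambda>t. \<xi> t $ l) t = fst (full_field D (P t)) $ l) \<and>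
       t * deriv Z t = fst (snd (full_field D (P t))) \<and> t * deriv E t = snd (snd (full_field D (P t)))"
  shows "\<forall>\<^sub>F t in nhds 0. P t = graph_point D (proj (P t))" and "solution (\<lambda>t. proj (P t))"
proof -
  define q where "q t = proj (P t)" for t
  have q_nth: "(\<lambda>t. q t $ zc D) = Z" "(\<lambda>t. q t $ ec D) = E"
    "l \<in> Uset D \<Longrightarrow> (\<lambda>t. q t $ idx D l) = (\<lambda>t. \<xi> t $ l)" for l
    by (simp_all add: q_def proj_nth P_def)
  have q_an: "(\<lambda>t. q t $ v) analytic_on {0}" for v
    by (cases v rule: slot_cases) (simp_all add: q_nth an)
  have q0: "q 0 = 0" by (simp add: q_def P0 proj_0)
  have q_ode: "\<forall>\<^sub>F t in nhds 0. (\<chi> v. t * deriv (\<lambda>t. q t $ v) t) = proj (full_field D (P t))"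
    using ode
  proof eventually_elim
    case (elim t)
    have "t * deriv (\<lambda>t. q t $ v) t = proj (full_field D (P t)) $ v" for v
      by (cases v rule: slot_cases) (use elim in \<open>simp_all add: q_nth proj_nth\<close>)
    then show ?case by (simp add: vec_eq_iff)
  qed
  define g where "g x = fst (graph_point D x)" for x
  have g_cd: "cdiff (*s) (*s) g x" if "x \<in> B0" for x
    unfolding g_def using cdiff_compose[OF cdiff_graph_point[OF that] cdiff_cscale_comps(1)] .
  define \<delta> where "\<delta> t = \<xi> t - g (q t)" for t
  have P_diff: "P t - graph_point D (q t) = (\<delta> t, 0, 0)" for t
    by (simp add: \<delta>_def g_def P_def q_def prod_eq_iff graph_point_nth proj_nth)
  have d_U: "\<delta> t $ l = 0" if "l \<notin> Sset D" for t l
    using that jj_notin jj0 by (cases l rule: index_cases) (auto simp: \<delta>_def g_def graph_point_nth q_def proj_nth P_def)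
  note chain = analytic_chain[OF q_an B0(1), of "\<lambda>x. g x $ l" for l, unfolded q0, OF B0(2) g_cd[unfolded cdiff_vec_iff, rule_format]]
  have d_an: "(\<lambda>t. \<delta> t $ l) analytic_on {0}" for l
    unfolding \<delta>_def vector_minus_component by (intro analytic_on_diff an chain(1))
  have d0: "\<delta> 0 = 0"
    using P_diff[of 0] by (simp add: P0 q0 graph_point_0 zero_prod_def)
  define M where "M y = fst (linear_part D (y, 0, 0))" for y
  have M_bl: "bounded_linear M"
    unfolding M_def
    by (rule bounded_linear_compose[OF bounded_linear_fst
      bounded_linear_compose[OF has_derivative_bounded_linear[OF linear_part_derivative]]])
       (intro bounded_linear_Pair bounded_linear_ident bounded_linear_zero)
  have M_lin: "M (k *s y) = k *s M y" for k y
    using linear_part_cscale[of k "(y, 0, 0)"] by (simp add: M_def cscale_def split_beta)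
  \<comment> \<open>Invariance of the graph gives the same equation at the foot point, where it
    holds without error. Subtracting it leaves only differences of field values at
    \<open>P t\<close> and on the graph.\<close>
  have d_ode: "\<forall>\<^sub>F t in nhds 0. (\<chi> l. t * deriv (\<lambda>t. \<delta> t $ l) t) - M (\<delta> t) =
      (fst (full_field D (P t)) - fst (full_field D (graph_point D (q t))) - M (\<delta> t)) -
      frechet_derivative g (at (q t)) (proj (full_field D (P t)) - proj (full_field D (graph_point D (q t))))"
  proof -
    have "\<forall>\<^sub>F t in nhds 0. \<forall>l. deriv (\<lambda>t. g (q t) $ l) t = frechet_derivative (\<lambda>x. g x $ l) (at (q t)) (\<chi> v. deriv (\<lambda>t. q t $ v) t)"
      by (intro eventually_all_finite chain(2))
    moreover have "\<forall>\<^sub>F t in nhds 0. \<forall>l. ((\<lambda>t. \<xi> t $ l) has_field_derivative deriv (\<lambda>t. \<xi> t $ l) t) (at t)"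
      by (intro eventually_all_finite analytic_eventually_has_derivative an)
    moreover have "\<forall>\<^sub>F t in nhds 0. \<forall>l. ((\<lambda>t. g (q t) $ l) has_field_derivative deriv (\<lambda>t. g (q t) $ l) t) (at t)"
      by (intro eventually_all_finite analytic_eventually_has_derivative chain(1))
    moreover have "\<forall>\<^sub>F t in nhds 0. q t \<in> B0"
      using analytic_vec_eventually[OF q_an B0(1)] q0 B0(2) by simp
    ultimately show ?thesis using ode q_ode
    proof eventually_elim
      case (elim t)
      let ?g' = "frechet_derivative g (at (q t))"
      have lin: "linear ?g'"
        by (rule has_derivative_linear[OF cdiff_frechet(1)[OF g_cd[OF elim(4)]]])
      have cl: "?g' (k *s y) = k *s ?g' y" for k y
        by (rule cdiff_frechet(2)[OF g_cd[OF elim(4)]])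
      have "t * deriv (\<lambda>t. \<delta> t $ l) t = fst (full_field D (P t)) $ l - ?g' (proj (full_field D (P t))) $ l" for l
      proof -
        have "deriv (\<lambda>t. \<delta> t $ l) t = deriv (\<lambda>t. \<xi> t $ l) t - deriv (\<lambda>t. g (q t) $ l) t"
          unfolding \<delta>_def vector_minus_component
          using elim(2,3) by (intro DERIV_imp_deriv DERIV_diff) auto
        also have "deriv (\<lambda>t. g (q t) $ l) t = ?g' (\<chi> v. deriv (\<lambda>t. q t $ v) t) $ l"
          using elim(1) frechet_derivative_nth[OF cdiff_differentiable[OF g_cd[OF elim(4)]]] by simp
        finally have "t * deriv (\<lambda>t. \<delta> t $ l) t = t * deriv (\<lambda>t. \<xi> t $ l) t - ?g' (t *s (\<chi> v. deriv (\<lambda>t. q t $ v) t)) $ l"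
          by (simp add: cl right_diff_distrib)
        also have "t *s (\<chi> v. deriv (\<lambda>t. q t $ v) t) = proj (full_field D (P t))"
          using elim(6) by (simp add: vec_eq_iff)
        finally show ?thesis using elim(5) by simp
      qed
      moreover have "?g' (proj (full_field D (graph_point D (q t)))) = fst (full_field D (graph_point D (q t)))"
      proof -
        have "?g' y = fst (frechet_derivative (graph_point D) (at (q t)) y)" for y
          unfolding g_def
          using frechet_derivative_eqI[OF has_derivative_fst[OF cdiff_frechet(1)[OF cdiff_graph_point[OF elim(4)]]]] by metis
        then show ?thesis using invariant_graph[OF elim(4)] by (simp add: red_field_eq)
      qed
      ultimately show ?case
        by (simp add: vec_eq_iff linear_diff[OF lin])
    qed
  qed
  define L2 where "L2 = frechet_derivative (\<lambda>p. proj (full_field D p)) (at 0)"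
  have sc: "bounded_linear (\<lambda>k. cscale k p)" "cscale 1 p = p" "norm (cscale k p) = norm k * norm p"
      "cscale (k * l) p = cscale k (cscale l p)" for k l :: complex and p :: "(complex^'m) \<times> complex \<times> complex"
    by (rule bounded_linear_cscale, simp add: cscale_def split_beta, rule norm_cscale,
        simp add: cscale_def split_beta vector_smult_assoc)
  have pf: "cdiff cscale (*s) (\<lambda>p. proj (full_field D p)) p" if "p \<in> regular_set" for p
    by (rule cdiff_proj[OF cdiff_full_field[OF that]])
  have L2: "((\<lambda>p. proj (full_field D p)) has_derivative L2) (at 0)"
    unfolding L2_def by (rule cdiff_frechet(1)[OF pf[OF zero_regular]])
  have L2_eq: "L2 p $ v = proj (linear_part D p) $ v" for p v
  proof -
    have vd: "((\<lambda>p. proj (full_field D p) $ v) has_derivative (\<lambda>p. L2 p $ v)) (at 0)"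
      by (rule bounded_linear.has_derivative[OF bounded_linear_vec_nth L2])
    have lp: "((\<lambda>p. T (full_field D p)) has_derivative (\<lambda>p. T (linear_part D p))) (at 0)" if "bounded_linear T" for T :: "_ \<Rightarrow> complex"
      using bounded_linear.has_derivative[OF that linear_part_derivative] .
    have "bounded_linear (\<lambda>p. proj p $ v)"
    proof (cases v rule: slot_cases)
      case 1 then show ?thesis by (simp add: proj_nth bounded_linear_compose[OF bounded_linear_fst bounded_linear_snd])
    next
      case 2 then show ?thesis by (simp add: proj_nth bounded_linear_compose[OF bounded_linear_snd bounded_linear_snd])
    next
      case (3 l) then show ?thesis by (simp add: proj_nth bounded_linear_compose[OF bounded_linear_vec_nth bounded_linear_fst])
    qed
    from has_derivative_unique[OF vd lp[OF this]] show ?thesis by meson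
  qed
  \<comment> \<open>The block structure of \<open>splitting\<close> enters here: there is no
    first-order coupling from stable to unstable components.\<close>
  have L2_d: "L2 (\<delta> t, 0, 0) = 0" for t
    unfolding vec_eq_iff
  proof
    fix v show "L2 (\<delta> t, 0, 0) $ v = 0 $ v"
    proof (cases v rule: slot_cases)
      case (3 l)
      have "\<delta> t $ l = 0" "\<delta> t $ jj D = 0" using d_U 3 jj_notin by auto
      then show ?thesis using 3 fst_linear_part_U[of "\<delta> t" l] by (simp add: L2_eq proj_nth)
    qed (simp_all add: L2_eq proj_nth linear_part_snd)
  qed
  have ff: "cdiff cscale (*s) (\<lambda>p. fst (full_field D p)) p" if "p \<in> regular_set" for p
    by (rule cdiff_compose[OF cdiff_full_field[OF that] cdiff_cscale_comps(1)])
  have L1: "frechet_derivative (\<lambda>p. fst (full_field D p)) (at 0) = (\<lambda>p. fst (linear_part D p))"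
    by (rule frechet_derivative_eqI[OF has_derivative_fst[OF linear_part_derivative]])
  have strict1: "strictly_differentiable (\<lambda>p. fst (full_field D p)) (\<lambda>p. fst (linear_part D p)) 0"
    using holomorphic_strictly_differentiable[OF open_regular_set zero_regular ff sc] unfolding L1 .
  have strict2: "strictly_differentiable (\<lambda>p. proj (full_field D p)) L2 0"
    using holomorphic_strictly_differentiable[OF open_regular_set zero_regular pf sc] unfolding L2_def .
  have strict3: "strictly_differentiable g (frechet_derivative g (at 0)) 0"
    by (rule holo_vec_strictly_differentiable[OF B0 g_cd])
  have g_bl: "bounded_linear (frechet_derivative g (at 0))"
    by (rule has_derivative_bounded_linear[OF cdiff_frechet(1)[OF g_cd[OF B0(2)]]])
  obtain K0 where K0: "\<And>y. norm (frechet_derivative g (at 0) y) \<le> norm y * K0" "K0 > 0"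
    using bounded_linear.pos_bounded[OF g_bl] by blast
  obtain r0 where r0: "r0 > 0" "\<forall>x\<in>ball 0 r0. \<forall>L'. (g has_derivative L') (at x) \<longrightarrow>
      (\<forall>y. norm (L' y - frechet_derivative g (at 0) y) \<le> 1 * norm y)"
    using strictly_differentiable_derivative[OF strict3 g_bl zero_less_one] by blast
  have P_tend: "(P \<longlongrightarrow> 0) (nhds 0)"
  proof -
    have "isCont Z 0" "isCont E 0" using an analytic_at_imp_isCont by blast+
    then have "(Z \<longlongrightarrow> Z 0) (nhds 0)" "(E \<longlongrightarrow> E 0) (nhds 0)"
      by (auto intro: isCont_tendsto_nhds)
    then have "(P \<longlongrightarrow> P 0) (nhds 0)"
      unfolding P_def by (intro tendsto_Pair analytic_vec_tendsto an)
    then show ?thesis using P0 by simp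
  qed
  have gp_tend: "((\<lambda>t. graph_point D (q t)) \<longlongrightarrow> 0) (nhds 0)"
  proof -
    have "isCont (graph_point D) 0" by (rule cdiff_continuous[OF cdiff_graph_point[OF B0(2)]])
    then have "(graph_point D \<longlongrightarrow> graph_point D 0) (nhds 0)"
      by (rule isCont_tendsto_nhds)
    then show ?thesis
      using filterlim_compose[of "graph_point D" "nhds 0" "nhds 0" q "nhds 0"] analytic_vec_tendsto[OF q_an]
      by (simp add: graph_point_0 q0)
  qed
  have est: "\<forall>\<^sub>F t in nhds 0. norm ((\<chi> l. t * deriv (\<lambda>t. \<delta> t $ l) t) - M (\<delta> t)) \<le> e * norm (\<delta> t)" if "e > 0" for e
  proof -
    note pe = that
    \<comment> \<open>Near 0 the derivative of g is bounded by K0 + 1, so the drift term costs (K0 +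
      1) e2 = e/2; the other half of e is spent on the field itself.\<close>
    define e2 where "e2 = e / (2 * (K0 + 1))"
    have e2: "e2 > 0" "(K0 + 1) * e2 = e / 2"
    proof -
      have K: "K0 + 1 > 0" using K0(2) by simp
      then show "e2 > 0" using that by (simp add: e2_def)
      have "e2 * (2 * (K0 + 1)) = e" unfolding e2_def using K by simp
      then show "(K0 + 1) * e2 = e / 2" by (simp add: algebra_simps)
    qed
    obtain r1 where r1: "r1 > 0" "\<And>p p'. p \<in> ball 0 r1 \<Longrightarrow> p' \<in> ball 0 r1 \<Longrightarrow>
        norm (fst (full_field D p) - fst (full_field D p') - fst (linear_part D (p - p'))) \<le> e/2 * norm (p - p')"
      by (rule strictly_differentiableE[OF strict1 half_gt_zero[OF pe]]) auto
    obtain r2 where r2: "r2 > 0" "\<And>p p'. p \<in> ball 0 r2 \<Longrightarrow> p' \<in> ball 0 r2 \<Longrightarrow>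
        norm (proj (full_field D p) - proj (full_field D p') - L2 (p - p')) \<le> e2 * norm (p - p')"
      by (rule strictly_differentiableE[OF strict2 e2(1)]) auto
    have "\<forall>\<^sub>F t in nhds 0. P t \<in> ball 0 (min r1 r2)" "\<forall>\<^sub>F t in nhds 0. graph_point D (q t) \<in> ball 0 (min r1 r2)"
      using r1(1) r2(1) topological_tendstoD[OF P_tend open_ball, of 0 "min r1 r2"]
        topological_tendstoD[OF gp_tend open_ball, of 0 "min r1 r2"] by simp_all
    moreover have "\<forall>\<^sub>F t in nhds 0. q t \<in> B0 \<inter> ball 0 r0"
      using B0 r0(1) q0 by (intro analytic_vec_eventually[OF q_an]) auto
    ultimately show ?thesis using d_ode
    proof eventually_elim
      case (elim t)
      let ?w = "proj (full_field D (P t)) - proj (full_field D (graph_point D (q t)))"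
      have nd: "norm (P t - graph_point D (q t)) = norm (\<delta> t)"
        unfolding P_diff by (simp add: norm_Pair)
      have 1: "norm (fst (full_field D (P t)) - fst (full_field D (graph_point D (q t))) - M (\<delta> t)) \<le> e/2 * norm (\<delta> t)"
        using r1(2)[of "P t" "graph_point D (q t)"] elim(1,2) nd by (simp add: P_diff M_def)
      have 2: "norm ?w \<le> e2 * norm (\<delta> t)"
        using r2(2)[of "P t" "graph_point D (q t)"] elim(1,2) nd by (simp add: P_diff L2_d)
      have "norm (frechet_derivative g (at (q t)) ?w - frechet_derivative g (at 0) ?w) \<le> 1 * norm ?w"
        by (rule r0(2)[rule_format, OF _ cdiff_frechet(1)[OF g_cd]]) (use elim(3) in simp_all)
      then have "norm (frechet_derivative g (at (q t)) ?w) \<le> norm ?w * K0 + norm ?w"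
        using K0(1)[of ?w] norm_triangle_ineq[of "frechet_derivative g (at (q t)) ?w - frechet_derivative g (at 0) ?w" "frechet_derivative g (at 0) ?w"]
        by simp
      also have "\<dots> = (K0 + 1) * norm ?w" by (simp add: algebra_simps)
      also have "\<dots> \<le> (K0 + 1) * (e2 * norm (\<delta> t))"
        using 2 K0(2) by (intro mult_left_mono) auto
      also have "\<dots> = e/2 * norm (\<delta> t)" using e2(2) by (simp flip: mult.assoc)
      finally have 3: "norm (frechet_derivative g (at (q t)) ?w) \<le> e/2 * norm (\<delta> t)" .
      show ?case unfolding elim(4)
        by (rule order.trans[OF norm_triangle_ineq4]) (use 1 3 in simp)
    qed
  qed
  have est': "\<forall>\<^sub>F t in at 0. norm ((\<chi> l. t * deriv (\<lambda>t. \<delta> t $ l) t) - M (\<delta> t)) \<le> e * norm (\<delta> t)" if "e > 0" for e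
    by (rule eventually_nhds_imp_at[OF est[OF that]])
  have "(\<forall>\<^sub>F t in nhds 0. \<delta> t = 0) \<or>
    (\<exists>n x. x \<noteq> 0 \<and> ((\<lambda>t. inverse (t ^ n) *s \<delta> t) \<longlongrightarrow> x) (at 0) \<and> M x = of_nat n *s x)"
    by (rule leading_coefficient_eigenvector[OF d_an M_bl M_lin]) (rule est')
  then have d_zero: "\<forall>\<^sub>F t in nhds 0. \<delta> t = 0"
  proof (elim disjE exE conjE)
    fix n x assume x: "x \<noteq> 0" "((\<lambda>t. inverse (t ^ n) *s \<delta> t) \<longlongrightarrow> x) (at 0)" "M x = of_nat n *s x"
    have "x $ l = 0" if "l \<notin> Sset D" for l
    proof -
      have "((\<lambda>t. (inverse (t ^ n) *s \<delta> t) $ l) \<longlongrightarrow> x $ l) (at 0)" by (rule tendsto_vec_nth[OF x(2)])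
      then have "((\<lambda>t::complex. 0) \<longlongrightarrow> x $ l) (at 0)" using d_U[OF that] by simp
      from tendsto_unique[OF at_neq_bot this tendsto_const] show ?thesis .
    qed
    \<comment> \<open>Order 0 is excluded because the curve starts at the origin, so that
      \<delta>(0) = 0.\<close>
    moreover have "n > 0"
    proof (rule ccontr)
      assume "\<not> n > 0"
      then have "(\<delta> \<longlongrightarrow> x) (at 0)" using x(2) by simp
      moreover have "(\<delta> \<longlongrightarrow> \<delta> 0) (at 0)"
        using analytic_vec_tendsto[OF d_an] by (simp only: tendsto_at_iff_tendsto_nhds)
      ultimately have "x = \<delta> 0" by (rule tendsto_unique[OF at_neq_bot])
      then show False using x(1) d0 by simp
    qed
    ultimately have "x = 0"
      using x(3) by (intro no_positive_stable_eigenvalue[of x n]) (simp_all add: M_def)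
    then show ?thesis using x(1) by simp
  qed
  show conc: "\<forall>\<^sub>F t in nhds 0. P t = graph_point D (proj (P t))"
    using d_zero
  proof eventually_elim
    case (elim t)
    then have "P t - graph_point D (q t) = 0" using P_diff[of t] by (simp add: zero_prod_def)
    then show ?case by (simp add: q_def)
  qed
  have "\<forall>\<^sub>F t in nhds 0. \<forall>v. t * deriv (\<lambda>t. q t $ v) t = red_field D (q t) $ v"
    using conc q_ode
  proof eventually_elim
    case (elim t)
    then have "red_field D (q t) = proj (full_field D (P t))" by (simp add: red_field_eq q_def)
    then show ?case using elim(2) by (simp add: vec_eq_iff)
  qed
  then show "solution (\<lambda>t. proj (P t))"
    using q_an q0 unfolding solution_def q_def by blast
qed

end

section \<open>The normal form\<close>

text \<open>After division by t^W a monomial of weighted degree m is a product of convergent factors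
  times t^(m - W), so exactly the terms of degree W survive. The numbers \<open>w a\<close> are any
  exponents for which the quotients converge, not necessarily the weights of the system.\<close>

lemma peval_limit:
  fixes P :: "'v::finite mpoly" and y :: "complex \<Rightarrow> 'v \<Rightarrow> complex"
  assumes y: "\<And>a. ((\<lambda>t. y t a / t ^ w a) \<longlongrightarrow> l a) (at 0)"
    and W: "\<And>n. n \<in> Poly_Mapping.keys P \<Longrightarrow> W \<le> (\<Sum>a\<in>UNIV. w a * Poly_Mapping.lookup n a)"
  shows "((\<lambda>t. peval P (y t) / t ^ W) \<longlongrightarrow> (\<Sum>n\<in>Poly_Mapping.keys P.
     if (\<Sum>a\<in>UNIV. w a * Poly_Mapping.lookup n a) = W
     then Poly_Mapping.lookup P n * (\<Prod>a\<in>UNIV. l a ^ Poly_Mapping.lookup n a) else 0)) (at 0)"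
proof -
  define m where "m n = (\<Sum>a\<in>UNIV. w a * Poly_Mapping.lookup n a)" for n
  have mono: "((\<lambda>t. Poly_Mapping.lookup P n * ((\<Prod>a\<in>UNIV. (y t a / t ^ w a) ^ Poly_Mapping.lookup n a) * t ^ (m n - W)))
      \<longlongrightarrow> Poly_Mapping.lookup P n * ((\<Prod>a\<in>UNIV. l a ^ Poly_Mapping.lookup n a) * 0 ^ (m n - W))) (at 0)" for n
    by (intro tendsto_mult tendsto_const tendsto_prod tendsto_power y tendsto_ident_at)
  have "((\<lambda>t. \<Sum>n\<in>Poly_Mapping.keys P. Poly_Mapping.lookup P n * ((\<Prod>a\<in>UNIV. (y t a / t ^ w a) ^ Poly_Mapping.lookup n a) * t ^ (m n - W)))
      \<longlongrightarrow> (\<Sum>n\<in>Poly_Mapping.keys P. Poly_Mapping.lookup P n * ((\<Prod>a\<in>UNIV. l a ^ Poly_Mapping.lookup n a) * 0 ^ (m n - W)))) (at 0)"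
    by (intro tendsto_sum mono)
  moreover have "(\<Sum>n\<in>Poly_Mapping.keys P. Poly_Mapping.lookup P n * ((\<Prod>a\<in>UNIV. l a ^ Poly_Mapping.lookup n a) * 0 ^ (m n - W)))
     = (\<Sum>n\<in>Poly_Mapping.keys P. if m n = W then Poly_Mapping.lookup P n * (\<Prod>a\<in>UNIV. l a ^ Poly_Mapping.lookup n a) else 0)"
  proof (rule sum.cong[OF refl])
    fix n assume "n \<in> Poly_Mapping.keys P"
    then have "W \<le> m n" using W by (simp add: m_def)
    then show "Poly_Mapping.lookup P n * ((\<Prod>a\<in>UNIV. l a ^ Poly_Mapping.lookup n a) * 0 ^ (m n - W))
      = (if m n = W then Poly_Mapping.lookup P n * (\<Prod>a\<in>UNIV. l a ^ Poly_Mapping.lookup n a) else 0)"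
      by (cases "m n = W") (simp_all add: power_0_left)
  qed
  moreover have "(\<Sum>n\<in>Poly_Mapping.keys P. Poly_Mapping.lookup P n * ((\<Prod>a\<in>UNIV. (y t a / t ^ w a) ^ Poly_Mapping.lookup n a) * t ^ (m n - W)))
     = peval P (y t) / t ^ W" if "t \<noteq> 0" for t
  proof -
    have "Poly_Mapping.lookup P n * ((\<Prod>a\<in>UNIV. (y t a / t ^ w a) ^ Poly_Mapping.lookup n a) * t ^ (m n - W))
        = Poly_Mapping.lookup P n * (\<Prod>a\<in>UNIV. y t a ^ Poly_Mapping.lookup n a) / t ^ W"
      if n: "n \<in> Poly_Mapping.keys P" for n
    proof -
      have "(\<Prod>a\<in>UNIV. (t ^ w a) ^ Poly_Mapping.lookup n a) = t ^ m n"
        by (simp add: m_def power_sum power_mult)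
      also have "t ^ m n = t ^ W * t ^ (m n - W)"
        using W[OF n] by (simp add: m_def[symmetric] flip: power_add)
      finally have e: "(\<Prod>a\<in>UNIV. (y t a / t ^ w a) ^ Poly_Mapping.lookup n a) =
          (\<Prod>a\<in>UNIV. y t a ^ Poly_Mapping.lookup n a) / (t ^ W * t ^ (m n - W))"
        by (simp add: power_divide prod_dividef)
      show ?thesis unfolding e using \<open>t \<noteq> 0\<close> by simp
    qed
    then show ?thesis
      unfolding peval_UNIV sum_divide_distrib by (intro sum.cong refl) blast
  qed
  ultimately show ?thesis
    unfolding m_def[symmetric]
    by (auto intro: Lim_transform_eventually simp: eventually_at_filter)
qed

text \<open>The coefficient of t^n in a difference of two curves is mapped by \<open>L\<close>.
  Strictness is needed because both arguments move.\<close>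

lemma strictly_differentiable_quotient:
  fixes f :: "complex^'n::finite \<Rightarrow> complex^'k::finite"
  assumes f: "strictly_differentiable f L x0" "bounded_linear L" "\<And>k y. L (k *s y) = k *s L y"
    and a: "(a \<longlongrightarrow> x0) (at 0)" and b: "(b \<longlongrightarrow> x0) (at 0)"
    and lim: "((\<lambda>t. inverse (t ^ n) *s (a t - b t)) \<longlongrightarrow> x) (at (0::complex))"
  shows "((\<lambda>t. inverse (t ^ n) *s (f (a t) - f (b t))) \<longlongrightarrow> L x) (at 0)"
proof -
  define d where "d t = a t - b t" for t
  have lim': "((\<lambda>t. inverse (t ^ n) *s d t) \<longlongrightarrow> x) (at 0)" using lim by (simp add: d_def)
  have z: "((\<lambda>t. inverse (t ^ n) *s (f (a t) - f (b t) - L (d t))) \<longlongrightarrow> 0) (at 0)"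
  proof (rule tendstoI)
    fix e :: real assume e: "e > 0"
    define c where "c = e / (2 * (norm x + 1))"
    have xp: "norm x + 1 > 0" by (simp add: add_nonneg_pos)
    have c: "c > 0" using e xp by (simp add: c_def)
    have "c * (norm x + 1) = e / 2"
    proof -
      have "c * (2 * (norm x + 1)) = e" unfolding c_def using xp by simp
      then show ?thesis by (simp add: algebra_simps)
    qed
    obtain r where r: "r > 0" "\<And>x y. x \<in> ball x0 r \<Longrightarrow> y \<in> ball x0 r \<Longrightarrow> norm (f x - f y - L (x - y)) \<le> c * norm (x - y)"
      by (rule strictly_differentiableE[OF f(1) c]) auto
    have "\<forall>\<^sub>F t in at 0. a t \<in> ball x0 r" "\<forall>\<^sub>F t in at 0. b t \<in> ball x0 r"
      using r(1) topological_tendstoD[OF a open_ball, of x0 r] topological_tendstoD[OF b open_ball, of x0 r] by simp_all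
    moreover have "\<forall>\<^sub>F t in at 0. norm (inverse (t ^ n) *s d t) < norm x + 1"
      by (rule order_tendstoD(2)[OF tendsto_norm[OF lim']]) simp
    ultimately show "\<forall>\<^sub>F t in at 0. dist (inverse (t ^ n) *s (f (a t) - f (b t) - L (d t))) 0 < e"
    proof eventually_elim
      case (elim t)
      have "norm (inverse (t ^ n)) * norm (f (a t) - f (b t) - L (d t)) \<le> norm (inverse (t ^ n)) * (c * norm (d t))"
        unfolding d_def using elim(1,2) by (intro mult_left_mono r(2)) auto
      also have "\<dots> = c * norm (inverse (t ^ n) *s d t)" by (simp add: norm_vector_smult)
      also have "\<dots> \<le> c * (norm x + 1)" using elim(3) c by (intro mult_left_mono) auto
      also have "\<dots> < e" using \<open>c * (norm x + 1) = e / 2\<close> e by simp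
      finally show ?case unfolding dist_norm diff_zero norm_vector_smult .
    qed
  qed
  have l: "((\<lambda>t. L (inverse (t ^ n) *s d t)) \<longlongrightarrow> L x) (at 0)"
    by (rule bounded_linear.tendsto[OF f(2) lim'])
  have "((\<lambda>t. inverse (t ^ n) *s (f (a t) - f (b t) - L (d t)) + L (inverse (t ^ n) *s d t)) \<longlongrightarrow> 0 + L x) (at 0)"
    by (rule tendsto_add[OF z l])
  moreover have "inverse (t ^ n) *s (f (a t) - f (b t) - L (d t)) + L (inverse (t ^ n) *s d t) = inverse (t ^ n) *s (f (a t) - f (b t))" for t
    unfolding f(3) by (simp add: vec_eq_iff algebra_simps)
  ultimately show ?thesis by simp
qed

text \<open>Origin of the margin 2: under the blow-up G_2 is O(w^(N+1)), and N \<ge> \<lambda> + 2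
  leaves at least w^2 after division by w^(1+\<lambda>). The type \<open>'b\<close> is the slot
  type, called \<open>'v\<close> in \<open>kov_system\<close>.\<close>

locale normal_form_system = kov_system +
  fixes N :: nat and h G1 :: "'b \<Rightarrow> 'b mpoly" and G2 :: "'b \<Rightarrow> complex^'b \<Rightarrow> complex" and B :: "(complex^'b) set"
  assumes B_sub: "B \<subseteq> B0" and nf: "normal_form D N h G1 G2 B" and N_large: "\<And>v. wt D v + 2 \<le> N"
begin

abbreviation H :: "complex^'b \<Rightarrow> complex^'b" where "H \<equiv> near_id D h"

lemma B: "open B" "0 \<in> B" "inj_on H B"
proof -
  note n = nf[unfolded normal_form_def]
  show "open B" "0 \<in> B" "inj_on H B"
    by (rule n[THEN conjunct1], rule n[THEN conjunct2, THEN conjunct1], rule n[THEN conjunct2, THEN conjunct2, THEN conjunct1])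
qed

lemmas nf_slot = bspec[OF nf[unfolded normal_form_def, THEN conjunct2, THEN conjunct2, THEN conjunct2]]

lemma h_0: "v \<in> Uslots D \<Longrightarrow> peval (h v) (\<lambda>_. 0) = 0"
  by (drule nf_slot) (elim conjE, assumption)

lemma h_deriv: "v \<in> Uslots D \<Longrightarrow> a \<in> Uslots D \<Longrightarrow>
    frechet_derivative (\<lambda>q. H q $ v) (at 0) (axis a 1) = (if a = v then 1 else 0)"
  by (drule nf_slot) (elim conjE, rule bspec)

lemma G1_resonant: "v \<in> Uslots D \<Longrightarrow> n \<in> Poly_Mapping.keys (G1 v) \<Longrightarrow>
    (\<Sum>a\<in>UNIV. wt D a * Poly_Mapping.lookup n a) = wt D v"
  unfolding resonant_def[symmetric] by (drule nf_slot) (elim conjE, rule bspec)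

lemma G2_holo: "v \<in> Uslots D \<Longrightarrow> holo_on (G2 v) (H ` B)"
  by (drule nf_slot) (elim conjE, assumption)

lemma G2_bound:
  assumes "v \<in> Uslots D"
  obtains C where "C > 0" "\<forall>\<^sub>F y in nhds 0. norm (G2 v y) \<le> C * norm y ^ (N + 1)"
proof -
  have "(\<lambda>y. norm (G2 v y)) \<in> O[nhds 0](\<lambda>y. norm y ^ (N + 1))"
    using nf_slot[OF assms] by (elim conjE)
  then obtain C where "C > 0" "\<forall>\<^sub>F y in nhds 0. norm (norm (G2 v y)) \<le> C * norm (norm y ^ (N + 1))"
    by (rule landau_o.bigE)
  then show ?thesis using that by simp
qed

lemma nf_ode:
  assumes "v \<in> Uslots D" "q \<in> B"
  shows "frechet_derivative (\<lambda>q. H q $ v) (at q) (red_field D q) =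
    of_nat (wt D v) * H q $ v + peval (G1 v) (\<lambda>a. H q $ a) + G2 v (H q)"
  using bspec[OF nf_slot[OF assms(1), THEN conjunct2, THEN conjunct2, THEN conjunct2, THEN conjunct2,
    THEN conjunct2, THEN conjunct2, THEN conjunct2] assms(2)] unfolding Let_def .

lemma H_nth: "H q $ zc D = q $ zc D" "H q $ ec D = q $ ec D"
  by (simp_all add: near_id_def Uslots_def)

lemma cdiff_H: "cdiff (*s) (*s) H q"
  unfolding cdiff_vec_iff
proof
  fix v show "cdiff (*s) (*) (\<lambda>q. H q $ v) q"
    by (cases "v \<in> Uslots D") (simp_all add: near_id_def cdiff_nth cdiff_peval)
qed

lemma H_0: "H 0 = 0"
proof -
  have "($) (0 :: complex^'b) = (\<lambda>_. 0)" by auto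
  then show ?thesis by (simp add: vec_eq_iff near_id_def h_0)
qed

definition H' :: "complex^'b \<Rightarrow> complex^'b" where "H' = frechet_derivative H (at 0)"

lemma H': "(H has_derivative H') (at 0)" "H' (k *s x) = k *s H' x"
  unfolding H'_def by (rule cdiff_frechet[OF cdiff_H])+

lemma H'_zc: "H' x $ zc D = x $ zc D" and H'_ec: "H' x $ ec D = x $ ec D"
proof -
  have d: "((\<lambda>q. H q $ v) has_derivative (\<lambda>x. H' x $ v)) (at 0)" for v
    by (rule bounded_linear.has_derivative[OF bounded_linear_vec_nth H'(1)])
  have n: "((\<lambda>q. q $ v) has_derivative (\<lambda>x. x $ v)) (at 0)" for v :: 'b
    by (intro bounded_linear_imp_has_derivative bounded_linear_vec_nth)
  show "H' x $ zc D = x $ zc D"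
    using fun_cong[OF has_derivative_unique[OF d[of "zc D", unfolded H_nth] n], of x] .
  show "H' x $ ec D = x $ ec D"
    using fun_cong[OF has_derivative_unique[OF d[of "ec D", unfolded H_nth] n], of x] .
qed

lemma H'_U:
  assumes "v \<in> Uslots D" "x $ zc D = 0" "x $ ec D = 0"
  shows "H' x $ v = x $ v"
proof -
  interpret bounded_linear H' using H'(1) by (rule has_derivative_bounded_linear)
  have "H' x = (\<Sum>a\<in>UNIV. x $ a *s H' (axis a 1))"
    by (subst vec_axis_sum[of x]) (simp only: sum H'(2))
  then have "H' x $ v = (\<Sum>a\<in>UNIV. x $ a * H' (axis a 1) $ v)" by simp
  also have "\<dots> = (\<Sum>a\<in>UNIV. if a = v then x $ v else 0)"
  proof (rule sum.cong[OF refl])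
    fix a
    show "x $ a * H' (axis a 1) $ v = (if a = v then x $ v else 0)"
    proof (cases "a \<in> Uslots D")
      case True
      then have "H' (axis a 1) $ v = (if a = v then 1 else 0)"
        using h_deriv[OF assms(1) True] frechet_derivative_nth[OF cdiff_differentiable[OF cdiff_H], where x = 0 and i = v and y = "axis a 1"]
        unfolding H'_def by (simp only:)
      then show ?thesis by simp
    next
      case False
      then have "a = zc D \<or> a = ec D" "a \<noteq> v" using assms(1) by (auto simp: Uslots_def)
      then show ?thesis using assms(2,3) by auto
    qed
  qed
  finally show ?thesis by simp
qed

text \<open>The change is near the identity in X_u alone; Z and \<epsilon> may enter Y to first
  order. Its derivative is thus block triangular with identity blocks on the diagonal.\<close>

lemma H'_inj:
  assumes "H' x = 0"
  shows "x = 0"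
proof -
  have "x $ zc D = 0" "x $ ec D = 0" using assms H'_zc[of x] H'_ec[of x] by simp_all
  then have "x $ v = 0" if "v \<in> Uslots D" for v using H'_U[OF that, of x] assms by simp
  then have "x $ v = 0" for v
    by (cases v rule: slot_cases) (use \<open>x $ zc D = 0\<close> \<open>x $ ec D = 0\<close> in auto)
  then show ?thesis by (simp add: vec_eq_iff)
qed

lemma open_image: "open (H ` B)"
  using B(1,3)
  by (intro invariance_of_domain continuous_at_imp_continuous_on ballI cdiff_continuous[OF cdiff_H])

lemma strict_H: "strictly_differentiable H H' 0"
  unfolding H'_def by (rule holo_vec_strictly_differentiable[OF open_UNIV UNIV_I cdiff_H])

lemma strict_red_field: "strictly_differentiable (red_field D) red_deriv 0"
  unfolding red_deriv_def by (rule holo_vec_strictly_differentiable[OF B0 cdiff_red_field])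

lemma inv_H: "y \<in> H ` B \<Longrightarrow> inv_into B H y \<in> B0" "y \<in> H ` B \<Longrightarrow> H (inv_into B H y) = y"
  using B_sub inv_into_into[of y H B] f_inv_into_f[of y H B] by auto

lemma zero_in_image: "0 \<in> H ` B"
  using B(2) H_0 by (metis imageI)

text \<open>Invertibility of the derivative is known only at 0, so the inverse is shown to be
  holomorphic only near 0. This suffices, since the blow-up collapses the divisor to 0. The local
  inverse and the inverse on \<open>B\<close> agree by injectivity on \<open>B\<close>.\<close>

lemma holomorphic_inverse_near_0:
  obtains S where "open S" "0 \<in> S" "S \<subseteq> H ` B" "\<And>y. y \<in> S \<Longrightarrow> cdiff (*s) (*s) (inv_into B H) y"
proof -
  obtain V c where V: "open V" "0 \<in> V" "V \<subseteq> B" "inj_on H V" "open (H ` V)" "c > 0"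
    "\<And>x y. x \<in> V \<Longrightarrow> y \<in> V \<Longrightarrow> norm (x - y) \<le> c * norm (H x - H y)"
    "\<And>y. y \<in> H ` V \<Longrightarrow> cdiff (*s) (*s) (inv_into V H) y"
    by (rule holomorphic_inverse_function[OF B(1,2), of H])
       (auto simp: cdiff_H intro: H'_inj[unfolded H'_def])
  have eq: "inv_into V H y = inv_into B H y" if "y \<in> H ` V" for y
  proof -
    from that obtain x where x: "x \<in> V" "y = H x" by blast
    then show ?thesis using V(3,4) B(3) by (auto simp: inv_into_f_f)
  qed
  show ?thesis
  proof (rule that[of "H ` V"])
    show "0 \<in> H ` V" using V(2) H_0 by (metis imageI)
    show "cdiff (*s) (*s) (inv_into B H) y" if "y \<in> H ` V" for y
      by (rule cdiff_cong_open[OF V(8)[OF that] V(5) that eq])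
  qed (use V in auto)
qed

lemma F_normal_nz: "y \<in> H ` B \<Longrightarrow> F_normal D h B y \<noteq> 0"
  unfolding F_normal_def by (rule F_on_nz[OF inv_H(1)])

text \<open>|G_2(Y)| is at most C |Y/t|^(N+1) |t|^(N+1), and \<open>W \<le> N\<close> leaves at
  least one factor |t|.\<close>

lemma G2_limit:
  assumes v: "v \<in> Uslots D" and Y: "\<And>a. ((\<lambda>t. Y t $ a / t) \<longlongrightarrow> l $ a) (at 0)" "(Y \<longlongrightarrow> 0) (at 0)" and W: "W \<le> N"
  shows "((\<lambda>t. G2 v (Y t) / t ^ W) \<longlongrightarrow> 0) (at 0)"
proof -
  obtain C where C: "C > 0" "\<forall>\<^sub>F y in nhds 0. norm (G2 v y) \<le> C * norm y ^ (N + 1)"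
    using G2_bound[OF v] .
  have Yt: "((\<lambda>t. inverse t *s Y t) \<longlongrightarrow> l) (at 0)"
    by (rule vec_tendstoI) (use Y(1) in \<open>simp add: divide_inverse mult.commute\<close>)
  have lim: "((\<lambda>t. C * norm (inverse t *s Y t) ^ (N + 1) * norm t ^ (N + 1 - W)) \<longlongrightarrow> C * norm l ^ (N + 1) * norm (0::complex) ^ (N + 1 - W)) (at 0)"
    by (intro tendsto_mult tendsto_const tendsto_power tendsto_norm Yt tendsto_ident_at)
  have "\<forall>\<^sub>F t in at 0. norm (G2 v (Y t)) \<le> C * norm (Y t) ^ (N + 1)"
    using C(2) Y(2) by (rule eventually_compose_filterlim)
  then have "\<forall>\<^sub>F t in at 0. norm (G2 v (Y t) / t ^ W) \<le> C * norm (inverse t *s Y t) ^ (N + 1) * norm t ^ (N + 1 - W)"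
    using eventually_neq_at_within[of 0 0 UNIV]
  proof eventually_elim
    case (elim t)
    have pw: "norm t ^ (N + 1 - W) * norm t ^ W = norm t ^ (N + 1)"
      unfolding power_add[symmetric] using W by simp
    have "C * norm (inverse t *s Y t) ^ (N + 1) * norm t ^ (N + 1 - W) * norm t ^ W
        = C * norm (inverse t *s Y t) ^ (N + 1) * (norm t ^ (N + 1 - W) * norm t ^ W)"
      by (simp only: mult.assoc)
    also have "\<dots> = C * (norm (inverse t *s Y t) * norm t) ^ (N + 1)"
      unfolding pw power_mult_distrib by (simp only: mult.assoc)
    also have "norm (inverse t *s Y t) * norm t = norm (Y t)"
      unfolding norm_vector_smult norm_inverse using elim(2) by simp
    finally have key: "C * norm (inverse t *s Y t) ^ (N + 1) * norm t ^ (N + 1 - W) * norm t ^ W = C * norm (Y t) ^ (N + 1)" .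
    have "norm (G2 v (Y t) / t ^ W) = norm (G2 v (Y t)) / norm t ^ W"
      by (simp only: norm_divide norm_power)
    also have "\<dots> \<le> C * norm (Y t) ^ (N + 1) / norm t ^ W"
      using elim(1) by (rule divide_right_mono) simp
    also have "\<dots> = C * norm (inverse t *s Y t) ^ (N + 1) * norm t ^ (N + 1 - W)"
      by (subst key[symmetric], rule nonzero_mult_div_cancel_right) (use elim(2) in simp)
    finally show ?case .
  qed
  note bound = this
  have "0 < N + 1 - W" using W by simp
  then have "norm (0::complex) ^ (N + 1 - W) = 0"
    unfolding norm_zero by (rule zero_power)
  with lim have "((\<lambda>t. C * norm (inverse t *s Y t) ^ (N + 1) * norm t ^ (N + 1 - W)) \<longlongrightarrow> 0) (at 0)"
    by (simp only: mult_zero_right)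
  from Lim_null_comparison[OF bound this] show ?thesis .
qed

text \<open>Resonance alone would admit a linear term Y_a when a and v have equal weights. But the
  unit vector e of slot a is an eigenvector of \<open>red_deriv\<close> for its weight and is fixed
  by \<open>H'\<close>, so J_u already accounts for the whole first order along t e. Dividing the
  normal form identity by t and letting t tend to 0 makes this precise.\<close>

lemma G1_no_linear_terms:
  assumes v: "v \<in> Uslots D" and a: "a \<in> Uslots D"
  shows "Poly_Mapping.lookup (G1 v) (Poly_Mapping.single a 1) = 0"
proof (cases "wt D a = wt D v")
  case False
  have "(\<Sum>b\<in>UNIV. wt D b * Poly_Mapping.lookup (Poly_Mapping.single a 1) b) = wt D a"
    by (simp add: lookup_single when_def if_distrib cong: if_cong)
  then show ?thesis
    using G1_resonant[OF v, of "Poly_Mapping.single a 1"] False by (auto simp: in_keys_iff)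
next
  case True
  define e :: "complex^'b" where "e = axis a 1"
  have e: "e $ zc D = 0" "e $ ec D = 0" "\<And>b. e $ b = (if b = a then 1 else 0)"
    using Uslots_neq[OF a] by (auto simp: e_def axis_def)
  have Ae: "red_deriv e = of_nat (wt D a) *s e"
    unfolding vec_eq_iff
  proof
    fix b show "red_deriv e $ b = (of_nat (wt D a) *s e) $ b"
      by (cases b rule: slot_cases) (use e red_deriv_nth(1,2)[of e] red_deriv_nth(3)[OF _ e(1,2)] in auto)
  qed
  have He: "H' e = e"
    unfolding vec_eq_iff
  proof
    fix b show "H' e $ b = e $ b"
      by (cases b rule: slot_cases) (use e H'_zc[of e] H'_ec[of e] H'_U[OF _ e(1,2)] in auto)
  qed
  define q where "q t = t *s e" for t :: complex
  have q0: "(q \<longlongrightarrow> 0) (at 0)"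
  proof (rule vec_tendstoI)
    fix i show "((\<lambda>t. q t $ i) \<longlongrightarrow> 0 $ i) (at 0)"
      using tendsto_mult[OF tendsto_ident_at[of 0 UNIV] tendsto_const[of "e $ i"]] by (simp add: q_def)
  qed
  have ql: "((\<lambda>t. inverse (t ^ 1) *s (q t - 0)) \<longlongrightarrow> e) (at 0)"
    by (rule Lim_transform_eventually[OF tendsto_const])
       (auto simp: eventually_at_filter q_def vector_smult_assoc)
  have Hl: "((\<lambda>t. inverse (t ^ 1) *s (H (q t) - H 0)) \<longlongrightarrow> H' e) (at 0)"
    by (rule strictly_differentiable_quotient[OF strict_H has_derivative_bounded_linear[OF H'(1)] H'(2) q0 tendsto_const ql])
  have Rl: "((\<lambda>t. inverse (t ^ 1) *s (red_field D (q t) - red_field D 0)) \<longlongrightarrow> red_deriv e) (at 0)"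
    by (rule strictly_differentiable_quotient[OF strict_red_field bounded_linear_red_deriv red_deriv(2) q0 tendsto_const ql])
  define Y where "Y t = H (q t)" for t
  have Yl: "((\<lambda>t. Y t $ b / t) \<longlongrightarrow> e $ b) (at 0)" for b
    using tendsto_vec_nth[OF Hl, of b] by (simp add: Y_def H_0 He divide_inverse mult.commute)
  have Y0: "(Y \<longlongrightarrow> 0) (at 0)"
  proof -
    have "isCont H 0" by (rule cdiff_continuous[OF cdiff_H])
    then show ?thesis using isCont_tendsto_compose[of 0 H q] q0 by (simp add: Y_def[abs_def] H_0)
  qed
  \<comment> \<open>The factor 1/t is moved into the argument by complex linearity. The argument
    then converges, and only the base point of the derivative still moves.\<close>
  define R where "R t = inverse t *s red_field D (q t)" for t
  have Rlim: "(R \<longlongrightarrow> of_nat (wt D a) *s e) (at 0)"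
    using Rl by (simp add: R_def[abs_def] red_field_0 Ae)
  have lhs: "((\<lambda>t. frechet_derivative H (at (q t)) (R t) $ v) \<longlongrightarrow> (of_nat (wt D a) *s e) $ v) (at 0)"
  proof -
    have z: "((\<lambda>t. frechet_derivative H (at (q t)) (R t) - H' (R t)) \<longlongrightarrow> 0) (at 0)"
    proof (rule tendstoI)
      fix \<epsilon> :: real assume \<epsilon>: "\<epsilon> > 0"
      define K where "K = norm (of_nat (wt D a) *s e) + 1"
      have K: "K > 0" by (simp add: K_def add_nonneg_pos)
      have "\<epsilon> / (2 * K) > 0" using \<epsilon> K by simp
      from strictly_differentiable_derivative[OF strict_H has_derivative_bounded_linear[OF H'(1)] this]
      obtain r where r: "r > 0" "\<forall>x\<in>ball 0 r. \<forall>L'. (H has_derivative L') (at x) \<longrightarrow> (\<forall>y. norm (L' y - H' y) \<le> \<epsilon> / (2 * K) * norm y)"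
        by blast
      have "\<forall>\<^sub>F t in at 0. q t \<in> ball 0 r"
        using r(1) topological_tendstoD[OF q0 open_ball, of 0 r] by simp
      moreover have "\<forall>\<^sub>F t in at 0. norm (R t) < K"
        by (rule order_tendstoD(2)[OF tendsto_norm[OF Rlim]]) (simp add: K_def)
      ultimately show "\<forall>\<^sub>F t in at 0. dist (frechet_derivative H (at (q t)) (R t) - H' (R t)) 0 < \<epsilon>"
      proof eventually_elim
        case (elim t)
        have "norm (frechet_derivative H (at (q t)) (R t) - H' (R t)) \<le> \<epsilon> / (2 * K) * norm (R t)"
          by (rule r(2)[rule_format, OF elim(1) cdiff_frechet(1)[OF cdiff_H]])
        also have "\<dots> \<le> \<epsilon> / (2 * K) * K" using elim(2) \<epsilon> K by (intro mult_left_mono) auto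
        also have "\<dots> < \<epsilon>" using \<epsilon> K by simp
        finally show ?case by simp
      qed
    qed
    have "((\<lambda>t. H' (R t)) \<longlongrightarrow> H' (of_nat (wt D a) *s e)) (at 0)"
      by (rule bounded_linear.tendsto[OF has_derivative_bounded_linear[OF H'(1)] Rlim])
    from tendsto_vec_nth[OF tendsto_add[OF z this], of v] show ?thesis
      by (simp add: H'(2) He)
  qed
  have "((\<lambda>t. peval (G1 v) (\<lambda>b. Y t $ b) / t ^ 1) \<longlongrightarrow> (\<Sum>n\<in>Poly_Mapping.keys (G1 v).
     if (\<Sum>b\<in>UNIV. 1 * Poly_Mapping.lookup n b) = 1
     then Poly_Mapping.lookup (G1 v) n * (\<Prod>b\<in>UNIV. e $ b ^ Poly_Mapping.lookup n b) else 0)) (at 0)"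
  proof (rule peval_limit)
    fix n assume n: "n \<in> Poly_Mapping.keys (G1 v)"
    \<comment> \<open>The weighted degree of a resonant monomial is \<open>wt D v\<close>, which is
      positive, so G_1 has no constant term.\<close>
    have "(\<Sum>b\<in>UNIV. 1 * Poly_Mapping.lookup n b) \<noteq> 0"
    proof
      assume "(\<Sum>b\<in>UNIV. 1 * Poly_Mapping.lookup n b) = 0"
      then have "\<And>b. Poly_Mapping.lookup n b = 0" by simp
      then show False using G1_resonant[OF v n] wt_pos[of v] by simp
    qed
    then show "1 \<le> (\<Sum>b\<in>UNIV. 1 * Poly_Mapping.lookup n b)" by linarith
  qed (use Yl in simp)
  \<comment> \<open>With unit weights the limit keeps the monomials of degree 1, and at e only that
    of slot a is nonzero.\<close>
  also have "(\<Sum>n\<in>Poly_Mapping.keys (G1 v).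
     if (\<Sum>b\<in>UNIV. 1 * Poly_Mapping.lookup n b) = 1
     then Poly_Mapping.lookup (G1 v) n * (\<Prod>b\<in>UNIV. e $ b ^ Poly_Mapping.lookup n b) else 0)
     = (\<Sum>n\<in>Poly_Mapping.keys (G1 v). if n = Poly_Mapping.single a 1 then Poly_Mapping.lookup (G1 v) n else 0)"
  proof (rule sum.cong[OF refl])
    fix n
    show "(if (\<Sum>b\<in>UNIV. 1 * Poly_Mapping.lookup n b) = 1
       then Poly_Mapping.lookup (G1 v) n * (\<Prod>b\<in>UNIV. e $ b ^ Poly_Mapping.lookup n b) else 0)
      = (if n = Poly_Mapping.single a 1 then Poly_Mapping.lookup (G1 v) n else 0)"
    proof (cases "n = Poly_Mapping.single a 1")
      case True
      have "(\<Sum>b\<in>UNIV. 1 * Poly_Mapping.lookup n b) = 1"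
        by (simp add: True lookup_single when_def)
      moreover have "(\<Prod>b\<in>UNIV. e $ b ^ Poly_Mapping.lookup n b) = 1"
        by (intro prod.neutral ballI) (simp add: True lookup_single when_def e(3))
      ultimately show ?thesis using True by simp
    next
      case False
      have "\<exists>b. b \<noteq> a \<and> Poly_Mapping.lookup n b \<noteq> 0" if s: "(\<Sum>b\<in>UNIV. 1 * Poly_Mapping.lookup n b) = 1"
      proof (rule ccontr)
        assume "\<not> ?thesis"
        then have z: "\<And>b. b \<noteq> a \<Longrightarrow> Poly_Mapping.lookup n b = 0" by blast
        have "(\<Sum>b\<in>UNIV. 1 * Poly_Mapping.lookup n b) = (\<Sum>b\<in>UNIV. if b = a then Poly_Mapping.lookup n a else 0)"
          by (intro sum.cong refl) (auto simp: z)
        then have "Poly_Mapping.lookup n a = 1" using s by simp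
        then have "n = Poly_Mapping.single a 1"
          using z by (intro poly_mapping_eqI) (auto simp: lookup_single when_def)
        then show False using False by simp
      qed
      then have "(\<Prod>b\<in>UNIV. e $ b ^ Poly_Mapping.lookup n b) = 0" if s: "(\<Sum>b\<in>UNIV. 1 * Poly_Mapping.lookup n b) = 1"
        using s by (auto simp: prod_zero_iff e(3) power_0_left)
      then show ?thesis using False by simp
    qed
  qed
  also have "\<dots> = Poly_Mapping.lookup (G1 v) (Poly_Mapping.single a 1)"
    by (auto simp: in_keys_iff)
  finally have G1l: "((\<lambda>t. peval (G1 v) (\<lambda>b. Y t $ b) / t) \<longlongrightarrow> Poly_Mapping.lookup (G1 v) (Poly_Mapping.single a 1)) (at 0)"
    by simp
  have G2l: "((\<lambda>t. G2 v (Y t) / t ^ 1) \<longlongrightarrow> 0) (at 0)"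
    using N_large[of v] by (intro G2_limit[OF v Yl Y0]) auto
  have rhs: "((\<lambda>t. of_nat (wt D v) * (Y t $ v / t) + peval (G1 v) (\<lambda>b. Y t $ b) / t + G2 v (Y t) / t ^ 1) \<longlongrightarrow>
      of_nat (wt D v) * e $ v + Poly_Mapping.lookup (G1 v) (Poly_Mapping.single a 1) + 0) (at 0)"
    by (intro tendsto_add tendsto_mult tendsto_const Yl G1l G2l)
  have "\<forall>\<^sub>F t in at 0. q t \<in> B"
    by (rule topological_tendstoD[OF q0 B(1,2)])
  then have "\<forall>\<^sub>F t in at 0. of_nat (wt D v) * (Y t $ v / t) + peval (G1 v) (\<lambda>b. Y t $ b) / t + G2 v (Y t) / t ^ 1
      = frechet_derivative H (at (q t)) (R t) $ v"
  proof eventually_elim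
    case (elim t)
    have "frechet_derivative H (at (q t)) (R t) $ v = inverse t * frechet_derivative H (at (q t)) (red_field D (q t)) $ v"
      unfolding R_def cdiff_frechet(2)[OF cdiff_H] by simp
    also have "frechet_derivative H (at (q t)) (red_field D (q t)) $ v
        = of_nat (wt D v) * Y t $ v + peval (G1 v) (\<lambda>a. Y t $ a) + G2 v (Y t)"
      using nf_ode[OF v elim] frechet_derivative_nth[OF cdiff_differentiable[OF cdiff_H], where x = "q t" and i = v and y = "red_field D (q t)"]
      by (simp add: Y_def)
    finally show ?case by (simp add: divide_inverse algebra_simps)
  qed
  from tendsto_unique[OF at_neq_bot Lim_transform_eventually[OF rhs this] lhs]
  show ?thesis using True by simp
qed

end

lemma quotient_limit_lower:
  fixes f :: "complex \<Rightarrow> complex"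
  assumes "((\<lambda>t. f t / t ^ a) \<longlongrightarrow> l) (at 0)" "k < a"
  shows "((\<lambda>t. f t / t ^ k) \<longlongrightarrow> 0) (at 0)"
proof -
  have "((\<lambda>t. f t / t ^ a * t ^ (a - k)) \<longlongrightarrow> l * 0 ^ (a - k)) (at 0)"
    by (intro tendsto_mult tendsto_power tendsto_ident_at assms(1))
  moreover have "l * 0 ^ (a - k) = 0" using assms(2) by (simp add: zero_power)
  ultimately have lim: "((\<lambda>t. f t / t ^ a * t ^ (a - k)) \<longlongrightarrow> 0) (at 0)" by (simp only:)
  have "f t / t ^ a * t ^ (a - k) = f t / t ^ k" if "t \<noteq> 0" for t
  proof -
    have "t ^ a = t ^ k * t ^ (a - k)" using assms(2) by (simp flip: power_add)
    then show ?thesis using that by simp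
  qed
  then have "\<forall>\<^sub>F t in at 0. f t / t ^ a * t ^ (a - k) = f t / t ^ k"
    by (simp add: eventually_at_filter)
  with lim show ?thesis by (rule Lim_transform_eventually)
qed

context normal_form_system
begin

lemma solution_normal_form:
  assumes q: "solution q"
  shows "(\<lambda>t. H (q t) $ v) analytic_on {0}"
    and "v \<in> Uslots D \<Longrightarrow> \<forall>\<^sub>F t in at 0. t * deriv (\<lambda>t. H (q t) $ v) t
      = of_nat (wt D v) * H (q t) $ v + (peval (G1 v) (\<lambda>a. H (q t) $ a) + G2 v (H (q t)))"
    and "\<forall>\<^sub>F t in at 0. t * deriv (\<lambda>t. H (q t) $ zc D) t
      = of_nat (wt D (zc D)) * H (q t) $ zc D + H (q t) $ ec D * F_on D (q t)"
    and "\<forall>\<^sub>F t in at 0. t * deriv (\<lambda>t. H (q t) $ ec D) t = of_nat (wt D (ec D)) * H (q t) $ ec D + 0"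
proof -
  have an: "\<And>v. (\<lambda>t. q t $ v) analytic_on {0}" and q0: "q 0 = 0"
    and ode: "\<forall>\<^sub>F t in nhds 0. \<forall>v. t * deriv (\<lambda>t. q t $ v) t = red_field D (q t) $ v"
    using q unfolding solution_def by blast+
  have Hc: "cdiff (*s) (*) (\<lambda>x. H x $ v) x" for x v
    using cdiff_H unfolding cdiff_vec_iff by (rule spec)
  note chain = analytic_chain[OF an open_UNIV UNIV_I Hc]
  show "(\<lambda>t. H (q t) $ v) analytic_on {0}" by (rule chain(1))
  show "\<forall>\<^sub>F t in at 0. t * deriv (\<lambda>t. H (q t) $ v) t
      = of_nat (wt D v) * H (q t) $ v + (peval (G1 v) (\<lambda>a. H (q t) $ a) + G2 v (H (q t)))" if v: "v \<in> Uslots D"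
  proof (rule eventually_nhds_imp_at)
    have "\<forall>\<^sub>F t in nhds 0. q t \<in> B"
      by (rule analytic_vec_eventually[OF an B(1)]) (simp add: q0 B(2))
    with ode chain(2)[of v]
    show "\<forall>\<^sub>F t in nhds 0. t * deriv (\<lambda>t. H (q t) $ v) t
      = of_nat (wt D v) * H (q t) $ v + (peval (G1 v) (\<lambda>a. H (q t) $ a) + G2 v (H (q t)))"
    proof eventually_elim
      case (elim t)
      have "t *s (\<chi> v. deriv (\<lambda>t. q t $ v) t) = red_field D (q t)"
        using elim(1) by (simp add: vec_eq_iff)
      then have "t * deriv (\<lambda>t. H (q t) $ v) t = frechet_derivative (\<lambda>x. H x $ v) (at (q t)) (red_field D (q t))"
        unfolding elim(2) using cdiff_frechet(2)[OF Hc, of v "q t" t "\<chi> v. deriv (\<lambda>t. q t $ v) t"] by (simp only:)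
      then show ?case using nf_ode[OF v elim(3)] by (simp only: add.assoc)
    qed
  qed
  show "\<forall>\<^sub>F t in at 0. t * deriv (\<lambda>t. H (q t) $ zc D) t
      = of_nat (wt D (zc D)) * H (q t) $ zc D + H (q t) $ ec D * F_on D (q t)"
    using eventually_nhds_imp_at[OF ode]
    by eventually_elim (simp add: H_nth red_field_nth slots_facts(2))
  show "\<forall>\<^sub>F t in at 0. t * deriv (\<lambda>t. H (q t) $ ec D) t = of_nat (wt D (ec D)) * H (q t) $ ec D + 0"
    using eventually_nhds_imp_at[OF ode]
    by eventually_elim (simp add: H_nth red_field_nth slots_facts(3))
qed

text \<open>At an order k below the weight, (k - weight) times the coefficient of t^k equals the
  coefficient of the remaining terms, which vanishes by induction. The slots are treated in the
  order \<epsilon>, Z, and then all unstable slots together by induction on k, because G_1 couples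
  them.\<close>

lemma solution_leading_coefficients:
  assumes q: "solution q"
  obtains u :: "complex^'b" where
    "\<And>v. ((\<lambda>t. H (q t) $ v / t ^ wt D v) \<longlongrightarrow> u $ v) (at 0)"
    "\<And>v. v \<in> Uslots D \<Longrightarrow> peval (G1 v) (\<lambda>a. u $ a) = 0"
proof -
  have q_an: "\<And>v. (\<lambda>t. q t $ v) analytic_on {0}" and q0: "q 0 = 0"
    using q unfolding solution_def by blast+
  define Y where "Y t = H (q t)" for t
  define F where "F v = fps_expansion (\<lambda>t. Y t $ v) 0" for v
  have Y_an: "(\<lambda>t. Y t $ v) analytic_on {0}" for v
    unfolding Y_def by (rule solution_normal_form(1)[OF q])
  have F: "(\<lambda>t. Y t $ v) has_fps_expansion F v" for v
    unfolding F_def by (rule analytic_at_imp_has_fps_expansion_0[OF Y_an])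
  note ode = solution_normal_form(2-4)[OF q, folded Y_def]
  have Y0: "Y 0 = 0" by (simp add: Y_def q0 H_0)
  have F_0: "fps_nth (F v) 0 = 0" for v
    using has_fps_expansion_imp_0_eq_fps_nth_0[OF F[of v]] Y0 by simp
  have Y_tend: "(Y \<longlongrightarrow> 0) (at 0)"
    using analytic_vec_tendsto[OF Y_an] Y0 by (simp add: tendsto_at_iff_tendsto_nhds[symmetric, of Y 0, unfolded Y0])
  have Y_1: "((\<lambda>t. Y t $ a / t) \<longlongrightarrow> (\<chi> a. fps_nth (F a) 1) $ a) (at 0)" for a
    using has_fps_expansion_leading(1)[OF F, of 1 a] F_0 by simp
  have Fec: "fps_nth (F (ec D)) k = 0" if "k < wt D (ec D)" for k
    using that
  proof (induction k rule: less_induct)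
    case (less k)
    have "(of_nat k - of_nat (wt D (ec D))) * fps_nth (F (ec D)) k = 0"
      by (rule scalar_leading_coefficient[OF F _ ode(3)]) (use less in auto)
    then show ?case using less.prems by simp
  qed
  have Yec: "((\<lambda>t. Y t $ ec D / t ^ k) \<longlongrightarrow> 0) (at 0)" if "k < wt D (ec D)" for k
    by (rule quotient_limit_lower[OF has_fps_expansion_leading(1)[OF F Fec] that])
  have F_tend: "((\<lambda>t. F_on D (q t)) \<longlongrightarrow> F_on D 0) (at 0)"
  proof -
    have "(q \<longlongrightarrow> 0) (at 0)"
      using analytic_vec_tendsto[OF q_an] q0 by (simp add: tendsto_at_iff_tendsto_nhds[symmetric, of q 0, unfolded q0])
    then show ?thesis
      by (rule isCont_tendsto_compose[OF cdiff_continuous[OF cdiff_F_on[OF B0(2)]]])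
  qed
  have Fzc: "fps_nth (F (zc D)) k = 0" if "k < wt D (zc D)" for k
    using that
  proof (induction k rule: less_induct)
    case (less k)
    \<comment> \<open>As s = r + 1, the term \<epsilon> F vanishes to an order above r and does not
      disturb the coefficients of Z below r.\<close>
    have "k < wt D (ec D)" using less.prems slots_facts(2,3) by (simp add: sw_def)
    from tendsto_mult[OF Yec[OF this] F_tend]
    have "((\<lambda>t. Y t $ ec D * F_on D (q t) / t ^ k) \<longlongrightarrow> 0) (at 0)"
      by simp
    from scalar_leading_coefficient[OF F _ ode(2) this] less
    have "(of_nat k - of_nat (wt D (zc D))) * fps_nth (F (zc D)) k = 0" by auto
    then show ?case using less.prems by simp
  qed
  have FU: "\<forall>v\<in>Uslots D. k < wt D v \<longrightarrow> fps_nth (F v) k = 0" for k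
  proof (induction k rule: less_induct)
    case (less k)
    show ?case
    proof (intro ballI impI)
      fix v assume v: "v \<in> Uslots D" and k: "k < wt D v"
      show "fps_nth (F v) k = 0"
      proof (cases "k = 0")
        case True then show ?thesis using F_0 by simp
      next
        case False
        \<comment> \<open>The order to which each slot is known to vanish at this stage of the
          induction.\<close>
        define w where "w a = (if a \<in> Uslots D then min k (wt D a) else wt D a)" for a
        have w_pos: "w a \<ge> 1" for a using False wt_pos[of a] by (auto simp: w_def)
        have Fw: "fps_nth (F a) j = 0" if "j < w a" for a j
        proof (cases "a \<in> Uslots D")
          case True
          then show ?thesis using less that by (auto simp: w_def)
        next
          case False
          then have "a = zc D \<or> a = ec D" by (auto simp: Uslots_def)
          then show ?thesis using that False Fzc Fec by (auto simp: w_def)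
        qed
        have lim: "((\<lambda>t. Y t $ a / t ^ w a) \<longlongrightarrow> fps_nth (F a) (w a)) (at 0)" for a
          by (rule has_fps_expansion_leading(1)[OF F Fw])
        \<comment> \<open>Either every factor is known to its full weight, and resonance gives the
          order \<open>wt D v\<close>, which exceeds k. Or some unstable factor is known only to
          order k; since G_1 has no linear terms in these slots, a further factor raises the order
          to at least k + 1.\<close>
        have key: "k + 1 \<le> (\<Sum>a\<in>UNIV. w a * Poly_Mapping.lookup n a)" if n: "n \<in> Poly_Mapping.keys (G1 v)" for n
        proof (cases "\<exists>a\<in>Uslots D. wt D a > k \<and> Poly_Mapping.lookup n a > 0")
          case False
          have "wt D a * Poly_Mapping.lookup n a = w a * Poly_Mapping.lookup n a" for a
            using False by (cases "a \<in> Uslots D"; cases "Poly_Mapping.lookup n a > 0") (auto simp: w_def min_def)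
          then have "(\<Sum>a\<in>UNIV. w a * Poly_Mapping.lookup n a) = (\<Sum>a\<in>UNIV. wt D a * Poly_Mapping.lookup n a)"
            by (intro sum.cong refl) (rule sym)
          then have "(\<Sum>a\<in>UNIV. w a * Poly_Mapping.lookup n a) = wt D v"
            unfolding G1_resonant[OF v n] .
          then show ?thesis using k by simp
        next
          case True
          then obtain a where a: "a \<in> Uslots D" "wt D a > k" "Poly_Mapping.lookup n a > 0" by blast
          have wa: "w a = k" using a by (simp add: w_def)
          have "(\<Sum>b\<in>UNIV. w b * Poly_Mapping.lookup n b) =
              k * Poly_Mapping.lookup n a + (\<Sum>b\<in>UNIV - {a}. w b * Poly_Mapping.lookup n b)"
            by (subst sum.remove[of UNIV a]) (simp_all add: wa)
          moreover have "k + 1 \<le> k * Poly_Mapping.lookup n a + (\<Sum>b\<in>UNIV - {a}. w b * Poly_Mapping.lookup n b)"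
          proof (cases "Poly_Mapping.lookup n a \<ge> 2")
            case True
            then have "k * 2 \<le> k * Poly_Mapping.lookup n a" by (intro mult_le_mono2)
            then show ?thesis using \<open>k \<noteq> 0\<close> by linarith
          next
            case False
            then have na: "Poly_Mapping.lookup n a = 1" using a(3) by simp
            have "n \<noteq> Poly_Mapping.single a 1"
              using G1_no_linear_terms[OF v a(1)] n by (auto simp: in_keys_iff)
            then obtain b where b: "b \<noteq> a" "Poly_Mapping.lookup n b \<noteq> 0"
              using na by (metis lookup_single_eq lookup_single_not_eq poly_mapping_eqI)
            have "1 \<le> w b * Poly_Mapping.lookup n b" using w_pos[of b] b(2) by simp
            also have "\<dots> \<le> (\<Sum>b\<in>UNIV - {a}. w b * Poly_Mapping.lookup n b)"
              using b(1) by (intro member_le_sum) auto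
            finally show ?thesis using na by simp
          qed
          ultimately show ?thesis by simp
        qed
        have "((\<lambda>t. peval (G1 v) (\<lambda>a. Y t $ a) / t ^ k) \<longlongrightarrow> 0) (at 0)"
          by (rule quotient_limit_lower[OF peval_limit[OF lim key]]) simp_all
        moreover have "((\<lambda>t. G2 v (Y t) / t ^ k) \<longlongrightarrow> 0) (at 0)"
          using k N_large[of v] by (intro G2_limit[OF v Y_1 Y_tend]) simp
        ultimately have "((\<lambda>t. peval (G1 v) (\<lambda>a. Y t $ a) / t ^ k + G2 v (Y t) / t ^ k) \<longlongrightarrow> 0 + 0) (at 0)"
          by (rule tendsto_add)
        then have R: "((\<lambda>t. (peval (G1 v) (\<lambda>a. Y t $ a) + G2 v (Y t)) / t ^ k) \<longlongrightarrow> 0) (at 0)"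
          by (simp add: add_divide_distrib)
        have "fps_nth (F v) j = 0" if "j < k" for j
          using less[OF that] v that k by simp
        from scalar_leading_coefficient[OF F this ode(1)[OF v] R]
        have "(of_nat k - of_nat (wt D v)) * fps_nth (F v) k = 0" .
        then show ?thesis using k by simp
      qed
    qed
  qed
  have Fall: "fps_nth (F v) k = 0" if "k < wt D v" for v k
  proof (cases "v \<in> Uslots D")
    case True then show ?thesis using FU that by blast
  next
    case False
    then have "v = zc D \<or> v = ec D" by (auto simp: Uslots_def)
    then show ?thesis using Fzc Fec that by blast
  qed
  define u :: "complex^'b" where "u = (\<chi> v. fps_nth (F v) (wt D v))"
  have lim: "((\<lambda>t. Y t $ v / t ^ wt D v) \<longlongrightarrow> u $ v) (at 0)" for v
    unfolding u_def vec_lambda_beta by (rule has_fps_expansion_leading(1)[OF F Fall])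
  \<comment> \<open>At the order equal to the weight the linear terms cancel, and the resonant
    monomials, all of exactly this weight, contribute G_1(u).\<close>
  have "peval (G1 v) (\<lambda>a. u $ a) = 0" if v: "v \<in> Uslots D" for v
  proof -
    have "((\<lambda>t. peval (G1 v) (\<lambda>a. Y t $ a) / t ^ wt D v) \<longlongrightarrow> (\<Sum>n\<in>Poly_Mapping.keys (G1 v).
       if (\<Sum>a\<in>UNIV. wt D a * Poly_Mapping.lookup n a) = wt D v
       then Poly_Mapping.lookup (G1 v) n * (\<Prod>a\<in>UNIV. u $ a ^ Poly_Mapping.lookup n a) else 0)) (at 0)"
      by (rule peval_limit[OF lim]) (simp add: G1_resonant[OF v])
    also have "(\<Sum>n\<in>Poly_Mapping.keys (G1 v).
       if (\<Sum>a\<in>UNIV. wt D a * Poly_Mapping.lookup n a) = wt D v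
       then Poly_Mapping.lookup (G1 v) n * (\<Prod>a\<in>UNIV. u $ a ^ Poly_Mapping.lookup n a) else 0)
       = peval (G1 v) (\<lambda>a. u $ a)"
      unfolding peval_UNIV by (intro sum.cong refl) (simp add: G1_resonant[OF v])
    finally have G1l: "((\<lambda>t. peval (G1 v) (\<lambda>a. Y t $ a) / t ^ wt D v) \<longlongrightarrow> peval (G1 v) (\<lambda>a. u $ a)) (at 0)" .
    have "((\<lambda>t. G2 v (Y t) / t ^ wt D v) \<longlongrightarrow> 0) (at 0)"
      using N_large[of v] by (intro G2_limit[OF v Y_1 Y_tend]) simp
    from tendsto_add[OF G1l this]
    have "((\<lambda>t. (peval (G1 v) (\<lambda>a. Y t $ a) + G2 v (Y t)) / t ^ wt D v) \<longlongrightarrow> peval (G1 v) (\<lambda>a. u $ a)) (at 0)"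
      by (simp add: add_divide_distrib)
    from scalar_leading_coefficient[OF F Fall ode(1)[OF v] this]
    show ?thesis by simp
  qed
  then show ?thesis using that[of u] lim unfolding Y_def by blast
qed

text \<open>If the curves differ, the leading coefficient x of the difference is an eigenvector for
  its order n. In slots of weight n it vanishes because the prescribed coefficients agree, in the
  other slots because the linear part is triangular with the weights on its diagonal. The slots are
  taken in the order \<epsilon>, Z, unstable.\<close>

lemma solution_unique:
  assumes q1: "solution q1" and q2: "solution q2"
    and l1: "\<And>v. ((\<lambda>t. H (q1 t) $ v / t ^ wt D v) \<longlongrightarrow> u $ v) (at 0)"
    and l2: "\<And>v. ((\<lambda>t. H (q2 t) $ v / t ^ wt D v) \<longlongrightarrow> u $ v) (at 0)"
  shows "\<forall>\<^sub>F t in nhds 0. q1 t = q2 t"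
proof -
  have an1: "\<And>v. (\<lambda>t. q1 t $ v) analytic_on {0}" and q10: "q1 0 = 0"
    and ode1: "\<forall>\<^sub>F t in nhds 0. \<forall>v. t * deriv (\<lambda>t. q1 t $ v) t = red_field D (q1 t) $ v"
    using q1 unfolding solution_def by blast+
  have an2: "\<And>v. (\<lambda>t. q2 t $ v) analytic_on {0}" and q20: "q2 0 = 0"
    and ode2: "\<forall>\<^sub>F t in nhds 0. \<forall>v. t * deriv (\<lambda>t. q2 t $ v) t = red_field D (q2 t) $ v"
    using q2 unfolding solution_def by blast+
  define \<delta> where "\<delta> t = q1 t - q2 t" for t
  have d_an: "(\<lambda>t. \<delta> t $ v) analytic_on {0}" for v
    unfolding \<delta>_def vector_minus_component by (intro analytic_on_diff an1 an2)
  have "\<forall>\<^sub>F t in nhds 0. \<forall>v. ((\<lambda>t. q1 t $ v) has_field_derivative deriv (\<lambda>t. q1 t $ v) t) (at t)"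
    "\<forall>\<^sub>F t in nhds 0. \<forall>v. ((\<lambda>t. q2 t $ v) has_field_derivative deriv (\<lambda>t. q2 t $ v) t) (at t)"
    by (intro eventually_all_finite analytic_eventually_has_derivative an1 an2)+
  with ode1 ode2 have d_ode: "\<forall>\<^sub>F t in nhds 0. (\<chi> v. t * deriv (\<lambda>t. \<delta> t $ v) t) = red_field D (q1 t) - red_field D (q2 t)"
  proof eventually_elim
    case (elim t)
    have "deriv (\<lambda>t. \<delta> t $ v) t = deriv (\<lambda>t. q1 t $ v) t - deriv (\<lambda>t. q2 t $ v) t" for v
      unfolding \<delta>_def vector_minus_component using elim(3,4) by (intro DERIV_imp_deriv DERIV_diff) auto
    then show ?case using elim(1,2) by (simp add: vec_eq_iff right_diff_distrib)
  qed
  have t1: "(q1 \<longlongrightarrow> 0) (nhds 0)" and t2: "(q2 \<longlongrightarrow> 0) (nhds 0)"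
    using analytic_vec_tendsto[OF an1] analytic_vec_tendsto[OF an2] q10 q20 by simp_all
  have at_nhds: "at (0::complex) \<le> nhds 0" by (simp add: at_within_def)
  note t1' = tendsto_mono[OF at_nhds t1] and t2' = tendsto_mono[OF at_nhds t2]
  have est: "\<forall>\<^sub>F t in at 0. norm ((\<chi> v. t * deriv (\<lambda>t. \<delta> t $ v) t) - red_deriv (\<delta> t)) \<le> e * norm (\<delta> t)" if pe: "e > 0" for e
  proof -
    obtain r where r: "r > 0" "\<And>x y. x \<in> ball 0 r \<Longrightarrow> y \<in> ball 0 r \<Longrightarrow>
        norm (red_field D x - red_field D y - red_deriv (x - y)) \<le> e * norm (x - y)"
      by (rule strictly_differentiableE[OF strict_red_field pe]) auto
    have "\<forall>\<^sub>F t in at 0. q1 t \<in> ball 0 r" "\<forall>\<^sub>F t in at 0. q2 t \<in> ball 0 r"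
      using r(1) topological_tendstoD[OF t1' open_ball, of 0 r] topological_tendstoD[OF t2' open_ball, of 0 r] by simp_all
    with eventually_nhds_imp_at[OF d_ode] show ?thesis
    proof eventually_elim
      case (elim t)
      have "norm (red_field D (q1 t) - red_field D (q2 t) - red_deriv (\<delta> t)) \<le> e * norm (\<delta> t)"
        unfolding \<delta>_def by (rule r(2)[OF elim(2,3)])
      then show ?case unfolding elim(1) .
    qed
  qed
  have "(\<forall>\<^sub>F t in nhds 0. \<delta> t = 0) \<or>
    (\<exists>n x. x \<noteq> 0 \<and> ((\<lambda>t. inverse (t ^ n) *s \<delta> t) \<longlongrightarrow> x) (at 0) \<and> red_deriv x = of_nat n *s x)"
    by (rule leading_coefficient_eigenvector[OF d_an bounded_linear_red_deriv red_deriv(2)]) (rule est)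
  then show ?thesis
  proof (elim disjE exE conjE)
    assume "\<forall>\<^sub>F t in nhds 0. \<delta> t = 0"
    then show ?thesis by eventually_elim (simp add: \<delta>_def)
  next
    fix n x assume x: "x \<noteq> 0" "((\<lambda>t. inverse (t ^ n) *s \<delta> t) \<longlongrightarrow> x) (at 0)" "red_deriv x = of_nat n *s x"
    have Hl: "((\<lambda>t. inverse (t ^ n) *s (H (q1 t) - H (q2 t))) \<longlongrightarrow> H' x) (at 0)"
      using x(2) unfolding \<delta>_def
      by (intro strictly_differentiable_quotient[OF strict_H has_derivative_bounded_linear[OF H'(1)] H'(2) t1' t2'])
    have H'n: "H' x $ v = 0" if n: "wt D v = n" for v
    proof -
      have "((\<lambda>t. H (q1 t) $ v / t ^ wt D v - H (q2 t) $ v / t ^ wt D v) \<longlongrightarrow> u $ v - u $ v) (at 0)"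
        by (rule tendsto_diff[OF l1 l2])
      moreover have "((\<lambda>t. H (q1 t) $ v / t ^ wt D v - H (q2 t) $ v / t ^ wt D v) \<longlongrightarrow> H' x $ v) (at 0)"
        using tendsto_vec_nth[OF Hl, of v] by (simp add: n divide_inverse algebra_simps)
      ultimately have "u $ v - u $ v = H' x $ v" by (rule tendsto_unique[OF at_neq_bot])
      then show ?thesis by simp
    qed
    have ev: "red_deriv x $ v = of_nat n * x $ v" for v using x(3) by simp
    have cancel: "x $ v = 0" if "of_nat (wt D v) * x $ v = of_nat n * x $ v" "wt D v = n \<Longrightarrow> x $ v = 0" for v
      using that by (cases "wt D v = n") auto
    have e0: "x $ ec D = 0"
      by (rule cancel) (use ev[of "ec D"] red_deriv_nth(1)[of x] slots_facts(3) H'n[of "ec D"] H'_ec[of x] in simp_all)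
    have z0: "x $ zc D = 0"
      by (rule cancel) (use e0 ev[of "zc D"] red_deriv_nth(2)[of x] slots_facts(2) H'n[of "zc D"] H'_zc[of x] in simp_all)
    have "x $ v = 0" if v: "v \<in> Uslots D" for v
      by (rule cancel) (use ev[of v] red_deriv_nth(3)[OF v z0 e0] H'n[of v] H'_U[OF v z0 e0] in simp_all)
    then have "x $ v = 0" for v
      using e0 z0 by (cases v rule: slot_cases) auto
    then have "x = 0" by (simp add: vec_eq_iff)
    then show ?thesis using x(1) by simp
  qed
qed

end

section \<open>The weighted blow-up\<close>

lemma peval_superset:
  assumes "finite K" "Poly_Mapping.keys P \<subseteq> K"
  shows "peval P y = (\<Sum>n\<in>K. Poly_Mapping.lookup P n * (\<Prod>v\<in>Poly_Mapping.keys n. y v ^ Poly_Mapping.lookup n v))"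
  unfolding peval_def using assms by (intro sum.mono_neutral_left) (auto simp: in_keys_iff)

lemma peval_add: "peval (P + Q) y = peval P y + peval Q y"
proof -
  let ?K = "Poly_Mapping.keys P \<union> Poly_Mapping.keys Q"
  have "finite ?K" "Poly_Mapping.keys P \<subseteq> ?K" "Poly_Mapping.keys Q \<subseteq> ?K" "Poly_Mapping.keys (P + Q) \<subseteq> ?K"
    using keys_add[of P Q] by auto
  then show ?thesis
    by (simp add: peval_superset[of ?K] lookup_add distrib_right sum.distrib)
qed

lemma peval_zero: "peval 0 y = 0"
  by (simp add: peval_def)

lemma peval_sum: "peval (\<Sum>i\<in>I. P i) y = (\<Sum>i\<in>I. peval (P i) y)"
  by (induction I rule: infinite_finite_induct) (simp_all add: peval_zero peval_add)

lemma peval_single: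
  fixes n :: "'v::finite \<Rightarrow>\<^sub>0 nat"
  shows "peval (Poly_Mapping.single n c) y = c * (\<Prod>v\<in>UNIV. y v ^ Poly_Mapping.lookup n v)"
  by (cases "c = 0") (simp_all add: peval_UNIV)

lemma powi_neg: "(w::complex) powi (- 1 - int l) = inverse (w ^ Suc l)"
proof -
  have "- 1 - int l = - int (Suc l)" by simp
  then show ?thesis by (simp only: power_int_minus power_int_of_nat)
qed

lemma cdiff_zero_of_quadratic_bound:
  fixes f :: "complex^'n::finite \<Rightarrow> complex"
  assumes "f a = 0" "r > 0" "C > 0" and b: "\<And>x. norm (x - a) < r \<Longrightarrow> norm (f x) \<le> C * norm (x - a) ^ 2"
  shows "cdiff (*s) (*) f a"
proof -
  have "(f has_derivative (\<lambda>_. 0)) (at a)"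
    unfolding has_derivative_at_alt
  proof (intro conjI allI impI)
    fix e :: real assume e: "e > 0"
    show "\<exists>d>0. \<forall>y. norm (y - a) < d \<longrightarrow> norm (f y - f a - 0) \<le> e * norm (y - a)"
    proof (intro exI[of _ "min r (e / C)"] conjI allI impI)
      show "min r (e / C) > 0" using assms(2,3) e by simp
      fix y assume y: "norm (y - a) < min r (e / C)"
      have "C * norm (y - a) \<le> e" using y assms(3) by (simp add: pos_less_divide_eq mult.commute less_imp_le)
      then have "C * norm (y - a) * norm (y - a) \<le> e * norm (y - a)" by (rule mult_right_mono) simp
      moreover have "norm (f y) \<le> C * norm (y - a) ^ 2" using y by (intro b) simp
      ultimately show "norm (f y - f a - 0) \<le> e * norm (y - a)"
        using assms(1) by (simp add: power2_eq_square mult.assoc)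
    qed
  qed simp
  then show ?thesis unfolding cdiff_def by (intro exI[of _ "\<lambda>_. 0"]) simp
qed

context normal_form_system
begin

lemma blowup_nth: "blowup D a $ ec D = a $ ec D ^ wt D (ec D)"
  "v \<noteq> ec D \<Longrightarrow> blowup D a $ v = a $ v * a $ ec D ^ wt D v"
  by (simp_all add: blowup_def slots_facts(3))

lemma cdiff_blowup: "cdiff (*s) (*s) (blowup D) a"
  unfolding cdiff_vec_iff
proof
  fix v show "cdiff (*s) (*) (\<lambda>a. blowup D a $ v) a"
    by (cases "v = ec D") (simp_all add: blowup_nth cdiff_power cdiff_mult cdiff_nth)
qed

lemma blowup_divisor: "a \<in> divisor D \<Longrightarrow> blowup D a = 0"
  unfolding vec_eq_iff
proof
  fix v assume "a \<in> divisor D"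
  then show "blowup D a $ v = 0 $ v"
    using wt_pos[of v] by (cases "v = ec D") (simp_all add: blowup_nth divisor_def power_0_left)
qed

lemma open_blowup_preimage: "open S \<Longrightarrow> open {a. blowup D a \<in> S}"
  using open_vimage[of S "blowup D"] cdiff_continuous[OF cdiff_blowup]
  by (simp add: continuous_at_imp_continuous_on vimage_def)

lemma F_blowup_nz: "a \<in> blowup_domain D h B \<Longrightarrow> F_blowup D h B a \<noteq> 0"
  unfolding blowup_domain_def F_blowup_def by (simp add: F_normal_nz)

lemma divisor_subset: "divisor D \<subseteq> blowup_domain D h B"
  using blowup_divisor zero_in_image by (auto simp: blowup_domain_def)

text \<open>Both sides are compared slot by slot. The slot of \<epsilon> gives dw/dt = w; with this
  the terms carrying the weights cancel, and the other slots read dz/dt = w F and du/dt = (G_1 +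
  G_2) / w^\<lambda>. Off the divisor dz/dt is nonzero, and division by it gives the system in
  z.\<close>

lemma transforms_into_blowup: "transforms_into_blowup_system D h G1 G2 B"
  unfolding transforms_into_blowup_system_def
proof (intro allI impI)
  fix \<gamma> :: "complex \<Rightarrow> complex^'b" and d t
  assume der: "\<forall>v. ((\<lambda>\<tau>. \<gamma> \<tau> $ v) has_field_derivative d $ v) (at t)"
    and mem: "\<gamma> t \<in> blowup_domain D h B - divisor D"
  define a where "a = \<gamma> t"
  define w where "w = a $ ec D"
  define F where "F = F_blowup D h B a"
  define g where "g v = peval (G1 v) (\<lambda>b. blowup D a $ b) + G2 v (blowup D a)" for v
  have w: "w \<noteq> 0" and F: "F \<noteq> 0"
    using mem F_blowup_nz unfolding w_def F_def a_def divisor_def by auto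
  have wp: "w ^ (wt D v - 1) = w ^ wt D v / w" for v
    using w wt_pos[of v] by (cases "wt D v") simp_all
  define E where "E v = (if v = ec D then of_nat (wt D v) * (w ^ wt D v / w) * d $ ec D
     else d $ v * w ^ wt D v + a $ v * (of_nat (wt D v) * (w ^ wt D v / w) * d $ ec D))" for v
  have derE: "((\<lambda>\<tau>. blowup D (\<gamma> \<tau>) $ v) has_field_derivative E v) (at t)" for v
  proof -
    have pw: "((\<lambda>\<tau>. \<gamma> \<tau> $ ec D ^ wt D v) has_field_derivative of_nat (wt D v) * (w ^ wt D v / w) * d $ ec D) (at t)"
    proof -
      have eq: "of_nat (wt D v) * (w ^ wt D v / w) * d $ ec D = of_nat (wt D v) * (d $ ec D * \<gamma> t $ ec D ^ (wt D v - Suc 0))"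
        unfolding wp[symmetric] by (simp add: w_def a_def)
      show ?thesis
        unfolding eq by (rule DERIV_power[OF der[rule_format, of "ec D"], of "wt D v"])
    qed
    show ?thesis
    proof (cases "v = ec D")
      case True
      then show ?thesis using pw by (simp add: blowup_nth E_def)
    next
      case False
      from DERIV_mult[OF der[rule_format, of v] pw]
      show ?thesis using False by (simp add: blowup_nth E_def w_def a_def mult_ac add_ac)
    qed
  qed
  let ?NF = "normal_field D h G1 G2 B (blowup D a)"
  have lhs: "(\<forall>v. ((\<lambda>\<tau>. blowup D (\<gamma> \<tau>) $ v) has_field_derivative ?NF $ v) (at t)) \<longleftrightarrow> (\<forall>v. E v = ?NF $ v)"
  proof
    assume l: "\<forall>v. ((\<lambda>\<tau>. blowup D (\<gamma> \<tau>) $ v) has_field_derivative ?NF $ v) (at t)"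
    show "\<forall>v. E v = ?NF $ v"
      by (rule allI, rule DERIV_unique[OF derE l[rule_format]])
  next
    assume "\<forall>v. E v = ?NF $ v"
    then show "\<forall>v. ((\<lambda>\<tau>. blowup D (\<gamma> \<tau>) $ v) has_field_derivative ?NF $ v) (at t)" using derE by metis
  qed
  have NF_ec: "?NF $ ec D = of_nat (wt D (ec D)) * w ^ wt D (ec D)"
    using slots_facts(1,3) by (simp add: normal_field_def blowup_nth w_def)
  \<comment> \<open>Here \<epsilon> = w^(r+1) is split as w^r w, so that w^r can be cancelled
    against the factor in Z.\<close>
  have NF_zc: "?NF $ zc D = of_nat (wt D (zc D)) * (a $ zc D * w ^ wt D (zc D)) + w ^ wt D (zc D) * w * F"
    using slots_facts(1,2,3) by (simp add: normal_field_def blowup_nth w_def F_def F_blowup_def sw_def)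
  have NF_U: "?NF $ v = of_nat (wt D v) * (a $ v * w ^ wt D v) + g v" if "v \<in> Uslots D" for v
    using Uslots_neq[OF that] by (simp add: normal_field_def blowup_nth w_def g_def)
  have E_ec: "E (ec D) = ?NF $ ec D \<longleftrightarrow> d $ ec D = w"
  proof -
    define c where "c = of_nat (wt D (ec D)) * (w ^ wt D (ec D) / w)"
    have "c \<noteq> 0" using w wt_pos[of "ec D"] by (simp add: c_def)
    moreover have "?NF $ ec D = c * w" using w by (simp add: NF_ec c_def)
    moreover have "E (ec D) = c * d $ ec D" by (simp add: E_def c_def)
    ultimately show ?thesis by simp
  qed
  have E_zc: "E (zc D) = ?NF $ zc D \<longleftrightarrow> d $ zc D = w * F" if "d $ ec D = w"
  proof -
    have "E (zc D) = d $ zc D * w ^ wt D (zc D) + of_nat (wt D (zc D)) * (a $ zc D * w ^ wt D (zc D))"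
      using slots_facts(1) that w by (simp add: E_def)
    then have "E (zc D) = ?NF $ zc D \<longleftrightarrow> d $ zc D * w ^ wt D (zc D) = w * F * w ^ wt D (zc D)"
      unfolding NF_zc by (simp add: algebra_simps)
    then show ?thesis using w by simp
  qed
  have E_U: "E v = ?NF $ v \<longleftrightarrow> d $ v = g v / w ^ wt D v" if "d $ ec D = w" "v \<in> Uslots D" for v
  proof -
    have "E v = d $ v * w ^ wt D v + of_nat (wt D v) * (a $ v * w ^ wt D v)"
      using Uslots_neq[OF that(2)] that(1) w by (simp add: E_def)
    then have "E v = ?NF $ v \<longleftrightarrow> d $ v * w ^ wt D v = g v"
      unfolding NF_U[OF that(2)] by (simp add: algebra_simps)
    then show ?thesis using w by (simp add: nonzero_eq_divide_eq)
  qed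
  let ?V = "blowup_rhs D h G1 G2 B a"
  have V_zc: "?V $ zc D = 1" by (simp add: blowup_rhs_def)
  have V_ec: "?V $ ec D = 1 / F" using slots_facts(1) by (simp add: blowup_rhs_def F_def)
  have V_U: "w * F * ?V $ v = g v / w ^ wt D v" if "v \<in> Uslots D" for v
  proof -
    have "?V $ v = inverse (w ^ Suc (wt D v)) * g v / F"
      using Uslots_neq[OF that] by (simp add: blowup_rhs_def powi_neg w_def g_def F_def)
    then have "w * F * ?V $ v = (w * inverse w) * (F * inverse F) * (g v * inverse (w ^ wt D v))"
      by (simp only: divide_inverse power_Suc inverse_mult_distrib mult_ac)
    then show ?thesis using w F by (simp add: divide_inverse)
  qed
  have all_slots: "(\<forall>v. Q v) \<longleftrightarrow> Q (ec D) \<and> Q (zc D) \<and> (\<forall>v\<in>Uslots D. Q v)" for Q :: "'b \<Rightarrow> bool"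
    by (auto simp: Uslots_def)
  have rhs: "(d $ zc D = w * F \<and> d = d $ zc D *s ?V) \<longleftrightarrow>
      d $ ec D = w \<and> d $ zc D = w * F \<and> (\<forall>v\<in>Uslots D. d $ v = g v / w ^ wt D v)"
  proof (cases "d $ zc D = w * F")
    case True
    have "d = d $ zc D *s ?V \<longleftrightarrow> (\<forall>v. d $ v = w * F * ?V $ v)"
      by (simp add: vec_eq_iff True)
    also have "\<dots> \<longleftrightarrow> d $ ec D = w \<and> (\<forall>v\<in>Uslots D. d $ v = g v / w ^ wt D v)"
      unfolding all_slots[of "\<lambda>v. d $ v = w * F * ?V $ v"] using F True by (simp add: V_zc V_ec V_U)
    finally show ?thesis using True by simp
  next
    case False
    then show ?thesis by simp
  qed
  show "(\<forall>v. ((\<lambda>\<tau>. blowup D (\<gamma> \<tau>) $ v) has_field_derivative normal_field D h G1 G2 B (blowup D (\<gamma> t)) $ v) (at t)) \<longleftrightarrow>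
     d $ zc D = \<gamma> t $ ec D * F_blowup D h B (\<gamma> t) \<and> d = d $ zc D *s blowup_rhs D h G1 G2 B (\<gamma> t)"
    unfolding a_def[symmetric] w_def[symmetric] F_def[symmetric] lhs rhs all_slots[of "\<lambda>v. E v = ?NF $ v"]
    using E_ec E_zc E_U by blast
qed

definition G2_ext :: "'b \<Rightarrow> complex^'b \<Rightarrow> complex" where
  "G2_ext v a = (if a $ ec D = 0 then 0 else a $ ec D powi (- 1 - int (wt D v)) * G2 v (blowup D a))"

lemma open_blowup_domain: "open (blowup_domain D h B)"
  unfolding blowup_domain_def by (rule open_blowup_preimage[OF open_image])

text \<open>All weights are at least 1, so w divides every component of the blow-up; the quotient
  \<open>m\<close> is continuous, hence bounded near \<open>a\<close>.\<close>

lemma blowup_linear_bound: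
  assumes "a \<in> divisor D"
  obtains r K where "r > 0" "K > 0" "\<And>b. norm (b - a) < r \<Longrightarrow> norm (blowup D b) \<le> K * norm (b $ ec D)"
proof -
  define m where "m b = (\<chi> v. if v = ec D then b $ ec D ^ (wt D v - 1) else b $ v * b $ ec D ^ (wt D v - 1))" for b :: "complex^'b"
  have eq: "blowup D b = b $ ec D *s m b" for b
    unfolding vec_eq_iff
  proof
    fix v
    have "x ^ wt D v = x * x ^ (wt D v - 1)" for x :: complex
      using wt_pos[of v] by (cases "wt D v") auto
    then show "blowup D b $ v = (b $ ec D *s m b) $ v"
      by (cases "v = ec D") (simp_all add: blowup_nth m_def)
  qed
  have "cdiff (*s) (*s) m a"
    unfolding cdiff_vec_iff
  proof
    fix v show "cdiff (*s) (*) (\<lambda>b. m b $ v) a"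
      by (cases "v = ec D") (simp_all add: m_def cdiff_power cdiff_mult cdiff_nth)
  qed
  then have "isCont m a" by (rule cdiff_continuous)
  then obtain r where r: "r > 0" "\<And>b. dist b a < r \<Longrightarrow> dist (m b) (m a) < 1"
    unfolding continuous_at_eps_delta using zero_less_one by blast
  show ?thesis
  proof (rule that[of r "norm (m a) + 1"])
    show "norm (m a) + 1 > 0" by (simp add: add_nonneg_pos)
    fix b assume "norm (b - a) < r"
    then have "norm (m b - m a) < 1" using r(2)[of b] by (simp add: dist_norm)
    then have "norm (m b) \<le> norm (m a) + 1" using norm_triangle_ineq2[of "m b" "m a"] by simp
    then show "norm (blowup D b) \<le> (norm (m a) + 1) * norm (b $ ec D)"
      unfolding eq norm_vector_smult by (subst mult.commute) (rule mult_right_mono, auto)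
  qed (rule r(1))
qed

lemma cdiff_G2_ext:
  assumes v: "v \<in> Uslots D" and a: "a \<in> blowup_domain D h B"
  shows "cdiff (*s) (*) (G2_ext v) a"
proof (cases "a $ ec D = 0")
  case False
  have G2: "cdiff (*s) (*) (G2 v) (blowup D a)"
    using G2_holo[OF v] a unfolding holo_on_iff blowup_domain_def by blast
  have "cdiff (*s) (*) (\<lambda>a. inverse (a $ ec D ^ Suc (wt D v)) * G2 v (blowup D a)) a"
    by (intro cdiff_mult cdiff_inverse cdiff_power cdiff_nth cdiff_compose[OF cdiff_blowup G2]) (use False in simp)
  moreover have "open {a :: complex^'b. a $ ec D \<noteq> 0}"
    by (intro open_Collect_neq continuous_intros)
  ultimately show ?thesis
    by (rule cdiff_cong_open) (use False in \<open>simp_all only: G2_ext_def powi_neg mem_Collect_eq if_False simp_thms\<close>)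
next
  case True
  then have div: "a \<in> divisor D" by (simp add: divisor_def)
  obtain r K where K: "r > 0" "K > 0" "\<And>b. norm (b - a) < r \<Longrightarrow> norm (blowup D b) \<le> K * norm (b $ ec D)"
    using blowup_linear_bound[OF div] by blast
  obtain C where C: "C > 0" "\<forall>\<^sub>F y in nhds 0. norm (G2 v y) \<le> C * norm y ^ (N + 1)"
    using G2_bound[OF v] .
  obtain r2 where r2: "r2 > 0" "\<And>y. norm y < r2 \<Longrightarrow> norm (G2 v y) \<le> C * norm y ^ (N + 1)"
    using C(2) unfolding eventually_nhds_metric dist_norm by auto
  \<comment> \<open>\<open>r2 / K\<close> keeps the blow-up where the bound on G_2 holds; the bound
    1 gives |w| < 1, so that |w|^(N - \<lambda>) is at most |w|^2.\<close>
  define \<rho> where "\<rho> = min (min r 1) (r2 / K)"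
  have \<rho>: "\<rho> > 0" "\<rho> \<le> r" "\<rho> \<le> 1" "\<rho> \<le> r2 / K" using K(1,2) r2(1) by (auto simp: \<rho>_def)
  show ?thesis
  proof (rule cdiff_zero_of_quadratic_bound[of _ _ \<rho> "C * K ^ (N + 1)"])
    show "G2_ext v a = 0" by (simp add: G2_ext_def True)
    fix b assume b: "norm (b - a) < \<rho>"
    define w where "w = b $ ec D"
    have "norm ((b - a) $ ec D) \<le> norm (b - a)" by (rule Finite_Cartesian_Product.norm_nth_le)
    then have wb: "norm w \<le> norm (b - a)" using True by (simp add: w_def)
    have wr: "norm w < 1" "norm w < r2 / K" using wb b \<rho> by linarith+
    show "norm (G2_ext v b) \<le> C * K ^ (N + 1) * norm (b - a) ^ 2"
    proof (cases "w = 0")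
      case True
      then have "G2_ext v b = 0" by (simp add: G2_ext_def w_def)
      then show ?thesis using C(1) K(2) by simp
    next
      case False
      have bl: "norm (blowup D b) \<le> K * norm w" using K(3)[of b] b \<rho> by (simp add: w_def)
      moreover have "K * norm w < r2" using wr(2) K(2) by (simp add: pos_less_divide_eq mult.commute)
      ultimately have "norm (G2 v (blowup D b)) \<le> C * norm (blowup D b) ^ (N + 1)" by (intro r2(2)) simp
      also have "\<dots> \<le> C * (K * norm w) ^ (N + 1)"
        using bl C(1) by (intro mult_left_mono power_mono) auto
      finally have g: "norm (G2 v (blowup D b)) \<le> C * (K * norm w) ^ (N + 1)" .
      \<comment> \<open>The powers 1 + \<lambda> are spent on the division; N - \<lambda>, at least
        2, remain.\<close>
      have split: "N + 1 = Suc (wt D v) + (N - wt D v)" using N_large[of v] by simp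
      have "norm (G2_ext v b) = norm (G2 v (blowup D b)) / norm w ^ Suc (wt D v)"
        using False unfolding G2_ext_def powi_neg w_def[symmetric]
        by (simp only: if_False norm_mult norm_inverse norm_power divide_inverse mult.commute)
      also have "\<dots> \<le> C * (K * norm w) ^ (N + 1) / norm w ^ Suc (wt D v)"
        using g by (rule divide_right_mono) simp
      also have "\<dots> = C * K ^ (N + 1) * (norm w ^ Suc (wt D v) * norm w ^ (N - wt D v)) / norm w ^ Suc (wt D v)"
        unfolding power_mult_distrib power_add[symmetric] split[symmetric] by (simp only: mult.assoc)
      also have "\<dots> = C * K ^ (N + 1) * norm w ^ (N - wt D v)"
        using False by simp
      also have "\<dots> \<le> C * K ^ (N + 1) * norm w ^ 2"
        using C(1) K(2) wr(1) N_large[of v] by (intro mult_left_mono power_decreasing) auto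
      also have "\<dots> \<le> C * K ^ (N + 1) * norm (b - a) ^ 2"
        using C(1) K(2) wb by (intro mult_left_mono power_mono) auto
      finally show ?thesis .
    qed
  qed (use \<rho>(1) C(1) K(2) in simp_all)
qed

lemma G2_holo_near_divisor:
  assumes "v \<in> Uslots D"
  shows "holo_near_divisor D (blowup_domain D h B)
        (\<lambda>a. a $ ec D powi (- 1 - int (wt D v)) * G2 v (blowup D a))"
  unfolding holo_near_divisor_def holo_on_iff
proof (intro exI[of _ "blowup_domain D h B"] exI[of _ "G2_ext v"] conjI ballI)
  show "G2_ext v a = a $ ec D powi (- 1 - int (wt D v)) * G2 v (blowup D a)" if "a \<in> blowup_domain D h B - divisor D" for a
    using that by (simp add: G2_ext_def divisor_def)
qed (use divisor_subset open_blowup_domain cdiff_G2_ext[OF assms] in auto)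

text \<open>Under the blow-up a monomial contributes w to the power of its weight, and resonance
  makes this power \<lambda> for every term. The slot of \<epsilon> contributes no further factor
  because \<epsilon> = w^s, so its exponent is dropped.\<close>

lemma G1_blowup_polynomial:
  assumes v: "v \<in> Uslots D"
  shows "\<exists>P. (\<forall>n\<in>Poly_Mapping.keys P. Poly_Mapping.lookup n (ec D) = 0) \<and>
        (\<forall>a. a $ ec D \<noteq> 0 \<longrightarrow>
           a $ ec D powi (- 1 - int (wt D v)) * peval (G1 v) (\<lambda>b. blowup D a $ b)
             = a $ ec D powi (- 1) * peval P (\<lambda>b. a $ b))"
proof -
  define drop_ec where "drop_ec n = Poly_Mapping.update (ec D) 0 n" for n :: "'b \<Rightarrow>\<^sub>0 nat"
  have dl: "Poly_Mapping.lookup (drop_ec n) b = (if b = ec D then 0 else Poly_Mapping.lookup n b)" for n b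
    by (simp add: drop_ec_def lookup_update)
  define P where "P = (\<Sum>n\<in>Poly_Mapping.keys (G1 v). Poly_Mapping.single (drop_ec n) (Poly_Mapping.lookup (G1 v) n))"
  have keys: "Poly_Mapping.lookup k (ec D) = 0" if "k \<in> Poly_Mapping.keys P" for k
  proof -
    have "k \<in> (\<Union>n\<in>Poly_Mapping.keys (G1 v). Poly_Mapping.keys (Poly_Mapping.single (drop_ec n) (Poly_Mapping.lookup (G1 v) n)))"
      using that keys_sum[of "\<lambda>n. Poly_Mapping.single (drop_ec n) (Poly_Mapping.lookup (G1 v) n)" "Poly_Mapping.keys (G1 v)"]
      unfolding P_def by blast
    then obtain n where "k \<in> Poly_Mapping.keys (Poly_Mapping.single (drop_ec n) (Poly_Mapping.lookup (G1 v) n))"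
      by blast
    then have "k = drop_ec n" by (auto split: if_splits)
    then show ?thesis by (simp add: dl)
  qed
  have pe: "peval (G1 v) (\<lambda>b. blowup D a $ b) = a $ ec D ^ wt D v * peval P (\<lambda>b. a $ b)" for a
  proof -
    define w where "w = a $ ec D"
    have mono: "(\<Prod>b\<in>UNIV. (blowup D a $ b) ^ Poly_Mapping.lookup n b) = w ^ wt D v * (\<Prod>b\<in>UNIV. a $ b ^ Poly_Mapping.lookup (drop_ec n) b)"
      if n: "n \<in> Poly_Mapping.keys (G1 v)" for n
    proof -
      have "(blowup D a $ b) ^ Poly_Mapping.lookup n b = w ^ (wt D b * Poly_Mapping.lookup n b) * a $ b ^ Poly_Mapping.lookup (drop_ec n) b" for b
        by (cases "b = ec D") (simp_all add: blowup_nth dl w_def power_mult power_mult_distrib)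
      then have "(\<Prod>b\<in>UNIV. (blowup D a $ b) ^ Poly_Mapping.lookup n b) =
          w ^ (\<Sum>b\<in>UNIV. wt D b * Poly_Mapping.lookup n b) * (\<Prod>b\<in>UNIV. a $ b ^ Poly_Mapping.lookup (drop_ec n) b)"
        by (simp add: prod.distrib power_sum)
      then show ?thesis unfolding G1_resonant[OF v n] .
    qed
    have "peval (G1 v) (\<lambda>b. blowup D a $ b) = (\<Sum>n\<in>Poly_Mapping.keys (G1 v). w ^ wt D v *
        (Poly_Mapping.lookup (G1 v) n * (\<Prod>b\<in>UNIV. a $ b ^ Poly_Mapping.lookup (drop_ec n) b)))"
      unfolding peval_UNIV by (intro sum.cong refl) (simp add: mono)
    then show ?thesis
      by (simp add: P_def peval_sum peval_single sum_distrib_left w_def)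
  qed
  have "w powi (- 1 - int (wt D v)) * (w ^ wt D v * x) = w powi (- 1) * x" if "w \<noteq> 0" for w x :: complex
    using that by (simp add: powi_neg power_int_minus)
  then show ?thesis
    using keys pe by (intro exI[of _ P]) simp
qed

lemma inverse_F_blowup_nz: "a \<in> divisor D \<Longrightarrow> 1 / F_blowup D h B a \<noteq> 0"
  using F_blowup_nz[of a] divisor_subset by auto

text \<open>\<open>W\<close> is the preimage of a neighbourhood of 0 on which the normalizing change
  has a holomorphic inverse; it contains the whole divisor, since the blow-up sends the divisor to
  0. The component along z is constantly 1, which makes the extended field nonzero
  everywhere.\<close>

lemma blowup_field_extends:
  assumes G1: "\<And>v. v \<in> Uslots D \<Longrightarrow> G1 v = 0"
  obtains W K where "divisor D \<subseteq> W" "W \<subseteq> blowup_domain D h B" "\<And>v. holo_on (\<lambda>b. K b $ v) W"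
    "\<And>b. K b $ zc D = 1" "\<And>b. b \<in> W - divisor D \<Longrightarrow> K b = blowup_rhs D h G1 G2 B b"
proof -
  obtain S where S: "open S" "0 \<in> S" "S \<subseteq> H ` B" "\<And>y. y \<in> S \<Longrightarrow> cdiff (*s) (*s) (inv_into B H) y"
    using holomorphic_inverse_near_0 by blast
  define W where "W = {b. blowup D b \<in> S}"
  have W: "open W" "divisor D \<subseteq> W" "W \<subseteq> blowup_domain D h B"
    using open_blowup_preimage[OF S(1)] S(2,3) blowup_divisor unfolding W_def blowup_domain_def by auto
  define K where "K b = (\<chi> v. if v = zc D then 1 else if v = ec D then 1 / F_blowup D h B b
     else G2_ext v b / F_blowup D h B b)" for b
  have F_cd: "cdiff (*s) (*) (F_blowup D h B) b" if "b \<in> W" for b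
  proof -
    have bS: "blowup D b \<in> S" using that by (simp add: W_def)
    have "cdiff (*s) (*s) (\<lambda>b. inv_into B H (blowup D b)) b"
      by (rule cdiff_compose[OF cdiff_blowup S(4)[OF bS]])
    moreover
    have "inv_into B H (blowup D b) \<in> B0"
      using bS S(3) by (intro inv_H(1)) blast
    ultimately have "cdiff (*s) (*) (\<lambda>b. F_on D (inv_into B H (blowup D b))) b"
      using cdiff_F_on cdiff_compose[where f = "\<lambda>b. inv_into B H (blowup D b)" and g = "F_on D"] by blast
    then show ?thesis by (simp add: F_blowup_def[abs_def] F_normal_def)
  qed
  have Fnz: "F_blowup D h B b \<noteq> 0" if "b \<in> W" for b
    using F_blowup_nz W(3) that by blast
  have holo: "holo_on (\<lambda>b. K b $ v) W" for v
    unfolding holo_on_iff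
  proof (intro conjI ballI W(1))
    fix b assume b: "b \<in> W"
    show "cdiff (*s) (*) (\<lambda>b. K b $ v) b"
    proof (cases v rule: slot_cases)
      case 1 then show ?thesis by (simp add: K_def cdiff_const)
    next
      case 2
      then show ?thesis using slots_facts(1) cdiff_divide[OF cdiff_const F_cd[OF b] Fnz[OF b]] by (simp add: K_def)
    next
      case (3 l)
      have "b \<in> blowup_domain D h B" using b W(3) by blast
      from cdiff_divide[OF cdiff_G2_ext[OF 3(3) this] F_cd[OF b] Fnz[OF b]]
      show ?thesis using Uslots_neq[OF 3(3)] by (simp add: K_def)
    qed
  qed
  show ?thesis
  proof (rule that[OF W(2,3) holo])
    show "K b $ zc D = 1" for b by (simp add: K_def)
    fix b assume b: "b \<in> W - divisor D"
    show "K b = blowup_rhs D h G1 G2 B b"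
      unfolding vec_eq_iff
    proof
      fix v show "K b $ v = blowup_rhs D h G1 G2 B b $ v"
      proof (cases v rule: slot_cases)
        case (3 l)
        then show ?thesis
          using b Uslots_neq[OF 3(3)] by (simp add: K_def blowup_rhs_def G1 peval_zero G2_ext_def divisor_def)
      qed (use slots_facts(1) in \<open>simp_all add: K_def blowup_rhs_def\<close>)
    qed
  qed
qed

lemma conclusion_of_G1_zero:
  assumes G1: "\<And>v. v \<in> Uslots D \<Longrightarrow> G1 v = 0"
  shows "holo_near_divisor D (blowup_domain D h B) (\<lambda>a. blowup_rhs D h G1 G2 B a $ v)"
    and "a \<in> divisor D \<Longrightarrow> foliation_nonsingular_at D (blowup_domain D h B) (blowup_rhs D h G1 G2 B) a"
proof -
  obtain W K where K: "divisor D \<subseteq> W" "W \<subseteq> blowup_domain D h B" "\<And>v. holo_on (\<lambda>b. K b $ v) W"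
    "\<And>b. K b $ zc D = 1" "\<And>b. b \<in> W - divisor D \<Longrightarrow> K b = blowup_rhs D h G1 G2 B b"
    using blowup_field_extends[OF G1] by blast
  show "holo_near_divisor D (blowup_domain D h B) (\<lambda>a. blowup_rhs D h G1 G2 B a $ v)"
    unfolding holo_near_divisor_def using K(1,2,3,5)
    by (intro exI[of _ W] exI[of _ "\<lambda>b. K b $ v"]) simp
  assume "a \<in> divisor D"
  moreover have "K a \<noteq> 0" using K(4)[of a] by auto
  ultimately show "foliation_nonsingular_at D (blowup_domain D h B) (blowup_rhs D h G1 G2 B) a"
    unfolding foliation_nonsingular_at_def using K(1,2,3,5)
    by (intro exI[of _ W] exI[of _ K] conjI ballI exI[of _ 1]) auto
qed

end

section \<open>Linearizable systems\<close>

context normal_form_system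
begin

lemma G1_zero_if_vanishing_on_open:
  assumes S: "open S" "S \<noteq> {}" and v: "v \<in> Uslots D"
    and zero: "\<And>y. y \<in> S \<Longrightarrow> peval (G1 v) (\<lambda>a. y $ a) = 0"
  shows "G1 v = 0"
proof -
  obtain y r where y: "y \<in> S" "r > 0" "ball y r \<subseteq> S" using S by (meson all_not_in_conv open_contains_ball)
  \<comment> \<open>The scaling argument needs a base point off the hyperplane \<epsilon> = 0; a
    point on it is moved off by a shift of length at most r/2.\<close>
  obtain y0 where y0: "norm (y0 - y) < r" "y0 $ ec D \<noteq> 0"
  proof (cases "y $ ec D = 0")
    case True
    show ?thesis
    proof (rule that[of "y + of_real (r / 2) *s axis (ec D) 1"])
      have "norm (axis (ec D) (1::complex)) \<le> (\<Sum>i\<in>UNIV. norm (axis (ec D) (1::complex) $ i))"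
        by (rule norm_vec_le_sum)
      also have "\<dots> = 1" by (simp add: axis_def if_distrib[of norm] cong: if_cong)
      finally have "r / 2 * norm (axis (ec D) (1::complex)) < r"
        using y(2) mult_left_mono[of "norm (axis (ec D) (1::complex))" 1 "r / 2"] by simp
      then show "norm (y + of_real (r / 2) *s axis (ec D) 1 - y) < r"
        using y(2) by (simp add: norm_vector_smult)
      show "(y + of_real (r / 2) *s axis (ec D) 1) $ ec D \<noteq> 0" using True y(2) by simp
    qed
  qed (use y(2) that[of y] in simp)
  have pos: "r - norm (y0 - y) > 0" using y0(1) by simp
  show ?thesis
  proof (rule weighted_homogeneous_eq_0[of "G1 v" "wt D" "wt D v", OF G1_resonant[OF v] wt_pos y0(2) pos])
    fix z assume "norm (z - y0) < r - norm (y0 - y)"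
    then have "norm (z - y) < r" using norm_triangle_ineq[of "z - y0" "y0 - y"] by simp
    then have "z \<in> S" using y(3) by (auto simp: dist_norm norm_minus_commute)
    then show "peval (G1 v) (\<lambda>a. z $ a) = 0" by (rule zero)
  qed
qed

lemma matrix_complex_linear:
  fixes L :: "complex^'n::finite \<Rightarrow> complex^'k::finite"
  assumes "bounded_linear L" "\<And>k y. L (k *s y) = k *s L y"
  shows "matrix L *v x = L x"
proof -
  interpret bounded_linear L by fact
  have "L x = (\<Sum>a\<in>UNIV. x $ a *s L (axis a 1))"
    by (subst vec_axis_sum[of x]) (simp only: sum assms(2))
  then show ?thesis by (simp add: vec_eq_iff matrix_def matrix_vector_mult_def mult.commute)
qed

text \<open>If \<mu> is not a weight, every component of an eigenvector vanishes, in the order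
  \<epsilon>, Z, unstable slots: each row is diagonal once the earlier components are 0.\<close>

lemma red_deriv_eigenvalue:
  assumes "red_deriv x = \<mu> *s x" "x \<noteq> 0"
  shows "\<exists>v. \<mu> = of_nat (wt D v)"
proof (rule ccontr)
  assume n: "\<not> ?thesis"
  have ev: "red_deriv x $ v = \<mu> * x $ v" for v using assms(1) by simp
  have cancel: "x $ v = 0" if "of_nat (wt D v) * x $ v = \<mu> * x $ v" for v
    using that n by auto
  have e0: "x $ ec D = 0"
    by (rule cancel) (use ev[of "ec D"] red_deriv_nth(1)[of x] slots_facts(3) in simp)
  have z0: "x $ zc D = 0"
    by (rule cancel) (use e0 ev[of "zc D"] red_deriv_nth(2)[of x] slots_facts(2) in simp)
  have "x $ v = 0" if v: "v \<in> Uslots D" for v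
    by (rule cancel) (use ev[of v] red_deriv_nth(3)[OF v z0 e0] in simp)
  then have "x $ v = 0" for v
    using e0 z0 by (cases v rule: slot_cases) auto
  then show False using assms(2) by (simp add: vec_eq_iff)
qed

lemma bounded_linear_matrix: "bounded_linear ((*v) (A :: complex^'n::finite^'k::finite))"
  by simp

text \<open>The diagonal entries are eigenvalues, hence weights. So \<tau>^A consists, in a basis of
  eigenvectors, of monomials with positive integer exponents, which are single-valued and vanish at
  \<tau> = 0.\<close>

lemma semisimple_exponential_curves:
  assumes "semisimple (red_matrix D)"
  obtains P :: "complex^'b^'b" and e :: "'b \<Rightarrow> nat" where "invertible P" "\<And>a. e a \<ge> 1"
    "\<And>y. red_matrix D *v (P *v y) = P *v (\<chi> a. of_nat (e a) * y $ a)"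
proof -
  obtain P \<Delta> :: "complex^'b^'b" where P: "invertible P" "\<forall>a b. a \<noteq> b \<longrightarrow> \<Delta> $ a $ b = 0"
    "red_matrix D ** P = P ** \<Delta>"
    using assms unfolding semisimple_def by blast
  have D: "\<Delta> *v y = (\<chi> a. \<Delta> $ a $ a * y $ a)" for y
    unfolding vec_eq_iff
  proof
    fix a
    have "(\<Delta> *v y) $ a = (\<Sum>b\<in>UNIV. if b = a then \<Delta> $ a $ a * y $ a else 0)"
      unfolding matrix_vector_mult_def vec_lambda_beta by (intro sum.cong refl) (use P(2) in auto)
    then show "(\<Delta> *v y) $ a = (\<chi> a. \<Delta> $ a $ a * y $ a) $ a" by simp
  qed
  obtain Q where Q: "Q ** P = mat 1" using P(1) unfolding invertible_def by blast
  have A: "red_matrix D *v y = red_deriv y" for y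
    unfolding red_matrix_def red_deriv_def[symmetric]
    by (rule matrix_complex_linear[OF bounded_linear_red_deriv red_deriv(2)])
  have "\<exists>v. \<Delta> $ a $ a = of_nat (wt D v)" for a
  proof (rule red_deriv_eigenvalue)
    have ax: "\<Delta> *v axis a 1 = \<Delta> $ a $ a *s axis a 1"
      unfolding D by (simp add: vec_eq_iff axis_def)
    have "red_deriv (P *v axis a 1) = P *v (\<Delta> *v axis a 1)"
      unfolding A[symmetric] matrix_vector_mul_assoc P(3) ..
    also have "\<dots> = \<Delta> $ a $ a *s (P *v axis a 1)"
      unfolding ax by (simp add: vec_eq_iff matrix_vector_mult_def sum_distrib_left mult_ac)
    finally show "red_deriv (P *v axis a 1) = \<Delta> $ a $ a *s (P *v axis a 1)" .
    show "P *v axis a 1 \<noteq> 0"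
    proof
      assume "P *v axis a 1 = 0"
      then have "Q *v (P *v axis a 1) = 0" by simp
      then have "axis a (1::complex) = 0" by (simp add: matrix_vector_mul_assoc Q)
      then have "axis a (1::complex) $ a = 0 $ a" by (simp only:)
      then show False by simp
    qed
  qed
  then have "\<forall>a. \<exists>v. \<Delta> $ a $ a = of_nat (wt D v)" by blast
  from choice[OF this] obtain f where f: "\<And>a. \<Delta> $ a $ a = of_nat (wt D (f a))" by blast
  show ?thesis
  proof (rule that[of P "\<lambda>a. wt D (f a)"])
    show "wt D (f a) \<ge> 1" for a using wt_pos[of "f a"] by simp
    show "red_matrix D *v (P *v y) = P *v (\<chi> a. of_nat (wt D (f a)) * y $ a)" for y
      unfolding matrix_vector_mul_assoc P(3) unfolding matrix_vector_mul_assoc[symmetric] D f ..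
  qed (rule P(1))
qed

text \<open>The curves P (t^e x) of the linear system are pulled back by the inverse of the
  linearization. The disc of radius 2 contains the closed unit disc, on which Cauchy's inequality is
  applied afterwards. The last property recovers the parameter x from the germ of its curve.\<close>

lemma linearizable_solutions:
  assumes ss: "semisimple (red_matrix D)" and lin: "analytically_linearizable D"
  obtains r K :: real and q :: "complex^'b \<Rightarrow> complex \<Rightarrow> complex^'b" where "r > 0" "K > 0"
    "\<And>x. norm x < r \<Longrightarrow> solution (q x)"
    "\<And>x v. norm x < r \<Longrightarrow> (\<lambda>t. H (q x t) $ v) holomorphic_on ball 0 2"
    "\<And>x x' t. norm x < r \<Longrightarrow> norm x' < r \<Longrightarrow> norm t < 2 \<Longrightarrow> norm (H (q x t) - H (q x' t)) \<le> K * norm (x - x')"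
    "\<And>x x'. norm x < r \<Longrightarrow> norm x' < r \<Longrightarrow> \<forall>\<^sub>F t in nhds 0. q x t = q x' t \<Longrightarrow> x = x'"
proof -
  obtain P :: "complex^'b^'b" and e where P: "invertible P" "\<And>a. e a \<ge> 1"
    "\<And>y. red_matrix D *v (P *v y) = P *v (\<chi> a. of_nat (e a) * y $ a)"
    using semisimple_exponential_curves[OF ss] by blast
  obtain Q where Q: "Q ** P = mat 1" using P(1) unfolding invertible_def by blast
  obtain W \<Theta> where W: "open W" "0 \<in> W" and Th_holo: "\<forall>v. holo_on (\<lambda>q. \<Theta> q $ v) W" and Th0: "\<Theta> 0 = 0"
    and Th_inv: "invertible (matrix (frechet_derivative \<Theta> (at 0)))"
    and Th_ode: "\<forall>q\<in>W. frechet_derivative \<Theta> (at q) (red_field D q) = red_matrix D *v \<Theta> q"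
    using lin unfolding analytically_linearizable_def by (elim exE conjE)
  have Th_cd: "cdiff (*s) (*s) \<Theta> x" if "x \<in> W" for x
    using Th_holo that unfolding cdiff_vec_iff holo_on_iff by blast
  obtain d K0 where dK: "d > 0" "K0 > 0" "\<And>x y. x \<in> ball 0 d \<Longrightarrow> y \<in> ball 0 d \<Longrightarrow> norm (H x - H y) \<le> K0 * norm (x - y)"
    using strictly_differentiable_lipschitz[OF strict_H has_derivative_bounded_linear[OF H'(1)]] by blast
  define W1 where "W1 = W \<inter> ball 0 d"
  have W1: "open W1" "0 \<in> W1" "W1 \<subseteq> W" "W1 \<subseteq> ball 0 d" using W dK(1) by (auto simp: W1_def)
  have W1_cd: "cdiff (*s) (*s) \<Theta> x" if "x \<in> W1" for x using Th_cd that W1(3) by blast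
  have Th_inj: "y = 0" if "frechet_derivative \<Theta> (at 0) y = 0" for y
  proof -
    obtain M where M: "M ** matrix (frechet_derivative \<Theta> (at 0)) = mat 1"
      using Th_inv unfolding invertible_def by blast
    have "matrix (frechet_derivative \<Theta> (at 0)) *v y = frechet_derivative \<Theta> (at 0) y"
      by (rule matrix_complex_linear[OF has_derivative_bounded_linear[OF cdiff_frechet(1)[OF Th_cd[OF W(2)]]]
          cdiff_frechet(2)[OF Th_cd[OF W(2)]]])
    then have "M *v (matrix (frechet_derivative \<Theta> (at 0)) *v y) = 0" using that by simp
    then show ?thesis by (simp add: matrix_vector_mul_assoc M)
  qed
  obtain V c where V: "open V" "0 \<in> V" "V \<subseteq> W1" "inj_on \<Theta> V" "open (\<Theta> ` V)" "c > 0"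
    "\<And>x y. x \<in> V \<Longrightarrow> y \<in> V \<Longrightarrow> norm (x - y) \<le> c * norm (\<Theta> x - \<Theta> y)"
    "\<And>y. y \<in> \<Theta> ` V \<Longrightarrow> cdiff (*s) (*s) (inv_into V \<Theta>) y"
    using holomorphic_inverse_function[OF W1(1,2) W1_cd Th_inj] by blast
  define g where "g = inv_into V \<Theta>"
  have gV: "g y \<in> V" "\<Theta> (g y) = y" if "y \<in> \<Theta> ` V" for y
    using that unfolding g_def by (rule inv_into_into, rule f_inv_into_f)
  have g_cd: "cdiff (*s) (*s) g y" if "y \<in> \<Theta> ` V" for y unfolding g_def by (rule V(8)[OF that])
  have g\<Theta>: "g (\<Theta> x) = x" if "x \<in> V" for x unfolding g_def by (rule inv_into_f_f[OF V(4) that])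
  have zV: "0 \<in> \<Theta> ` V" using V(2) Th0 by (metis imageI)
  have g0: "g 0 = 0" using g\<Theta>[OF V(2)] Th0 by simp
  \<comment> \<open>Differentiating the identity g(\<Theta>(x)) = x turns the conjugation by
    \<Theta> into one by its inverse.\<close>
  have g_flow: "frechet_derivative g (at y) (red_matrix D *v y) = red_field D (g y)" if y: "y \<in> \<Theta> ` V" for y
  proof -
    have gW: "g y \<in> W" using gV(1)[OF y] V(3) W1(3) by blast
    have "((\<lambda>x. g (\<Theta> x)) has_derivative (\<lambda>z. frechet_derivative g (at (\<Theta> (g y))) (frechet_derivative \<Theta> (at (g y)) z))) (at (g y))"
      by (rule has_derivative_compose[OF cdiff_frechet(1)[OF Th_cd[OF gW]]])
         (rule cdiff_frechet(1)[OF g_cd], use gV[OF y] y in simp)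
    moreover have "((\<lambda>x. g (\<Theta> x)) has_derivative (\<lambda>z. z)) (at (g y))"
      by (rule has_derivative_transform_within_open[OF has_derivative_ident V(1) gV(1)[OF y]]) (simp add: g\<Theta>)
    ultimately have "(\<lambda>z. frechet_derivative g (at (\<Theta> (g y))) (frechet_derivative \<Theta> (at (g y)) z)) = (\<lambda>z. z)"
      by (rule has_derivative_unique)
    from fun_cong[OF this, of "red_field D (g y)"] show ?thesis
      using Th_ode[rule_format, OF gW] gV(2)[OF y] by simp
  qed
  obtain \<rho> where \<rho>: "\<rho> > 0" "ball 0 \<rho> \<subseteq> \<Theta> ` V" using V(5) zV open_contains_ball by blast
  define \<eta> where "\<eta> x t = P *v (\<chi> a. t ^ e a * x $ a)" for x t
  obtain K1 where K1: "K1 > 0" "\<And>y. norm (P *v y) \<le> norm y * K1"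
    using bounded_linear.pos_bounded[OF bounded_linear_matrix[of P]] by blast
  \<comment> \<open>For |t| < 2 the factor t^(e a) is bounded by 2^(e a); K1 accounts for P.\<close>
  define K2 where "K2 = (\<Sum>a\<in>UNIV. 2 ^ e a) * K1"
  have K2: "K2 > 0" unfolding K2_def using K1(1) by (intro mult_pos_pos sum_pos) auto
  have \<eta>_bound: "norm (\<eta> x t) \<le> K2 * norm x" if "norm t < 2" for x t
  proof -
    have "norm (\<chi> a. t ^ e a * x $ a) \<le> (\<Sum>a\<in>UNIV. norm ((\<chi> a. t ^ e a * x $ a) $ a))" by (rule norm_vec_le_sum)
    also have "\<dots> \<le> (\<Sum>a\<in>UNIV. 2 ^ e a * norm x)"
    proof (rule sum_mono)
      fix a
      show "norm ((\<chi> a. t ^ e a * x $ a) $ a) \<le> 2 ^ e a * norm x"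
        using that power_mono[of "norm t" 2 "e a"] Finite_Cartesian_Product.norm_nth_le[of x a]
        by (simp add: norm_mult norm_power mult_mono)
    qed
    finally have "norm (\<chi> a. t ^ e a * x $ a) * K1 \<le> (\<Sum>a\<in>UNIV. 2 ^ e a) * norm x * K1"
      using K1(1) by (intro mult_right_mono) (simp_all add: sum_distrib_right)
    then show ?thesis using K1(2)[of "\<chi> a. t ^ e a * x $ a"] by (simp add: \<eta>_def K2_def mult_ac)
  qed
  have \<eta>_diff: "\<eta> x t - \<eta> x' t = \<eta> (x - x') t" for x x' t
  proof -
    have "(\<chi> a. t ^ e a * (x - x') $ a) = (\<chi> a. t ^ e a * x $ a) - (\<chi> a. t ^ e a * x' $ a)"
      by (simp add: vec_eq_iff right_diff_distrib)
    then show ?thesis by (simp add: \<eta>_def matrix_vector_mult_diff_distrib)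
  qed
  define r where "r = \<rho> / K2"
  have r: "r > 0" using \<rho>(1) K2 by (simp add: r_def)
  have \<eta>V: "\<eta> x t \<in> \<Theta> ` V" if "norm x < r" "norm t < 2" for x t
  proof -
    have "K2 * norm x < \<rho>" using that(1) K2 by (simp add: r_def pos_less_divide_eq mult.commute)
    then have "norm (\<eta> x t) < \<rho>" using \<eta>_bound[OF that(2), of x] by linarith
    then show ?thesis using \<rho>(2) by (auto simp: dist_norm)
  qed
  have \<eta>_cd: "cdiff (*) (*s) (\<eta> x) t" for x t
    unfolding \<eta>_def
    by (rule cdiff_matrix_mult) (auto simp: cdiff_vec_iff intro!: cdiff_mult cdiff_power cdiff_id cdiff_const)
  have \<eta>_an: "(\<lambda>t. \<eta> x t $ v) analytic_on {0}" for x v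
  proof -
    have "cdiff (*) (*) (\<lambda>t. \<eta> x t $ v) t" for t
      using \<eta>_cd[of x t] unfolding cdiff_vec_iff by blast
    then have "(\<lambda>t. \<eta> x t $ v) holomorphic_on UNIV"
      by (simp add: holomorphic_on_def cdiff_field)
    then show ?thesis unfolding analytic_at by blast
  qed
  have \<eta>0: "\<eta> x 0 = 0" for x
  proof -
    have "0 < e a" for a using P(2)[of a] by simp
    then have "(\<chi> a. 0 ^ e a * x $ a) = 0" by (simp add: vec_eq_iff zero_power)
    then show ?thesis by (simp add: \<eta>_def)
  qed
  have \<eta>_deriv: "(\<chi> v. t * deriv (\<lambda>t. \<eta> x t $ v) t) = red_matrix D *v \<eta> x t" for x t
    unfolding vec_eq_iff
  proof
    fix v
    have pw: "((\<lambda>t. t ^ n) has_field_derivative of_nat n * t ^ (n - 1)) (at t)" for n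
      using DERIV_power[OF DERIV_ident, of n t UNIV] by simp
    have "((\<lambda>t. \<Sum>b\<in>UNIV. P $ v $ b * (t ^ e b * x $ b)) has_field_derivative
        (\<Sum>b\<in>UNIV. P $ v $ b * (of_nat (e b) * t ^ (e b - 1) * x $ b))) (at t)"
      by (intro DERIV_sum DERIV_cmult DERIV_cmult_right pw)
    then have "((\<lambda>t. \<eta> x t $ v) has_field_derivative
        (\<Sum>b\<in>UNIV. P $ v $ b * (of_nat (e b) * t ^ (e b - 1) * x $ b))) (at t)"
      by (simp add: \<eta>_def matrix_vector_mult_def)
    then have "t * deriv (\<lambda>t. \<eta> x t $ v) t = t * (\<Sum>b\<in>UNIV. P $ v $ b * (of_nat (e b) * t ^ (e b - 1) * x $ b))"
      by (simp only: DERIV_imp_deriv)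
    also have "\<dots> = (\<Sum>b\<in>UNIV. P $ v $ b * (of_nat (e b) * (t ^ e b * x $ b)))"
      unfolding sum_distrib_left
    proof (rule sum.cong[OF refl])
      fix b
      have "t ^ e b = t * t ^ (e b - 1)" using P(2)[of b] by (cases "e b") auto
      then show "t * (P $ v $ b * (of_nat (e b) * t ^ (e b - 1) * x $ b)) = P $ v $ b * (of_nat (e b) * (t ^ e b * x $ b))"
        by (simp add: mult_ac)
    qed
    also have "\<dots> = (red_matrix D *v \<eta> x t) $ v"
      unfolding \<eta>_def P(3) by (simp add: matrix_vector_mult_def)
    finally show "(\<chi> v. t * deriv (\<lambda>t. \<eta> x t $ v) t) $ v = (red_matrix D *v \<eta> x t) $ v" by simp
  qed
  define q where "q x t = g (\<eta> x t)" for x t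
  have gc: "cdiff (*s) (*) (\<lambda>y. g y $ v) y" if "y \<in> \<Theta> ` V" for y v
    using g_cd[OF that] unfolding cdiff_vec_iff by blast
  have sol: "solution (q x)" if x: "norm x < r" for x
    unfolding solution_def
  proof (intro conjI allI)
    have z: "\<eta> x 0 \<in> \<Theta> ` V" using zV by (simp add: \<eta>0)
    note chain = analytic_chain[OF \<eta>_an V(5) z gc]
    show "(\<lambda>t. q x t $ v) analytic_on {0}" for v unfolding q_def by (rule chain(1))
    show "q x 0 = 0" by (simp add: q_def \<eta>0 g0)
    have "\<forall>\<^sub>F t in nhds 0. \<forall>v. deriv (\<lambda>t. g (\<eta> x t) $ v) t = frechet_derivative (\<lambda>y. g y $ v) (at (\<eta> x t)) (\<chi> a. deriv (\<lambda>t. \<eta> x t $ a) t)"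
      by (intro eventually_all_finite chain(2))
    moreover have "\<forall>\<^sub>F t in nhds (0::complex). t \<in> ball 0 2" by (intro eventually_nhds_in_open) auto
    ultimately show "\<forall>\<^sub>F t in nhds 0. \<forall>v. t * deriv (\<lambda>t. q x t $ v) t = red_field D (q x t) $ v"
    proof eventually_elim
      case (elim t)
      have yV: "\<eta> x t \<in> \<Theta> ` V" using elim(2) by (intro \<eta>V[OF x]) simp
      show ?case
      proof
        fix v
        have "t * deriv (\<lambda>t. q x t $ v) t = t * frechet_derivative (\<lambda>y. g y $ v) (at (\<eta> x t)) (\<chi> a. deriv (\<lambda>t. \<eta> x t $ a) t)"
          unfolding q_def using elim(1) by simp
        also have "\<dots> = frechet_derivative (\<lambda>y. g y $ v) (at (\<eta> x t)) (t *s (\<chi> a. deriv (\<lambda>t. \<eta> x t $ a) t))"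
          by (rule cdiff_frechet(2)[OF gc[OF yV], symmetric])
        also have "t *s (\<chi> a. deriv (\<lambda>t. \<eta> x t $ a) t) = red_matrix D *v \<eta> x t"
          unfolding \<eta>_deriv[symmetric] by (simp add: vec_eq_iff)
        also have "frechet_derivative (\<lambda>y. g y $ v) (at (\<eta> x t)) (red_matrix D *v \<eta> x t) = red_field D (q x t) $ v"
          using frechet_derivative_nth[OF cdiff_differentiable[OF g_cd[OF yV]]] g_flow[OF yV] by (simp add: q_def)
        finally show "t * deriv (\<lambda>t. q x t $ v) t = red_field D (q x t) $ v" .
      qed
    qed
  qed
  have holo: "(\<lambda>t. H (q x t) $ v) holomorphic_on ball 0 2" if x: "norm x < r" for x v
    unfolding holomorphic_on_def
  proof
    fix t :: complex assume "t \<in> ball 0 2"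
    then have yV: "\<eta> x t \<in> \<Theta> ` V" by (intro \<eta>V[OF x]) simp
    have "cdiff (*) (*s) (\<lambda>t. H (q x t)) t"
      unfolding q_def by (rule cdiff_compose[OF cdiff_compose[OF \<eta>_cd g_cd[OF yV]] cdiff_H])
    then have "(\<lambda>t. H (q x t) $ v) field_differentiable (at t)"
      unfolding cdiff_vec_iff cdiff_field by blast
    then show "(\<lambda>t. H (q x t) $ v) field_differentiable (at t within ball 0 2)"
      by (rule field_differentiable_at_within)
  qed
  have lip: "norm (H (q x t) - H (q x' t)) \<le> K0 * c * K2 * norm (x - x')"
    if x: "norm x < r" "norm x' < r" and t: "norm t < 2" for x x' t
  proof -
    have V1: "q x t \<in> V" "q x' t \<in> V" "\<Theta> (q x t) = \<eta> x t" "\<Theta> (q x' t) = \<eta> x' t"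
      unfolding q_def by (rule gV[OF \<eta>V[OF x(1) t]] gV[OF \<eta>V[OF x(2) t]])+
    then have "norm (H (q x t) - H (q x' t)) \<le> K0 * norm (q x t - q x' t)"
      using V(3) W1(4) by (intro dK(3)) blast+
    also have "\<dots> \<le> K0 * (c * norm (\<eta> x t - \<eta> x' t))"
      using V(7)[OF V1(1,2)] dK(2) unfolding V1(3,4) by (intro mult_left_mono) auto
    also have "\<dots> \<le> K0 * (c * (K2 * norm (x - x')))"
      using \<eta>_bound[OF t, of "x - x'"] dK(2) V(6) unfolding \<eta>_diff by (intro mult_left_mono) auto
    finally show ?thesis by (simp add: mult.assoc)
  qed
  have inj: "x = x'" if x: "norm x < r" "norm x' < r" and ev: "\<forall>\<^sub>F t in nhds 0. q x t = q x' t" for x x'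
  proof -
    have "\<forall>\<^sub>F t in nhds (0::complex). t \<in> ball 0 2" by (intro eventually_nhds_in_open) auto
    with ev have "\<forall>\<^sub>F t in nhds 0. t \<in> ball 0 2 \<and> q x t = q x' t" by eventually_elim simp
    \<comment> \<open>One common value at some t \<noteq> 0 is enough; at t = 0 all curves meet in
      the origin.\<close>
    then have "\<forall>\<^sub>F t in at 0. (t \<in> ball 0 2 \<and> q x t = q x' t) \<and> t \<noteq> 0"
      by (auto simp: eventually_at_filter elim: eventually_mono)
    then obtain t where t: "norm t < 2" "q x t = q x' t" "t \<noteq> 0"
      using eventually_happens[of _ "at (0::complex)"] by (auto simp: trivial_limit_at)
    have "\<eta> x t = \<eta> x' t"
      using t(2) gV(2)[OF \<eta>V[OF x(1) t(1)]] gV(2)[OF \<eta>V[OF x(2) t(1)]] unfolding q_def by metis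
    then have "Q *v \<eta> x t = Q *v \<eta> x' t" by simp
    then have "(\<chi> a. t ^ e a * x $ a) = (\<chi> a. t ^ e a * x' $ a)"
      by (simp add: \<eta>_def matrix_vector_mul_assoc Q)
    then have "t ^ e a * x $ a = t ^ e a * x' $ a" for a
      unfolding vec_eq_iff by simp
    then show ?thesis using t(3) by (simp add: vec_eq_iff)
  qed
  show ?thesis
    by (rule that[of r "K0 * c * K2" q]) (use r dK(2) V(6) K2 sol holo lip inj in simp_all)
qed

text \<open>The components of u(x) are Taylor coefficients, so Cauchy's inequality on the unit
  circle bounds their variation by that of the curves; hence u is Lipschitz. It is injective by
  uniqueness of curves. Parameters and coefficients range over the same space, as invariance of
  domain requires.\<close>

lemma linearizable_imp_G1_zero:
  assumes ss: "semisimple (red_matrix D)" and lin: "analytically_linearizable D" and v: "v \<in> Uslots D"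
  shows "G1 v = 0"
proof (rule linearizable_solutions[OF ss lin])
  fix r K :: real and q :: "complex^'b \<Rightarrow> complex \<Rightarrow> complex^'b"
  assume r: "r > 0" and K: "K > 0"
    and sol: "\<And>x. norm x < r \<Longrightarrow> solution (q x)"
    and holo: "\<And>x v. norm x < r \<Longrightarrow> (\<lambda>t. H (q x t) $ v) holomorphic_on ball 0 2"
    and lip: "\<And>x x' t. norm x < r \<Longrightarrow> norm x' < r \<Longrightarrow> norm t < 2 \<Longrightarrow> norm (H (q x t) - H (q x' t)) \<le> K * norm (x - x')"
    and inj: "\<And>x x'. norm x < r \<Longrightarrow> norm x' < r \<Longrightarrow> \<forall>\<^sub>F t in nhds 0. q x t = q x' t \<Longrightarrow> x = x'"
  have "\<forall>x\<in>ball 0 r. \<exists>u::complex^'b. (\<forall>v. ((\<lambda>t. H (q x t) $ v / t ^ wt D v) \<longlongrightarrow> u $ v) (at 0)) \<and>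
      (\<forall>v\<in>Uslots D. peval (G1 v) (\<lambda>a. u $ a) = 0)"
  proof
    fix x :: "complex^'b" assume "x \<in> ball 0 r"
    then have "solution (q x)" by (intro sol) simp
    then show "\<exists>u::complex^'b. (\<forall>v. ((\<lambda>t. H (q x t) $ v / t ^ wt D v) \<longlongrightarrow> u $ v) (at 0)) \<and>
      (\<forall>v\<in>Uslots D. peval (G1 v) (\<lambda>a. u $ a) = 0)"
    proof (rule solution_leading_coefficients)
      fix w :: "complex^'b"
      assume a: "\<And>v. ((\<lambda>t. H (q x t) $ v / t ^ wt D v) \<longlongrightarrow> w $ v) (at 0)"
        and b: "\<And>v. v \<in> Uslots D \<Longrightarrow> peval (G1 v) (\<lambda>a. w $ a) = 0"
      show ?thesis by (intro exI[of _ w] conjI allI ballI a b)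
    qed
  qed
  from bchoice[OF this] obtain u :: "complex^'b \<Rightarrow> complex^'b" where
    U: "\<forall>x\<in>ball 0 r. (\<forall>v. ((\<lambda>t. H (q x t) $ v / t ^ wt D v) \<longlongrightarrow> u x $ v) (at 0)) \<and>
      (\<forall>v\<in>Uslots D. peval (G1 v) (\<lambda>a. u x $ a) = 0)" ..
  have u: "((\<lambda>t. H (q x t) $ v / t ^ wt D v) \<longlongrightarrow> u x $ v) (at 0)" if "x \<in> ball 0 r" for x v
    by (rule spec[OF bspec[OF U that, THEN conjunct1]])
  have u0: "peval (G1 v) (\<lambda>a. u x $ a) = 0" if "x \<in> ball 0 r" for x
    by (rule bspec[OF bspec[OF U that, THEN conjunct2] v])
  have ulip: "norm (u x $ v - u x' $ v) \<le> K * norm (x - x')" if x: "x \<in> ball 0 r" "x' \<in> ball 0 r" for x x' v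
  proof -
    define f where "f t = H (q x t) $ v - H (q x' t) $ v" for t
    have f_holo: "f holomorphic_on ball 0 2"
      unfolding f_def using x by (intro holomorphic_on_diff holo) auto
    have an: "f analytic_on {0}"
      unfolding analytic_at using f_holo by (intro exI[of _ "ball 0 2"]) auto
    have "((\<lambda>t. f t / t ^ wt D v) \<longlongrightarrow> u x $ v - u x' $ v) (at 0)"
      using tendsto_diff[OF u[OF x(1), of v] u[OF x(2), of v]] unfolding f_def diff_divide_distrib .
    from has_fps_expansion_leading_unique(2)[OF analytic_at_imp_has_fps_expansion_0[OF an] this]
    have eq: "(deriv ^^ wt D v) f 0 / fact (wt D v) = u x $ v - u x' $ v"
      by (simp only: fps_expansion_def fps_nth_Abs_fps)
    have bd: "norm (f t) \<le> K * norm (x - x')" if "norm t < 2" for t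
    proof -
      have "norm ((H (q x t) - H (q x' t)) $ v) \<le> norm (H (q x t) - H (q x' t))"
        by (rule Finite_Cartesian_Product.norm_nth_le)
      also have "\<dots> \<le> K * norm (x - x')" by (rule lip) (use x that in simp_all)
      finally show ?thesis by (simp only: f_def vector_minus_component)
    qed
    have "norm ((deriv ^^ wt D v) f 0) \<le> fact (wt D v) * (K * norm (x - x')) / 1 ^ wt D v"
    proof (rule Cauchy_inequality)
      show "f holomorphic_on ball 0 1" by (rule holomorphic_on_subset[OF f_holo]) auto
      show "continuous_on (cball 0 1) f"
        by (rule holomorphic_on_imp_continuous_on[OF holomorphic_on_subset[OF f_holo]]) auto
      show "norm (f t) \<le> K * norm (x - x')" if "norm (0 - t) = 1" for t using that by (intro bd) simp
    qed simp
    then show ?thesis unfolding eq[symmetric] by (simp add: norm_divide divide_le_eq mult.commute)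
  qed
  have cont: "continuous_on (ball 0 r) u"
  proof -
    have "continuous_on (ball 0 r) (\<lambda>x. u x $ v)" for v
    proof -
      have "K-lipschitz_on (ball 0 r) (\<lambda>x. u x $ v)"
        by (rule lipschitz_onI) (unfold dist_norm, rule ulip, assumption+, use K in simp)
      then show ?thesis by (rule lipschitz_on_continuous_on)
    qed
    then have "continuous_on (ball 0 r) (\<lambda>x. \<chi> v. u x $ v)" by (rule continuous_on_vec_lambda)
    then show ?thesis by simp
  qed
  have "inj_on u (ball 0 r)"
  proof (rule inj_onI)
    fix x x' assume x: "x \<in> ball 0 r" "x' \<in> ball 0 r" "u x = u x'"
    have n: "norm x < r" "norm x' < r" using x by simp_all
    have l2: "((\<lambda>t. H (q x' t) $ v / t ^ wt D v) \<longlongrightarrow> u x $ v) (at 0)" for v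
      unfolding x(3) by (rule u[OF x(2)])
    have "\<forall>\<^sub>F t in nhds 0. q x t = q x' t"
      by (rule solution_unique[OF sol[OF n(1)] sol[OF n(2)] u[OF x(1)] l2])
    then show "x = x'" by (rule inj[OF n])
  qed
  then have "open (u ` ball 0 r)"
    using cont by (intro invariance_of_domain) auto
  then show ?thesis
    by (rule G1_zero_if_vanishing_on_open[OF _ _ v]) (use r u0 in auto)
qed

end

section \<open>Laurent series solutions\<close>

text \<open>No common radius of convergence is required. Continuity of each single coefficient
  suffices, since u consists of Taylor coefficients.\<close>

definition fps_family :: "'t::topological_space set \<Rightarrow> ('t \<Rightarrow> complex \<Rightarrow> complex) \<Rightarrow> bool" where
  "fps_family \<Omega> f \<longleftrightarrow> (\<exists>F. (\<forall>\<theta>\<in>\<Omega>. f \<theta> has_fps_expansion F \<theta>) \<and>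
     (\<forall>n. continuous_on \<Omega> (\<lambda>\<theta>. fps_nth (F \<theta>) n)))"

lemma fps_familyI:
  assumes "\<And>\<theta>. \<theta> \<in> \<Omega> \<Longrightarrow> f \<theta> has_fps_expansion F \<theta>" "\<And>n. continuous_on \<Omega> (\<lambda>\<theta>. fps_nth (F \<theta>) n)"
  shows "fps_family \<Omega> f"
  unfolding fps_family_def using assms by blast

lemma fps_family_const: "continuous_on \<Omega> k \<Longrightarrow> fps_family \<Omega> (\<lambda>\<theta> _. k \<theta>)"
proof (rule fps_familyI[where F = "\<lambda>\<theta>. fps_const (k \<theta>)"])
  fix n assume "continuous_on \<Omega> k"
  then show "continuous_on \<Omega> (\<lambda>\<theta>. fps_nth (fps_const (k \<theta>)) n)" by (cases "n = 0") simp_all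
qed simp

lemma fps_family_ident: "fps_family \<Omega> (\<lambda>_ \<zeta>. \<zeta>)"
  by (rule fps_familyI[where F = "\<lambda>_. fps_X"]) (simp_all add: has_fps_expansion_fps_X)

lemma fps_family_add:
  assumes "fps_family \<Omega> f" "fps_family \<Omega> g"
  shows "fps_family \<Omega> (\<lambda>\<theta> \<zeta>. f \<theta> \<zeta> + g \<theta> \<zeta>)"
proof -
  obtain F G where F: "\<forall>\<theta>\<in>\<Omega>. f \<theta> has_fps_expansion F \<theta>" "\<forall>n. continuous_on \<Omega> (\<lambda>\<theta>. fps_nth (F \<theta>) n)"
    and G: "\<forall>\<theta>\<in>\<Omega>. g \<theta> has_fps_expansion G \<theta>" "\<forall>n. continuous_on \<Omega> (\<lambda>\<theta>. fps_nth (G \<theta>) n)"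
    using assms unfolding fps_family_def by blast
  show ?thesis
    by (rule fps_familyI[where F = "\<lambda>\<theta>. F \<theta> + G \<theta>"])
       (use F G in \<open>auto intro!: has_fps_expansion_add continuous_on_add\<close>)
qed

lemma fps_family_mult:
  assumes "fps_family \<Omega> f" "fps_family \<Omega> g"
  shows "fps_family \<Omega> (\<lambda>\<theta> \<zeta>. f \<theta> \<zeta> * g \<theta> \<zeta>)"
proof -
  obtain F G where F: "\<forall>\<theta>\<in>\<Omega>. f \<theta> has_fps_expansion F \<theta>" "\<forall>n. continuous_on \<Omega> (\<lambda>\<theta>. fps_nth (F \<theta>) n)"
    and G: "\<forall>\<theta>\<in>\<Omega>. g \<theta> has_fps_expansion G \<theta>" "\<forall>n. continuous_on \<Omega> (\<lambda>\<theta>. fps_nth (G \<theta>) n)"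
    using assms unfolding fps_family_def by blast
  show ?thesis
    by (rule fps_familyI[where F = "\<lambda>\<theta>. F \<theta> * G \<theta>"])
       (use F G in \<open>auto simp: fps_mult_nth intro!: has_fps_expansion_mult continuous_on_sum continuous_on_mult\<close>)
qed

lemma fps_family_power: "fps_family \<Omega> f \<Longrightarrow> fps_family \<Omega> (\<lambda>\<theta> \<zeta>. f \<theta> \<zeta> ^ n)"
  by (induction n) (simp_all add: fps_family_mult fps_family_const)

lemma fps_family_sum:
  "(\<And>i. i \<in> I \<Longrightarrow> fps_family \<Omega> (f i)) \<Longrightarrow> fps_family \<Omega> (\<lambda>\<theta> \<zeta>. \<Sum>i\<in>I. f i \<theta> \<zeta>)"
  by (induction I rule: infinite_finite_induct) (simp_all add: fps_family_add fps_family_const)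

lemma fps_family_prod:
  "(\<And>i. i \<in> I \<Longrightarrow> fps_family \<Omega> (f i)) \<Longrightarrow> fps_family \<Omega> (\<lambda>\<theta> \<zeta>. \<Prod>i\<in>I. f i \<theta> \<zeta>)"
  by (induction I rule: infinite_finite_induct) (simp_all add: fps_family_mult fps_family_const)

lemma fps_family_peval:
  assumes "\<And>v. fps_family \<Omega> (\<lambda>\<theta> \<zeta>. f \<theta> \<zeta> v)"
  shows "fps_family \<Omega> (\<lambda>\<theta> \<zeta>. peval P (f \<theta> \<zeta>))"
  unfolding peval_def
  by (intro fps_family_sum fps_family_mult fps_family_prod fps_family_power fps_family_const continuous_on_const assms)

text \<open>The inner series has no constant term, so each coefficient of the composition is a
  finite sum of products of coefficients.\<close>

lemma fps_family_compose:
  assumes f: "fps_family \<Omega> f" "\<And>\<theta>. \<theta> \<in> \<Omega> \<Longrightarrow> f \<theta> 0 = 0" and \<Phi>: "\<Phi> has_fps_expansion C"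
  shows "fps_family \<Omega> (\<lambda>\<theta> \<zeta>. \<Phi> (f \<theta> \<zeta>))"
proof -
  obtain F where F: "\<And>\<theta>. \<theta> \<in> \<Omega> \<Longrightarrow> f \<theta> has_fps_expansion F \<theta>" "\<And>n. continuous_on \<Omega> (\<lambda>\<theta>. fps_nth (F \<theta>) n)"
    using f(1) unfolding fps_family_def by blast
  have pw: "continuous_on \<Omega> (\<lambda>\<theta>. fps_nth (F \<theta> ^ k) n)" for k n
  proof (induction k arbitrary: n)
    case 0
    have "(\<lambda>\<theta>. fps_nth (F \<theta> ^ 0) n) = (\<lambda>\<theta>. if n = 0 then 1 else 0)" by auto
    then show ?case by simp
  next
    case (Suc k)
    then show ?case
      by (simp add: fps_mult_nth) (intro continuous_on_sum continuous_on_mult F(2))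
  qed
  show ?thesis
  proof (rule fps_familyI[where F = "\<lambda>\<theta>. fps_compose C (F \<theta>)"])
    fix \<theta> assume \<theta>: "\<theta> \<in> \<Omega>"
    have "fps_nth (F \<theta>) 0 = 0"
      using has_fps_expansion_imp_0_eq_fps_nth_0[OF F(1)[OF \<theta>]] f(2)[OF \<theta>] by simp
    from has_fps_expansion_compose[OF \<Phi> F(1)[OF \<theta>] this]
    show "(\<lambda>\<zeta>. \<Phi> (f \<theta> \<zeta>)) has_fps_expansion fps_compose C (F \<theta>)" by (simp only: comp_def)
  next
    fix n
    show "continuous_on \<Omega> (\<lambda>\<theta>. fps_nth (fps_compose C (F \<theta>)) n)"
      unfolding fps_compose_nth by (intro continuous_on_sum continuous_on_mult continuous_on_const pw)
  qed
qed

lemma fps_family_analytic: "fps_family \<Omega> f \<Longrightarrow> \<theta> \<in> \<Omega> \<Longrightarrow> f \<theta> analytic_on {0}"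
  unfolding fps_family_def using has_fps_expansion_imp_analytic_0 by blast

text \<open>The limit is the n-th Taylor coefficient, and that is continuous in the
  parameter.\<close>

lemma fps_family_leading_continuous:
  assumes f: "fps_family \<Omega> f" and lim: "\<And>\<theta>. \<theta> \<in> \<Omega> \<Longrightarrow> ((\<lambda>\<zeta>. f \<theta> \<zeta> / \<zeta> ^ n) \<longlongrightarrow> l \<theta>) (at 0)"
  shows "continuous_on \<Omega> l"
proof -
  obtain F where F: "\<And>\<theta>. \<theta> \<in> \<Omega> \<Longrightarrow> f \<theta> has_fps_expansion F \<theta>" "\<And>n. continuous_on \<Omega> (\<lambda>\<theta>. fps_nth (F \<theta>) n)"
    using f unfolding fps_family_def by blast
  have "fps_nth (F \<theta>) n = l \<theta>" if "\<theta> \<in> \<Omega>" for \<theta>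
    by (rule has_fps_expansion_leading_unique(2)[OF F(1)[OF that] lim[OF that]])
  then show ?thesis using F(2)[of n] by (simp cong: continuous_on_cong)
qed

section \<open>The chart coordinates along a Laurent solution\<close>

context kov_system
begin

text \<open>
  With \<open>\<zeta> = z - z\<^sub>0\<close>: \<open>lx A i\<close> is the solution \<open>x\<^sub>i\<close> and \<open>lpsi A i\<close> is \<open>\<zeta>\<^bsup>p\<^sub>i\<^esup> x\<^sub>i\<close>; \<open>lw A\<close> is \<open>w = x\<^sub>j\<^bsup>-1/p\<^sub>j\<^esup>\<close>, on
  the branch where \<open>lroot A = w / \<zeta>\<close> takes the value \<open>1 / beta D\<close> at \<open>\<zeta> = 0\<close>; \<open>lX\<close>, \<open>lxi\<close>, \<open>lZ\<close>, \<open>lE\<close>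
  are the coordinates \<open>X\<close>, \<open>\<xi>\<close>, \<open>Z\<close>, \<open>\<epsilon>\<close> along the solution.
\<close>

definition lfps :: "('m \<Rightarrow> nat \<Rightarrow> complex) \<Rightarrow> 'm \<Rightarrow> complex fps" where
  "lfps A i = Abs_fps (\<lambda>n. if n = 0 then cc D $ i else A i n)"

definition lpsi :: "('m \<Rightarrow> nat \<Rightarrow> complex) \<Rightarrow> 'm \<Rightarrow> complex \<Rightarrow> complex" where
  "lpsi A i = eval_fps (lfps A i)"

definition lx :: "('m \<Rightarrow> nat \<Rightarrow> complex) \<Rightarrow> 'm \<Rightarrow> complex \<Rightarrow> complex" where
  "lx A i \<zeta> = lpsi A i \<zeta> * \<zeta> powi (- int (pw D i))"

definition lroot :: "('m \<Rightarrow> nat \<Rightarrow> complex) \<Rightarrow> complex \<Rightarrow> complex" where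
  "lroot A \<zeta> = inverse (beta D) * (1 + (lpsi A (jj D) \<zeta> * inverse (cc D $ jj D) + (- 1))) powr (- 1 / of_nat (pw D (jj D)))"

definition lw :: "('m \<Rightarrow> nat \<Rightarrow> complex) \<Rightarrow> complex \<Rightarrow> complex" where
  "lw A \<zeta> = \<zeta> * lroot A \<zeta>"

definition lX :: "('m \<Rightarrow> nat \<Rightarrow> complex) \<Rightarrow> complex \<Rightarrow> complex^'m" where
  "lX A \<zeta> = (\<chi> i. if i = jj D then 1 else lpsi A i \<zeta> * lroot A \<zeta> ^ pw D i)"

definition lxi :: "('m \<Rightarrow> nat \<Rightarrow> complex) \<Rightarrow> complex \<Rightarrow> complex^'m" where
  "lxi A \<zeta> = matrix_inv (TT D) *v (lX A \<zeta> - fixed_point D)"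

definition lZ :: "complex \<Rightarrow> ('m \<Rightarrow> nat \<Rightarrow> complex) \<Rightarrow> complex \<Rightarrow> complex" where
  "lZ z0 A \<zeta> = (z0 + \<zeta>) * lw A \<zeta> ^ rw D"

definition lE :: "('m \<Rightarrow> nat \<Rightarrow> complex) \<Rightarrow> complex \<Rightarrow> complex" where
  "lE A \<zeta> = lw A \<zeta> ^ sw D"

lemma cc_jj: "cc D $ jj D \<noteq> 0" "beta D ^ pw D (jj D) = cc D $ jj D"
  using root unfolding indicial_root_def by auto

lemma laurent_solution_expansion:
  assumes ls: "laurent_solution D z0 A"
  shows "lpsi A i has_fps_expansion lfps A i"
    and "\<forall>\<^sub>F \<zeta> in at 0. \<forall>i. (lx A i has_field_derivative
      fval D i (\<chi> l. lx A l \<zeta>) (z0 + \<zeta>) + gval D i (\<chi> l. lx A l \<zeta>) (z0 + \<zeta>)) (at \<zeta>)"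
proof -
  define x where "x = (\<lambda>i z. cc D $ i * (z - z0) powi (- int (pw D i)) +
                     suminf (\<lambda>n. A i (Suc n) * (z - z0) powi (- int (pw D i) + int (Suc n))))"
  have "laurent_solution D z0 A \<longleftrightarrow> (\<exists>\<rho>>0. \<forall>z i. 0 < norm (z - z0) \<and> norm (z - z0) < \<rho> \<longrightarrow>
           summable (\<lambda>n. A i (Suc n) * (z - z0) powi (- int (pw D i) + int (Suc n))) \<and>
           (x i has_field_derivative
              (fval D i (\<chi> l. x l z) z + gval D i (\<chi> l. x l z) z)) (at z))"
    unfolding laurent_solution_def Let_def x_def ..
  from iffD1[OF this ls] obtain \<rho> where \<rho>: "\<rho> > 0" and all0: "\<forall>z i. 0 < norm (z - z0) \<and> norm (z - z0) < \<rho> \<longrightarrow>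
           summable (\<lambda>n. A i (Suc n) * (z - z0) powi (- int (pw D i) + int (Suc n))) \<and>
           (x i has_field_derivative
              (fval D i (\<chi> l. x l z) z + gval D i (\<chi> l. x l z) z)) (at z)"
    by (elim exE conjE) (rule that)
  have all_s: "summable (\<lambda>n. A i (Suc n) * \<zeta> powi (- int (pw D i) + int (Suc n)))" if "0 < norm \<zeta>" "norm \<zeta> < \<rho>" for \<zeta> i
    using all0[rule_format, of "\<zeta> + z0" i] that by simp
  have all_d: "(x i has_field_derivative fval D i (\<chi> l. x l (\<zeta> + z0)) (\<zeta> + z0) + gval D i (\<chi> l. x l (\<zeta> + z0)) (\<zeta> + z0)) (at (\<zeta> + z0))"
    if "0 < norm \<zeta>" "norm \<zeta> < \<rho>" for \<zeta> i
    using all0[rule_format, of "\<zeta> + z0" i] that by simp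
  have pint: "\<zeta> powi (- int p + int (Suc n)) = \<zeta> powi (- int p) * \<zeta> ^ Suc n" if "\<zeta> \<noteq> 0" for \<zeta> :: complex and p n
    using that by (simp only: power_int_add simp_thms power_int_of_nat)
  have sm: "summable (\<lambda>n. fps_nth (lfps A i) n * \<zeta> ^ n)" if \<zeta>: "0 < norm \<zeta>" "norm \<zeta> < \<rho>" for \<zeta> i
  proof -
    have "\<zeta> \<noteq> 0" using \<zeta>(1) by auto
    have "summable (\<lambda>n. A i (Suc n) * \<zeta> powi (- int (pw D i) + int (Suc n)))"
      by (rule all_s[OF \<zeta>])
    then have "summable (\<lambda>n. \<zeta> ^ pw D i * (A i (Suc n) * \<zeta> powi (- int (pw D i) + int (Suc n))))"
      by (rule summable_mult)
    moreover have "\<zeta> ^ pw D i * (A i (Suc n) * \<zeta> powi (- int (pw D i) + int (Suc n))) = fps_nth (lfps A i) (Suc n) * \<zeta> ^ Suc n" for n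
    proof -
      have "\<zeta> ^ pw D i * \<zeta> powi (- int (pw D i)) = 1"
        using \<open>\<zeta> \<noteq> 0\<close> by (simp add: power_int_minus)
      moreover have "\<zeta> ^ pw D i * (A i (Suc n) * (\<zeta> powi (- int (pw D i)) * \<zeta> ^ Suc n))
          = (\<zeta> ^ pw D i * \<zeta> powi (- int (pw D i))) * (A i (Suc n) * \<zeta> ^ Suc n)" by (simp only: mult_ac)
      ultimately show ?thesis unfolding pint[OF \<open>\<zeta> \<noteq> 0\<close>] by (simp add: lfps_def)
    qed
    ultimately have "summable (\<lambda>n. fps_nth (lfps A i) (Suc n) * \<zeta> ^ Suc n)" by (simp only:)
    then show ?thesis by (subst (asm) summable_Suc_iff)
  qed
  \<comment> \<open>Convergence at one nonzero point already gives a positive radius of convergence;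
    \<rho>/2 is such a point.\<close>
  have half: "0 < norm (complex_of_real (\<rho> / 2))" "norm (complex_of_real (\<rho> / 2)) < \<rho>"
    unfolding norm_of_real using \<rho> by linarith+
  have "0 < ereal (norm (complex_of_real (\<rho> / 2)))"
    unfolding zero_ereal_def less_ereal.simps by (rule half(1))
  also have "\<dots> \<le> conv_radius (fps_nth (lfps A i))"
    by (rule conv_radius_geI[OF sm[OF half]])
  finally have "fps_conv_radius (lfps A i) > 0"
    unfolding fps_conv_radius_def .
  then show "lpsi A i has_fps_expansion lfps A i"
    unfolding lpsi_def by (rule eval_fps_has_fps_expansion)
  have xeq: "x i (\<zeta> + z0) = lx A i \<zeta>" if \<zeta>: "0 < norm \<zeta>" "norm \<zeta> < \<rho>" for \<zeta> i
  proof -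
    have nz: "\<zeta> \<noteq> 0" using \<zeta>(1) by auto
    note s = sm[OF \<zeta>, of i]
    have "lpsi A i \<zeta> = suminf (\<lambda>n. fps_nth (lfps A i) n * \<zeta> ^ n)" by (simp add: lpsi_def eval_fps_def)
    also have "\<dots> = suminf (\<lambda>n. fps_nth (lfps A i) (Suc n) * \<zeta> ^ Suc n) + fps_nth (lfps A i) 0 * \<zeta> ^ 0"
      using suminf_split_head[OF s] by simp
    finally have 1: "lpsi A i \<zeta> = suminf (\<lambda>n. A i (Suc n) * \<zeta> ^ Suc n) + cc D $ i" by (simp add: lfps_def)
    have "summable (\<lambda>n. fps_nth (lfps A i) (Suc n) * \<zeta> ^ Suc n)"
      using s by (subst summable_Suc_iff)
    then have s2: "summable (\<lambda>n. A i (Suc n) * \<zeta> ^ Suc n)" by (simp add: lfps_def)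
    have "suminf (\<lambda>n. A i (Suc n) * \<zeta> powi (- int (pw D i) + int (Suc n))) = suminf (\<lambda>n. \<zeta> powi (- int (pw D i)) * (A i (Suc n) * \<zeta> ^ Suc n))"
      unfolding pint[OF nz] by (simp only: mult.left_commute)
    also have "\<dots> = \<zeta> powi (- int (pw D i)) * suminf (\<lambda>n. A i (Suc n) * \<zeta> ^ Suc n)"
      by (rule suminf_mult[OF s2])
    finally have 2: "suminf (\<lambda>n. A i (Suc n) * \<zeta> powi (- int (pw D i) + int (Suc n))) = \<zeta> powi (- int (pw D i)) * suminf (\<lambda>n. A i (Suc n) * \<zeta> ^ Suc n)" .
    have "x i (\<zeta> + z0) = cc D $ i * \<zeta> powi (- int (pw D i)) + suminf (\<lambda>n. A i (Suc n) * \<zeta> powi (- int (pw D i) + int (Suc n)))"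
      by (simp only: x_def add_diff_cancel_right')
    also have "\<dots> = lx A i \<zeta>" unfolding 2 lx_def 1 by (simp add: algebra_simps)
    finally show ?thesis .
  qed
  have "(lx A i has_field_derivative
      fval D i (\<chi> l. lx A l \<zeta>) (z0 + \<zeta>) + gval D i (\<chi> l. lx A l \<zeta>) (z0 + \<zeta>)) (at \<zeta>)" if \<zeta>: "0 < norm \<zeta>" "norm \<zeta> < \<rho>" for \<zeta> i
  proof -
    note all_d[OF \<zeta>, of i]
    then have "((\<lambda>\<zeta>. x i (\<zeta> + z0)) has_field_derivative fval D i (\<chi> l. lx A l \<zeta>) (z0 + \<zeta>) + gval D i (\<chi> l. lx A l \<zeta>) (z0 + \<zeta>)) (at \<zeta>)"
      unfolding xeq[OF \<zeta>] by (subst (asm) DERIV_shift) (simp only: add.commute)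
    moreover have "open (ball 0 \<rho> - {0::complex})" by (intro open_Diff) auto
    moreover have "\<zeta> \<in> ball 0 \<rho> - {0}" using \<zeta> by auto
    ultimately show ?thesis
      by (rule has_field_derivative_transform_within_open) (rule xeq, auto)
  qed
  note der = this
  have "\<forall>\<^sub>F \<zeta> in nhds 0. \<zeta> \<in> ball (0::complex) \<rho>"
    using \<rho> by (intro eventually_nhds_in_open) auto
  then have "\<forall>\<^sub>F \<zeta> in at 0. \<zeta> \<in> ball (0::complex) \<rho>" by (rule eventually_nhds_imp_at)
  moreover have "\<forall>\<^sub>F \<zeta> in at (0::complex). \<zeta> \<noteq> 0" by (rule eventually_neq_at_within)
  ultimately show "\<forall>\<^sub>F \<zeta> in at 0. \<forall>i. (lx A i has_field_derivative
      fval D i (\<chi> l. lx A l \<zeta>) (z0 + \<zeta>) + gval D i (\<chi> l. lx A l \<zeta>) (z0 + \<zeta>)) (at \<zeta>)"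
  proof eventually_elim
    case (elim \<zeta>)
    then show ?case by (intro allI der) simp_all
  qed
qed

lemma laurent_families:
  assumes z0: "continuous_on \<Omega> z0" and A: "\<And>i n. n \<ge> 1 \<Longrightarrow> continuous_on \<Omega> (\<lambda>\<theta>. A \<theta> i n)"
    and e: "\<And>\<theta> i. \<theta> \<in> \<Omega> \<Longrightarrow> lpsi (A \<theta>) i has_fps_expansion lfps (A \<theta>) i"
  shows "fps_family \<Omega> (\<lambda>\<theta>. lpsi (A \<theta>) i)" "fps_family \<Omega> (\<lambda>\<theta>. lroot (A \<theta>))" "fps_family \<Omega> (\<lambda>\<theta>. lw (A \<theta>))"
    "fps_family \<Omega> (\<lambda>\<theta> \<zeta>. lX (A \<theta>) \<zeta> $ i)" "fps_family \<Omega> (\<lambda>\<theta> \<zeta>. lxi (A \<theta>) \<zeta> $ i)"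
    "fps_family \<Omega> (\<lambda>\<theta>. lZ (z0 \<theta>) (A \<theta>))" "fps_family \<Omega> (\<lambda>\<theta>. lE (A \<theta>))"
proof -
  note rules = fps_family_mult fps_family_add fps_family_power fps_family_sum fps_family_ident
  have c: "fps_family \<Omega> (\<lambda>_ _. k)" for k by (intro fps_family_const continuous_on_const)
  show psi: "fps_family \<Omega> (\<lambda>\<theta>. lpsi (A \<theta>) i)" for i
  proof (rule fps_familyI[OF e])
    fix n show "continuous_on \<Omega> (\<lambda>\<theta>. fps_nth (lfps (A \<theta>) i) n)"
      using A[of n i] by (cases "n = 0") (simp_all add: lfps_def)
  qed
  have psi0: "lpsi (A \<theta>) i 0 = cc D $ i" if "\<theta> \<in> \<Omega>" for \<theta> i
    using has_fps_expansion_imp_0_eq_fps_nth_0[OF e[OF that]] by (simp add: lfps_def)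
  show root: "fps_family \<Omega> (\<lambda>\<theta>. lroot (A \<theta>))"
    unfolding lroot_def[abs_def]
  proof (rule fps_family_mult[OF c])
    show "fps_family \<Omega> (\<lambda>\<theta> \<zeta>. (1 + (lpsi (A \<theta>) (jj D) \<zeta> * inverse (cc D $ jj D) + (- 1))) powr (- 1 / of_nat (pw D (jj D))))"
    \<comment> \<open>The base of the power is written as 1 + y with y(0) = 0, so that the binomial
      series can be composed with y.\<close>
    proof (rule fps_family_compose[where \<Phi> = "\<lambda>y. (1 + y) powr (- 1 / of_nat (pw D (jj D)))"])
      show "fps_family \<Omega> (\<lambda>\<theta> \<zeta>. lpsi (A \<theta>) (jj D) \<zeta> * inverse (cc D $ jj D) + (- 1))"
        by (intro fps_family_add fps_family_mult psi c)
      show "lpsi (A \<theta>) (jj D) 0 * inverse (cc D $ jj D) + (- 1) = 0" if "\<theta> \<in> \<Omega>" for \<theta>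
        using psi0[OF that] cc_jj(1) by simp
      show "(\<lambda>y::complex. (1 + y) powr (- 1 / of_nat (pw D (jj D)))) has_fps_expansion fps_binomial (- 1 / of_nat (pw D (jj D)))"
        by (rule has_fps_expansion_binomial_complex)
    qed
  qed
  show w: "fps_family \<Omega> (\<lambda>\<theta>. lw (A \<theta>))"
    unfolding lw_def[abs_def] by (intro fps_family_mult fps_family_ident root)
  show X: "fps_family \<Omega> (\<lambda>\<theta> \<zeta>. lX (A \<theta>) \<zeta> $ i)" for i
    by (cases "i = jj D") (simp_all add: lX_def c fps_family_mult fps_family_power psi root)
  show "fps_family \<Omega> (\<lambda>\<theta> \<zeta>. lxi (A \<theta>) \<zeta> $ i)"
    unfolding lxi_def matrix_vector_mult_def vec_lambda_beta vector_minus_component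
    unfolding diff_conv_add_uminus
    by (intro fps_family_sum fps_family_mult fps_family_add X c)
  show "fps_family \<Omega> (\<lambda>\<theta>. lZ (z0 \<theta>) (A \<theta>))"
    unfolding lZ_def[abs_def] by (intro fps_family_mult fps_family_add fps_family_power fps_family_ident fps_family_const z0 w)
  show "fps_family \<Omega> (\<lambda>\<theta>. lE (A \<theta>))"
    unfolding lE_def[abs_def] by (intro fps_family_power w)
qed

end

lemma analytic_local_inverse:
  fixes f :: "complex \<Rightarrow> complex"
  assumes an: "f analytic_on {0}" and f0: "f 0 = 0" and d: "deriv f 0 \<noteq> 0"
  obtains g where "g analytic_on {0}" "g 0 = 0" "\<forall>\<^sub>F z in nhds 0. g (f z) = z" "\<forall>\<^sub>F t in nhds 0. f (g t) = t"
    "\<forall>\<^sub>F t in nhds 0. deriv f (g t) * deriv g t = 1"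
proof -
  obtain S where S: "open S" "0 \<in> S" "f holomorphic_on S"
    using an unfolding analytic_at by blast
  obtain r where r: "r > 0" "ball 0 r \<subseteq> S" "open (f ` ball 0 r)" "inj_on f (ball 0 r)"
    using has_complex_derivative_locally_invertible[OF S(3,2,1) d] by blast
  have hol: "f holomorphic_on ball 0 r" by (rule holomorphic_on_subset[OF S(3) r(2)])
  obtain g where g: "g holomorphic_on (f ` ball 0 r)" "\<And>z. z \<in> ball 0 r \<Longrightarrow> deriv f z * deriv g (f z) = 1"
    "\<And>z. z \<in> ball 0 r \<Longrightarrow> g (f z) = z"
    using holomorphic_has_inverse[OF hol open_ball r(4)] by blast
  have z0: "0 \<in> f ` ball 0 r" using f0 r(1) by (intro image_eqI[of _ _ 0]) auto
  show ?thesis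
  proof (rule that[of g])
    show "g analytic_on {0}" unfolding analytic_at using g(1) r(3) z0 by blast
    show "g 0 = 0" using g(3)[of 0] f0 r(1) by simp
    have "\<forall>\<^sub>F z in nhds 0. z \<in> ball (0::complex) r" using r(1) by (intro eventually_nhds_in_open) auto
    then show "\<forall>\<^sub>F z in nhds 0. g (f z) = z" by eventually_elim (rule g(3))
    have im: "\<forall>\<^sub>F t in nhds 0. t \<in> f ` ball 0 r" using r(3) z0 by (intro eventually_nhds_in_open) auto
    then show "\<forall>\<^sub>F t in nhds 0. f (g t) = t"
      by eventually_elim (auto simp: g(3) simp del: mem_ball)
    from im show "\<forall>\<^sub>F t in nhds 0. deriv f (g t) * deriv g t = 1"
      by eventually_elim (auto simp: g(2,3) simp del: mem_ball)
  qed
qed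

context kov_system
begin

lemma laurent_analytic:
  assumes ls: "laurent_solution D z0 A"
  shows "lpsi A i analytic_on {0}" "lroot A analytic_on {0}" "lw A analytic_on {0}"
    "(\<lambda>\<zeta>. lxi A \<zeta> $ i) analytic_on {0}" "lZ z0 A analytic_on {0}" "lE A analytic_on {0}"
proof -
  \<comment> \<open>A one-point parameter set turns the statement on families into one on a single
    solution.\<close>
  note f = laurent_families[of "{0::real}" "\<lambda>_. z0" "\<lambda>_. A", OF continuous_on_const continuous_on_const
      laurent_solution_expansion(1)[OF ls]]
  have s: "(0::real) \<in> {0}" by simp
  show "lpsi A i analytic_on {0}" "lroot A analytic_on {0}" "lw A analytic_on {0}"
    "(\<lambda>\<zeta>. lxi A \<zeta> $ i) analytic_on {0}" "lZ z0 A analytic_on {0}" "lE A analytic_on {0}"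
    using fps_family_analytic[OF f(1) s] fps_family_analytic[OF f(2) s] fps_family_analytic[OF f(3) s]
      fps_family_analytic[OF f(5) s] fps_family_analytic[OF f(6) s] fps_family_analytic[OF f(7) s] by simp_all
qed

text \<open>Raising to the power p_j removes the logarithm whatever its branch, and beta^(p_j) = c_j
  cancels the normalization of the base. Off \<zeta> = 0 the relation amounts to w^(p_j) x_j =
  1.\<close>

lemma lroot_facts:
  assumes ls: "laurent_solution D z0 A"
  shows "lpsi A i 0 = cc D $ i" "lroot A 0 = inverse (beta D)"
    "\<forall>\<^sub>F \<zeta> in nhds 0. lroot A \<zeta> \<noteq> 0 \<and> lroot A \<zeta> ^ pw D (jj D) * lpsi A (jj D) \<zeta> = 1"
proof -
  show psi0: "lpsi A i 0 = cc D $ i" for i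
    using has_fps_expansion_imp_0_eq_fps_nth_0[OF laurent_solution_expansion(1)[OF ls, of i]] by (simp add: lfps_def)
  show "lroot A 0 = inverse (beta D)"
    using cc_jj(1) by (simp add: lroot_def psi0)
  have "isCont (lpsi A (jj D)) 0" using laurent_analytic(1)[OF ls] analytic_at_imp_isCont by blast
  then have "(lpsi A (jj D) \<longlongrightarrow> lpsi A (jj D) 0) (nhds 0)" by (rule isCont_tendsto_nhds)
  then have "\<forall>\<^sub>F \<zeta> in nhds 0. lpsi A (jj D) \<zeta> \<noteq> 0"
    by (rule tendsto_imp_eventually_ne) (simp add: psi0 cc_jj(1))
  then show "\<forall>\<^sub>F \<zeta> in nhds 0. lroot A \<zeta> \<noteq> 0 \<and> lroot A \<zeta> ^ pw D (jj D) * lpsi A (jj D) \<zeta> = 1"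
  proof eventually_elim
    case (elim \<zeta>)
    define y where "y = lpsi A (jj D) \<zeta> * inverse (cc D $ jj D)"
    define p where "p = pw D (jj D)"
    have p: "p > 0" using pw_pos by (simp add: p_def)
    have y: "y \<noteq> 0" using elim cc_jj(1) by (simp add: y_def)
    have rt: "lroot A \<zeta> = inverse (beta D) * exp ((- 1 / of_nat p) * Ln y)"
      using y by (simp add: lroot_def y_def[symmetric] p_def powr_def)
    have "exp ((- 1 / of_nat p) * Ln y) ^ p = exp (of_nat p * ((- 1 / of_nat p) * Ln y))"
      by (rule exp_of_nat_mult[symmetric])
    also have "of_nat p * ((- 1 / of_nat p) * Ln y) = - Ln y" using p by simp
    also have "exp (- Ln y) = inverse y" using y by (simp add: exp_minus)
    finally have "lroot A \<zeta> ^ p = inverse (cc D $ jj D) * inverse y"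
      unfolding rt power_mult_distrib power_inverse cc_jj(2)[folded p_def] by (simp only:)
    then have "lroot A \<zeta> ^ p * lpsi A (jj D) \<zeta>
        = (inverse (cc D $ jj D) * cc D $ jj D) * (inverse (lpsi A (jj D) \<zeta>) * lpsi A (jj D) \<zeta>)"
      by (simp only: y_def inverse_mult_distrib inverse_inverse_eq mult_ac)
    then have "lroot A \<zeta> ^ p * lpsi A (jj D) \<zeta> = 1"
      using elim cc_jj(1) by simp
    then show ?case using rt beta_nz by (simp add: p_def)
  qed
qed

lemma deriv_lw_0:
  assumes ls: "laurent_solution D z0 A"
  shows "deriv (lw A) 0 = inverse (beta D)"
proof -
  have "lroot A field_differentiable (at 0)"
    using laurent_analytic(2)[OF ls] by (simp add: analytic_on_imp_differentiable_at)
  then obtain l where "(lroot A has_field_derivative l) (at 0)" unfolding field_differentiable_def by blast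
  from DERIV_mult[OF DERIV_ident this]
  have "(lw A has_field_derivative 1 * lroot A 0 + l * 0) (at 0)" by (simp add: lw_def[abs_def])
  then show ?thesis using lroot_facts(2)[OF ls] by (simp add: DERIV_imp_deriv)
qed

lemma X_of_lxi: "X_of D (lxi A \<zeta>) = lX A \<zeta>"
proof -
  have "TT D *v lxi A \<zeta> = lX A \<zeta> - fixed_point D"
    by (simp add: lxi_def matrix_vector_mul_assoc TT_inverse)
  then show ?thesis by (simp add: X_of_def)
qed

text \<open>Homogeneity of f and the defining relation of G release the same factor w^(-(p_i + 1))
  and leave f + w^s G.\<close>

lemma vector_field_in_chart:
  assumes w: "w \<noteq> 0" and X: "X $ jj D = 1"
  shows "fval D i (\<chi> l. X $ l * w powi (- int (pw D l))) (Z * w powi (- int (rw D)))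
       + gval D i (\<chi> l. X $ l * w powi (- int (pw D l))) (Z * w powi (- int (rw D)))
       = inverse w ^ (pw D i + 1) * numer D i X Z (w ^ sw D)"
proof -
  have s: "slot_one D X = X" using X by (simp add: slot_one_def vec_eq_iff)
  have "(\<chi> l. X $ l * w powi (- int (pw D l))) = wscale D (inverse w) X"
    by (simp add: wscale_def vec_eq_iff power_int_minus power_inverse mult.commute)
  moreover have "Z * w powi (- int (rw D)) = inverse w ^ rw D * Z"
    by (simp add: power_int_minus power_inverse mult.commute)
  ultimately have f: "fval D i (\<chi> l. X $ l * w powi (- int (pw D l))) (Z * w powi (- int (rw D)))
      = inverse w ^ (pw D i + 1) * fval D i X Z"
    using A1 unfolding assumption_A1_def by (metis (no_types))
  have g: "gval D i (\<chi> l. X $ l * w powi (- int (pw D l))) (Z * w powi (- int (rw D)))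
      = w powi (int (sw D) - (1 + int (pw D i))) * Gval D i X Z (w ^ sw D)"
    using G_det w X unfolding G_determined_def by blast
  have "int (sw D) - (1 + int (pw D i)) = int (sw D) + - int (pw D i + 1)" by simp
  then have "w powi (int (sw D) - (1 + int (pw D i))) = w ^ sw D * inverse w ^ (pw D i + 1)"
    using w by (simp only: power_int_add power_int_minus power_int_of_nat power_inverse simp_thms)
  then show ?thesis unfolding f g numer_def s by (simp only: distrib_left mult_ac)
qed

text \<open>Since \<epsilon> = w^s and d\<epsilon>/dt = s \<epsilon>, the chart time satisfies dw/dt
  = w. Hence w / w' times the derivative in \<zeta> is the derivative in chart time, where w' =
  dw/d\<zeta>.\<close>

lemma laurent_chart_ode:
  assumes ls: "laurent_solution D z0 A"
  shows "\<forall>\<^sub>F \<zeta> in at 0. deriv (lw A) \<zeta> \<noteq> 0 \<and> lw A \<zeta> \<noteq> 0 \<and> (\<exists>\<xi>' Z' E'.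
     (\<forall>l. ((\<lambda>\<zeta>. lxi A \<zeta> $ l) has_field_derivative \<xi>' l) (at \<zeta>)) \<and> (lZ z0 A has_field_derivative Z') (at \<zeta>) \<and>
     (lE A has_field_derivative E') (at \<zeta>) \<and>
     (\<forall>l. lw A \<zeta> / deriv (lw A) \<zeta> * \<xi>' l = fst (full_field D (lxi A \<zeta>, lZ z0 A \<zeta>, lE A \<zeta>)) $ l) \<and>
     lw A \<zeta> / deriv (lw A) \<zeta> * Z' = fst (snd (full_field D (lxi A \<zeta>, lZ z0 A \<zeta>, lE A \<zeta>))) \<and>
     lw A \<zeta> / deriv (lw A) \<zeta> * E' = snd (snd (full_field D (lxi A \<zeta>, lZ z0 A \<zeta>, lE A \<zeta>))))"
proof -
  have dw: "\<forall>\<^sub>F \<zeta> in nhds 0. deriv (lw A) \<zeta> \<noteq> 0"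
  proof -
    have "deriv (lw A) analytic_on {0}" by (rule analytic_deriv[OF laurent_analytic(3)[OF ls]])
    then have "isCont (deriv (lw A)) 0" using analytic_at_imp_isCont by blast
    then have "(deriv (lw A) \<longlongrightarrow> deriv (lw A) 0) (nhds 0)" by (rule isCont_tendsto_nhds)
    then show ?thesis
      by (rule tendsto_imp_eventually_ne) (simp add: deriv_lw_0[OF ls] beta_nz)
  qed
  have "\<forall>\<^sub>F \<zeta> in at 0. \<zeta> \<noteq> 0 \<and> deriv (lw A) \<zeta> \<noteq> 0 \<and> (lw A has_field_derivative deriv (lw A) \<zeta>) (at \<zeta>) \<and>
      lroot A \<zeta> \<noteq> 0 \<and> lroot A \<zeta> ^ pw D (jj D) * lpsi A (jj D) \<zeta> = 1 \<and>
      (\<forall>i. (lx A i has_field_derivative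
      fval D i (\<chi> l. lx A l \<zeta>) (z0 + \<zeta>) + gval D i (\<chi> l. lx A l \<zeta>) (z0 + \<zeta>)) (at \<zeta>))"
    using eventually_neq_at_within[of "0::complex" 0 UNIV] eventually_nhds_imp_at[OF dw]
      eventually_nhds_imp_at[OF analytic_eventually_has_derivative[OF laurent_analytic(3)[OF ls]]]
      eventually_nhds_imp_at[OF lroot_facts(3)[OF ls]] laurent_solution_expansion(2)[OF ls]
    by eventually_elim (intro conjI; simp)
  then obtain S where S: "open S" "0 \<in> S" and good0: "\<forall>\<zeta>\<in>S. \<zeta> \<noteq> 0 \<longrightarrow> \<zeta> \<noteq> 0 \<and> deriv (lw A) \<zeta> \<noteq> 0 \<and> (lw A has_field_derivative deriv (lw A) \<zeta>) (at \<zeta>) \<and>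
      lroot A \<zeta> \<noteq> 0 \<and> lroot A \<zeta> ^ pw D (jj D) * lpsi A (jj D) \<zeta> = 1 \<and>
      (\<forall>i. (lx A i has_field_derivative
      fval D i (\<chi> l. lx A l \<zeta>) (z0 + \<zeta>) + gval D i (\<chi> l. lx A l \<zeta>) (z0 + \<zeta>)) (at \<zeta>))"
    unfolding eventually_at_topological by auto
  define S' where "S' = S - {0}"
  have S': "open S'" unfolding S'_def using S(1) by (rule open_delete)
  have good: "\<zeta> \<noteq> 0" "deriv (lw A) \<zeta> \<noteq> 0" "(lw A has_field_derivative deriv (lw A) \<zeta>) (at \<zeta>)"
      "lroot A \<zeta> \<noteq> 0" "lroot A \<zeta> ^ pw D (jj D) * lpsi A (jj D) \<zeta> = 1"
      "(lx A i has_field_derivative fval D i (\<chi> l. lx A l \<zeta>) (z0 + \<zeta>) + gval D i (\<chi> l. lx A l \<zeta>) (z0 + \<zeta>)) (at \<zeta>)"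
    if "\<zeta> \<in> S'" for \<zeta> i
  proof -
    note g = good0[rule_format, of \<zeta>]
    have m: "\<zeta> \<in> S" "\<zeta> \<noteq> 0" using that by (auto simp: S'_def)
    show "\<zeta> \<noteq> 0" "deriv (lw A) \<zeta> \<noteq> 0" "(lw A has_field_derivative deriv (lw A) \<zeta>) (at \<zeta>)"
      "lroot A \<zeta> \<noteq> 0" "lroot A \<zeta> ^ pw D (jj D) * lpsi A (jj D) \<zeta> = 1"
      "(lx A i has_field_derivative fval D i (\<chi> l. lx A l \<zeta>) (z0 + \<zeta>) + gval D i (\<chi> l. lx A l \<zeta>) (z0 + \<zeta>)) (at \<zeta>)"
      using g[OF m] by (elim conjE, simp only:)+
  qed
  have wnz: "lw A \<zeta> \<noteq> 0" if "\<zeta> \<in> S'" for \<zeta> using good(1,4)[OF that] by (simp add: lw_def)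
  have wpsi: "lx A i \<zeta> * lw A \<zeta> ^ pw D i = lX A \<zeta> $ i" if "\<zeta> \<in> S'" for \<zeta> i
  proof -
    have "\<zeta> powi (- int (pw D i)) * \<zeta> ^ pw D i = 1" using good(1)[OF that] by (simp add: power_int_minus)
    moreover have "lx A i \<zeta> * lw A \<zeta> ^ pw D i = (\<zeta> powi (- int (pw D i)) * \<zeta> ^ pw D i) * (lpsi A i \<zeta> * lroot A \<zeta> ^ pw D i)"
      by (simp only: lx_def lw_def power_mult_distrib mult_ac)
    ultimately have "lx A i \<zeta> * lw A \<zeta> ^ pw D i = lpsi A i \<zeta> * lroot A \<zeta> ^ pw D i" by simp
    then show ?thesis using good(5)[OF that] by (cases "i = jj D") (simp_all add: lX_def mult.commute)
  qed
  have X1: "lX A \<zeta> $ jj D = 1" for \<zeta> by (simp add: lX_def)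
  have main: "deriv (lw A) \<zeta> \<noteq> 0 \<and> lw A \<zeta> \<noteq> 0 \<and> (\<exists>\<xi>' Z' E'.
     (\<forall>l. ((\<lambda>\<zeta>. lxi A \<zeta> $ l) has_field_derivative \<xi>' l) (at \<zeta>)) \<and> (lZ z0 A has_field_derivative Z') (at \<zeta>) \<and>
     (lE A has_field_derivative E') (at \<zeta>) \<and>
     (\<forall>l. lw A \<zeta> / deriv (lw A) \<zeta> * \<xi>' l = fst (full_field D (lxi A \<zeta>, lZ z0 A \<zeta>, lE A \<zeta>)) $ l) \<and>
     lw A \<zeta> / deriv (lw A) \<zeta> * Z' = fst (snd (full_field D (lxi A \<zeta>, lZ z0 A \<zeta>, lE A \<zeta>))) \<and>
     lw A \<zeta> / deriv (lw A) \<zeta> * E' = snd (snd (full_field D (lxi A \<zeta>, lZ z0 A \<zeta>, lE A \<zeta>))))"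
    if \<zeta>: "\<zeta> \<in> S'" for \<zeta>
  proof -
    define w where "w = lw A \<zeta>"
    define w' where "w' = deriv (lw A) \<zeta>"
    define X where "X = lX A \<zeta>"
    define Z where "Z = lZ z0 A \<zeta>"
    define nu where "nu i = numer D i X Z (w ^ sw D)" for i
    have w: "w \<noteq> 0" and w': "w' \<noteq> 0" and dw: "(lw A has_field_derivative w') (at \<zeta>)"
      using wnz[OF \<zeta>] good(2,3)[OF \<zeta>] by (simp_all add: w_def w'_def)
    have XX: "X $ jj D = 1" by (simp add: X_def X1)
    have "lx A l \<zeta> = X $ l * w powi (- int (pw D l))" for l
      using wpsi[OF \<zeta>, of l] w by (simp add: X_def w_def power_int_minus field_simps)
    moreover have "z0 + \<zeta> = Z * w powi (- int (rw D))"
      using w by (simp add: Z_def lZ_def w_def[symmetric] power_int_minus)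
    ultimately have dx: "(lx A i has_field_derivative inverse w ^ (pw D i + 1) * nu i) (at \<zeta>)" for i
      using good(6)[OF \<zeta>, of i] vector_field_in_chart[OF w XX, of i Z] by (simp only: nu_def)
    have pwd: "((\<lambda>\<zeta>. lw A \<zeta> ^ n) has_field_derivative of_nat n * (w ^ n * w' / w)) (at \<zeta>)" for n
    proof -
      have "of_nat n * (w' * w ^ (n - Suc 0)) = of_nat n * (w ^ n * w' / w)"
        using w by (cases n) simp_all
      then show ?thesis using DERIV_power[OF dw, of n] by (simp only: w_def)
    qed
    have dX: "((\<lambda>\<zeta>. lX A \<zeta> $ i) has_field_derivative (nu i + of_nat (pw D i) * X $ i * w') / w) (at \<zeta>)" for i
    proof -
      have "((\<lambda>\<zeta>. lx A i \<zeta> * lw A \<zeta> ^ pw D i) has_field_derivative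
          inverse w ^ (pw D i + 1) * nu i * w ^ pw D i + of_nat (pw D i) * (w ^ pw D i * w' / w) * lx A i \<zeta>) (at \<zeta>)"
        using DERIV_mult[OF dx[of i] pwd[of "pw D i"]] by (simp only: w_def)
      moreover have "inverse w ^ (pw D i + 1) * nu i * w ^ pw D i + of_nat (pw D i) * (w ^ pw D i * w' / w) * lx A i \<zeta>
          = (nu i + of_nat (pw D i) * X $ i * w') / w"
      proof -
        have "inverse w ^ (pw D i + 1) * nu i * w ^ pw D i = (inverse w ^ pw D i * w ^ pw D i) * (nu i / w)"
          by (simp only: power_add power_one_right divide_inverse mult_ac)
        also have "inverse w ^ pw D i * w ^ pw D i = 1" using w by (simp flip: power_mult_distrib)
        finally have 1: "inverse w ^ (pw D i + 1) * nu i * w ^ pw D i = nu i / w" by simp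
        have "of_nat (pw D i) * (w ^ pw D i * w' / w) * lx A i \<zeta> = of_nat (pw D i) * (lx A i \<zeta> * w ^ pw D i) * w' / w"
          by (simp only: times_divide_eq_left times_divide_eq_right mult_ac)
        also have "lx A i \<zeta> * w ^ pw D i = X $ i" using wpsi[OF \<zeta>, of i] by (simp only: w_def X_def)
        finally show ?thesis unfolding 1 by (simp only: add_divide_distrib)
      qed
      ultimately have "((\<lambda>\<zeta>. lx A i \<zeta> * lw A \<zeta> ^ pw D i) has_field_derivative (nu i + of_nat (pw D i) * X $ i * w') / w) (at \<zeta>)"
        by (simp only:)
      then show ?thesis
        by (rule has_field_derivative_transform_within_open[OF _ S' \<zeta>]) (rule wpsi)
    qed
    \<comment> \<open>X_j is constantly 1; setting its derivative to 0 determines f_j + \<epsilon>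
      G_j, which gives F = 1/w'.\<close>
    have nuj: "nu (jj D) = - of_nat (pw D (jj D)) * w'"
    proof -
      have "((\<lambda>\<zeta>. lX A \<zeta> $ jj D) has_field_derivative 0) (at \<zeta>)" unfolding X1 by (rule DERIV_const)
      from DERIV_unique[OF this dX[of "jj D"]] w XX
      have "nu (jj D) + of_nat (pw D (jj D)) * w' = 0" by simp
      then show ?thesis by (simp add: add_eq_0_iff)
    qed
    have F: "Fm1 D X Z (w ^ sw D) = 1 / w'"
      using nuj w' pw_pos[of "jj D"] by (simp add: Fm1_def nu_def)
    have xf: "X_field D X Z (w ^ sw D) $ i = w / w' * ((nu i + of_nat (pw D i) * X $ i * w') / w)" for i
    proof (cases "i = jj D")
      case True
      then show ?thesis using nuj XX by (simp add: X_field_def)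
    next
      case False
      have "of_nat (pw D (jj D)) * (nu i / nu (jj D)) = - (nu i / w')"
        using w' pw_pos[of "jj D"] by (simp add: nuj)
      then have "X_field D X Z (w ^ sw D) $ i = of_nat (pw D i) * X $ i + nu i / w'"
        using False by (simp add: X_field_def nu_def[symmetric])
      also have "\<dots> = (nu i + of_nat (pw D i) * X $ i * w') / w'"
        using w' by (simp add: add_divide_distrib)
      also have "\<dots> = w / w' * ((nu i + of_nat (pw D i) * X $ i * w') / w)"
        using w by simp
      finally show ?thesis .
    qed
    define \<xi>' where "\<xi>' l = (\<Sum>k\<in>UNIV. matrix_inv (TT D) $ l $ k * ((nu k + of_nat (pw D k) * X $ k * w') / w))" for l
    define Z' where "Z' = w ^ rw D + of_nat (rw D) * (w ^ rw D * w' / w) * (z0 + \<zeta>)"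
    define E' where "E' = of_nat (sw D) * (w ^ sw D * w' / w)"
    have d\<xi>: "((\<lambda>\<zeta>. lxi A \<zeta> $ l) has_field_derivative \<xi>' l) (at \<zeta>)" for l
    proof -
      have "((\<lambda>\<zeta>. \<Sum>k\<in>UNIV. matrix_inv (TT D) $ l $ k * (lX A \<zeta> $ k - fixed_point D $ k)) has_field_derivative
          (\<Sum>k\<in>UNIV. matrix_inv (TT D) $ l $ k * ((nu k + of_nat (pw D k) * X $ k * w') / w - 0))) (at \<zeta>)"
        by (intro DERIV_sum DERIV_cmult DERIV_diff dX DERIV_const)
      then show ?thesis by (simp add: lxi_def matrix_vector_mult_def \<xi>'_def)
    qed
    have dZ: "(lZ z0 A has_field_derivative Z') (at \<zeta>)"
    proof -
      have "((\<lambda>\<zeta>. z0 + \<zeta>) has_field_derivative 0 + 1) (at \<zeta>)" by (intro DERIV_add DERIV_const DERIV_ident)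
      from DERIV_mult[OF this pwd[of "rw D"]] show ?thesis by (simp add: lZ_def[abs_def] Z'_def w_def)
    qed
    have dE: "(lE A has_field_derivative E') (at \<zeta>)"
      unfolding lE_def[abs_def] E'_def by (rule pwd)
    have "lE A \<zeta> = w ^ sw D" by (simp add: lE_def w_def)
    then have ff: "full_field D (lxi A \<zeta>, lZ z0 A \<zeta>, lE A \<zeta>) =
        (matrix_inv (TT D) *v X_field D X Z (w ^ sw D), of_nat (rw D) * Z + w ^ sw D * (1 / w'), of_nat (sw D) * w ^ sw D)"
      unfolding full_field_eq fst_conv snd_conv X_of_lxi X_def[symmetric] Z_def[symmetric] by (simp only: F)
    have e1: "w / w' * \<xi>' l = (matrix_inv (TT D) *v X_field D X Z (w ^ sw D)) $ l" for l
      unfolding matrix_vector_mult_def vec_lambda_beta xf \<xi>'_def sum_distrib_left by (simp only: mult.left_commute)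
    have e2: "w / w' * Z' = of_nat (rw D) * Z + w ^ sw D * (1 / w')"
    proof -
      have "w / w' * Z' = w * w ^ rw D * (1 / w') + of_nat (rw D) * ((z0 + \<zeta>) * w ^ rw D)"
        using w w' by (simp add: Z'_def distrib_left mult_ac)
      also have "w * w ^ rw D = w ^ sw D" by (simp add: sw_def)
      finally show ?thesis by (simp add: Z_def lZ_def w_def)
    qed
    have e3: "w / w' * E' = of_nat (sw D) * w ^ sw D" using w w' by (simp add: E'_def)
    show ?thesis
      unfolding w_def[symmetric] w'_def[symmetric] ff fst_conv snd_conv
      using w w' d\<xi> dZ dE e1 e2 e3
      by (intro conjI exI[of _ \<xi>'] exI[of _ Z'] exI[of _ E'] allI) assumption+
  qed
  have "\<forall>\<^sub>F \<zeta> in at 0. \<zeta> \<in> S'"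
    unfolding eventually_at_topological S'_def using S by blast
  then show ?thesis by eventually_elim (rule main)
qed

end

lemma eventually_nhds_iff_at: "eventually P (nhds a) \<longleftrightarrow> eventually P (at a) \<and> P (a::'a::t1_space)"
  using eventually_nhds_x_imp_x[of P a]
  by (auto simp: eventually_at_filter elim: eventually_mono)

text \<open>g(s)/s tends to 1, so the extra factor (g(s)/s)^n does not change the limit: a change of
  variable tangent to the identity keeps leading coefficients.\<close>

lemma limit_reparametrized:
  fixes \<phi> g :: "complex \<Rightarrow> complex"
  assumes g: "g analytic_on {0}" "g 0 = 0" "deriv g 0 = 1"
    and lim: "((\<lambda>t. \<phi> t / t ^ n) \<longlongrightarrow> l) (at 0)"
  shows "filterlim g (at 0) (at 0)" "((\<lambda>s. \<phi> (g s) / s ^ n) \<longlongrightarrow> l) (at 0)"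
proof -
  have "(g has_field_derivative 1) (at 0)"
    using eventually_nhds_x_imp_x[OF analytic_eventually_has_derivative[OF g(1)]] g(3) by simp
  then have q: "((\<lambda>s. g s / s) \<longlongrightarrow> 1) (at 0)"
    by (simp add: has_field_derivative_iff g(2))
  have nz: "\<forall>\<^sub>F s in at 0. g s \<noteq> 0"
    using tendsto_imp_eventually_ne[OF q, of 0] by (auto elim: eventually_mono)
  have "isCont g 0" using g(1) analytic_at_imp_isCont by blast
  then have "(g \<longlongrightarrow> 0) (at 0)" using g(2) by (simp add: isCont_def)
  then show fl: "filterlim g (at 0) (at 0)"
    using nz by (simp add: filterlim_at)
  have "((\<lambda>s. \<phi> (g s) / g s ^ n * (g s / s) ^ n) \<longlongrightarrow> l * 1 ^ n) (at 0)"
    by (rule tendsto_mult[OF filterlim_compose[OF lim fl] tendsto_power[OF q]])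
  moreover have "\<forall>\<^sub>F s in at 0. \<phi> (g s) / g s ^ n * (g s / s) ^ n = \<phi> (g s) / s ^ n"
    using nz by eventually_elim (simp add: power_divide)
  ultimately have "((\<lambda>s. \<phi> (g s) / s ^ n) \<longlongrightarrow> l * 1 ^ n) (at 0)"
    by (rule Lim_transform_eventually)
  then show "((\<lambda>s. \<phi> (g s) / s ^ n) \<longlongrightarrow> l) (at 0)" by simp
qed

context kov_system
begin

definition lP :: "complex \<Rightarrow> ('m \<Rightarrow> nat \<Rightarrow> complex) \<Rightarrow> complex \<Rightarrow> (complex^'m) \<times> complex \<times> complex" where
  "lP z0 A \<zeta> = (lxi A \<zeta>, lZ z0 A \<zeta>, lE A \<zeta>)"

lemma lw_0: "lw A 0 = 0" by (simp add: lw_def)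

lemma lP_0:
  assumes ls: "laurent_solution D z0 A"
  shows "lP z0 A 0 = 0"
proof -
  have "lX A 0 = fixed_point D"
    unfolding vec_eq_iff
  proof
    fix i show "lX A 0 $ i = fixed_point D $ i"
      using fixed_point_jj lroot_facts(1,2)[OF ls]
      by (cases "i = jj D") (simp_all add: lX_def fixed_point_def power_int_minus power_inverse)
  qed
  then show ?thesis
    using rw_pos by (simp add: lP_def lxi_def lZ_def lE_def lw_0 sw_def zero_prod_def zero_power)
qed

text \<open>The new variable is \<tau> = beta w, for which \<tau> d/d\<tau> = w d/dw is the
  derivative in chart time. The factor beta makes \<tau> tangent to \<zeta>, so that leading
  coefficients in \<tau> and in \<zeta> agree; \<kappa> expresses \<zeta> through \<tau>.\<close>

lemma laurent_curve:
  assumes ls: "laurent_solution D z0 A"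
  obtains \<kappa> where "\<kappa> analytic_on {0}" "\<kappa> 0 = 0" "deriv \<kappa> 0 = 1"
    "\<forall>\<^sub>F \<zeta> in nhds 0. \<kappa> (beta D * lw A \<zeta>) = \<zeta>" "\<forall>\<^sub>F t in nhds 0. beta D * lw A (\<kappa> t) = t"
    "\<forall>\<^sub>F t in nhds 0. lP z0 A (\<kappa> t) = graph_point D (proj (lP z0 A (\<kappa> t)))"
    "solution (\<lambda>t. proj (lP z0 A (\<kappa> t)))"
proof -
  define f where "f \<zeta> = beta D * lw A \<zeta>" for \<zeta>
  have f_an: "f analytic_on {0}" unfolding f_def by (intro analytic_on_mult analytic_on_const laurent_analytic(3)[OF ls])
  have f0: "f 0 = 0" by (simp add: f_def lw_0)
  have df: "\<forall>\<^sub>F \<zeta> in nhds 0. deriv f \<zeta> = beta D * deriv (lw A) \<zeta>"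
    using analytic_eventually_has_derivative[OF laurent_analytic(3)[OF ls]]
  proof eventually_elim
    case (elim \<zeta>)
    show ?case unfolding f_def[abs_def] by (rule DERIV_imp_deriv[OF DERIV_cmult[OF elim]])
  qed
  have df0: "deriv f 0 = 1"
    using eventually_nhds_x_imp_x[OF df] deriv_lw_0[OF ls] beta_nz by simp
  then have dnz: "deriv f 0 \<noteq> 0" by simp
  obtain \<kappa> where \<kappa>: "\<kappa> analytic_on {0}" "\<kappa> 0 = 0" "\<forall>\<^sub>F z in nhds 0. \<kappa> (f z) = z" "\<forall>\<^sub>F t in nhds 0. f (\<kappa> t) = t"
    "\<forall>\<^sub>F t in nhds 0. deriv f (\<kappa> t) * deriv \<kappa> t = 1"
    using analytic_local_inverse[OF f_an f0 dnz] by blast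
  have dk0: "deriv \<kappa> 0 = 1"
    using eventually_nhds_x_imp_x[OF \<kappa>(5)] df0 by (simp add: \<kappa>(2))
  have k_tend: "(\<kappa> \<longlongrightarrow> 0) (nhds 0)"
    using isCont_tendsto_nhds[of 0 \<kappa>] analytic_at_imp_isCont[OF \<kappa>(1)] \<kappa>(2) by simp
  have k_at: "filterlim \<kappa> (at 0) (at 0)"
    by (rule limit_reparametrized(1)[OF \<kappa>(1,2) dk0, of "\<lambda>_. 0" 0 0]) simp
  have comp_an: "(\<lambda>t. F (\<kappa> t)) analytic_on {0}" if "F analytic_on {0}" for F
    using analytic_on_compose_gen[OF \<kappa>(1) that] \<kappa>(2) by (simp add: comp_def)
  have ode_at: "\<forall>\<^sub>F t in at 0. (\<forall>l. t * deriv (\<lambda>t. lxi A (\<kappa> t) $ l) t = fst (full_field D (lxi A (\<kappa> t), lZ z0 A (\<kappa> t), lE A (\<kappa> t))) $ l) \<and>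
       t * deriv (\<lambda>t. lZ z0 A (\<kappa> t)) t = fst (snd (full_field D (lxi A (\<kappa> t), lZ z0 A (\<kappa> t), lE A (\<kappa> t)))) \<and>
       t * deriv (\<lambda>t. lE A (\<kappa> t)) t = snd (snd (full_field D (lxi A (\<kappa> t), lZ z0 A (\<kappa> t), lE A (\<kappa> t))))"
    using eventually_compose_filterlim[OF laurent_chart_ode[OF ls] k_at]
      eventually_nhds_imp_at[OF eventually_compose_filterlim[OF df k_tend]]
      eventually_nhds_imp_at[OF \<kappa>(4)] eventually_nhds_imp_at[OF \<kappa>(5)]
      eventually_nhds_imp_at[OF analytic_eventually_has_derivative[OF \<kappa>(1)]]
  proof eventually_elim
    case (elim t)
    define w where "w = lw A (\<kappa> t)"
    define w' where "w' = deriv (lw A) (\<kappa> t)"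
    have w': "w' \<noteq> 0" using elim(1) unfolding w'_def by (rule conjunct1)
    have "\<exists>\<xi>' Z' E'.
     (\<forall>l. ((\<lambda>\<zeta>. lxi A \<zeta> $ l) has_field_derivative \<xi>' l) (at (\<kappa> t))) \<and> (lZ z0 A has_field_derivative Z') (at (\<kappa> t)) \<and>
     (lE A has_field_derivative E') (at (\<kappa> t)) \<and>
     (\<forall>l. w / w' * \<xi>' l = fst (full_field D (lxi A (\<kappa> t), lZ z0 A (\<kappa> t), lE A (\<kappa> t))) $ l) \<and>
     w / w' * Z' = fst (snd (full_field D (lxi A (\<kappa> t), lZ z0 A (\<kappa> t), lE A (\<kappa> t)))) \<and>
     w / w' * E' = snd (snd (full_field D (lxi A (\<kappa> t), lZ z0 A (\<kappa> t), lE A (\<kappa> t))))"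
      using elim(1) unfolding w_def w'_def by (elim conjE)
    then obtain \<xi>' Z' E' where d: "\<forall>l. ((\<lambda>\<zeta>. lxi A \<zeta> $ l) has_field_derivative \<xi>' l) (at (\<kappa> t))"
      "(lZ z0 A has_field_derivative Z') (at (\<kappa> t))" "(lE A has_field_derivative E') (at (\<kappa> t))"
      and v: "\<forall>l. w / w' * \<xi>' l = fst (full_field D (lxi A (\<kappa> t), lZ z0 A (\<kappa> t), lE A (\<kappa> t))) $ l"
      "w / w' * Z' = fst (snd (full_field D (lxi A (\<kappa> t), lZ z0 A (\<kappa> t), lE A (\<kappa> t))))"
      "w / w' * E' = snd (snd (full_field D (lxi A (\<kappa> t), lZ z0 A (\<kappa> t), lE A (\<kappa> t))))"
      by (elim exE conjE) (rule that)
    have tk: "t * deriv \<kappa> t = w / w'"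
    proof -
      have 1: "beta D * w = t" using elim(3) by (simp add: f_def w_def)
      have 2: "beta D * w' * deriv \<kappa> t = 1" using elim(2,4) by (simp add: w'_def)
      have "t * deriv \<kappa> t * w' = w * (beta D * w' * deriv \<kappa> t)" unfolding 1[symmetric] by (simp only: mult_ac)
      then have "t * deriv \<kappa> t * w' = w" unfolding 2 by simp
      then show ?thesis using w' by (simp add: eq_divide_eq)
    qed
    have ch: "t * deriv (\<lambda>t. F (\<kappa> t)) t = w / w' * F'" if "(F has_field_derivative F') (at (\<kappa> t))" for F F'
    proof -
      have "deriv (\<lambda>t. F (\<kappa> t)) t = F' * deriv \<kappa> t"
        by (rule DERIV_imp_deriv[OF DERIV_chain2[OF that elim(5)]])
      then have "t * deriv (\<lambda>t. F (\<kappa> t)) t = (t * deriv \<kappa> t) * F'" by (simp only: mult_ac)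
      then show ?thesis unfolding tk .
    qed
    show ?case
      using ch[OF d(1)[rule_format]] ch[OF d(2)] ch[OF d(3)] v by simp
  qed
  have P0: "(lxi A (\<kappa> 0), lZ z0 A (\<kappa> 0), lE A (\<kappa> 0)) = 0"
    using lP_0[OF ls] by (simp add: lP_def \<kappa>(2))
  have ode: "\<forall>\<^sub>F t in nhds 0. (\<forall>l. t * deriv (\<lambda>t. lxi A (\<kappa> t) $ l) t = fst (full_field D (lxi A (\<kappa> t), lZ z0 A (\<kappa> t), lE A (\<kappa> t))) $ l) \<and>
       t * deriv (\<lambda>t. lZ z0 A (\<kappa> t)) t = fst (snd (full_field D (lxi A (\<kappa> t), lZ z0 A (\<kappa> t), lE A (\<kappa> t)))) \<and>
       t * deriv (\<lambda>t. lE A (\<kappa> t)) t = snd (snd (full_field D (lxi A (\<kappa> t), lZ z0 A (\<kappa> t), lE A (\<kappa> t))))"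
    \<comment> \<open>The chart equation was derived off \<zeta> = 0; at t = 0 both sides
      vanish.\<close>
    unfolding eventually_nhds_iff_at
    by (rule conjI[OF ode_at]) (simp add: P0 full_field_0)
  have jj0: "lxi A (\<kappa> t) $ jj D = 0" for t
    by (simp add: lxi_def matrix_inv_TT_jj lX_def fixed_point_jj)
  note sol = solution_on_unstable_manifold[OF comp_an[OF laurent_analytic(4)[OF ls]] comp_an[OF laurent_analytic(5)[OF ls]]
      comp_an[OF laurent_analytic(6)[OF ls]] P0 jj0 ode]
  show ?thesis
    by (rule that[of \<kappa>, OF \<kappa>(1,2) dk0 \<kappa>(3)[unfolded f_def] \<kappa>(4)[unfolded f_def]
        sol(1)[folded lP_def] sol(2)[folded lP_def]])
qed

end

context normal_form_system
begin

text \<open>The coefficients are taken in \<zeta> because the expansions in \<zeta> are the ones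
  known to vary continuously with the parameters, whereas \<kappa> changes with the
  solution.\<close>

lemma laurent_leading_coefficients:
  assumes ls: "laurent_solution D z0 A"
  shows "\<exists>u::complex^'b. (\<forall>v. ((\<lambda>\<zeta>. H (proj (lP z0 A \<zeta>)) $ v / \<zeta> ^ wt D v) \<longlongrightarrow> u $ v) (at 0)) \<and>
    (\<forall>v\<in>Uslots D. peval (G1 v) (\<lambda>a. u $ a) = 0)"
proof (rule laurent_curve[OF ls])
  fix \<kappa> assume \<kappa>: "\<kappa> analytic_on {0}" "\<kappa> 0 = 0" "deriv \<kappa> 0 = 1"
    "\<forall>\<^sub>F \<zeta> in nhds 0. \<kappa> (beta D * lw A \<zeta>) = \<zeta>" "\<forall>\<^sub>F t in nhds 0. beta D * lw A (\<kappa> t) = t"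
    "solution (\<lambda>t. proj (lP z0 A (\<kappa> t)))"
  define f where "f \<zeta> = beta D * lw A \<zeta>" for \<zeta>
  have f: "f analytic_on {0}" "f 0 = 0" "deriv f 0 = 1"
  proof -
    show "f analytic_on {0}" unfolding f_def by (intro analytic_on_mult analytic_on_const laurent_analytic(3)[OF ls])
    show "f 0 = 0" by (simp add: f_def lw_0)
    have "(lw A has_field_derivative inverse (beta D)) (at 0)"
      using eventually_nhds_x_imp_x[OF analytic_eventually_has_derivative[OF laurent_analytic(3)[OF ls]]] deriv_lw_0[OF ls] by simp
    from DERIV_imp_deriv[OF DERIV_cmult[OF this, of "beta D"]] show "deriv f 0 = 1"
      using beta_nz by (simp add: f_def[abs_def])
  qed
  show ?thesis
  proof (rule solution_leading_coefficients[OF \<kappa>(6)])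
    fix u :: "complex^'b"
    assume u: "\<And>v. ((\<lambda>t. H (proj (lP z0 A (\<kappa> t))) $ v / t ^ wt D v) \<longlongrightarrow> u $ v) (at 0)"
      "\<And>v. v \<in> Uslots D \<Longrightarrow> peval (G1 v) (\<lambda>a. u $ a) = 0"
    have "((\<lambda>\<zeta>. H (proj (lP z0 A \<zeta>)) $ v / \<zeta> ^ wt D v) \<longlongrightarrow> u $ v) (at 0)" for v
    proof -
      have "((\<lambda>\<zeta>. H (proj (lP z0 A (\<kappa> (f \<zeta>)))) $ v / \<zeta> ^ wt D v) \<longlongrightarrow> u $ v) (at 0)"
        by (rule limit_reparametrized(2)[OF f u(1)])
      moreover have "\<forall>\<^sub>F \<zeta> in at 0. H (proj (lP z0 A (\<kappa> (f \<zeta>)))) $ v / \<zeta> ^ wt D v = H (proj (lP z0 A \<zeta>)) $ v / \<zeta> ^ wt D v"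
        using eventually_nhds_imp_at[OF \<kappa>(4)] by eventually_elim (simp add: f_def)
      ultimately show ?thesis by (rule Lim_transform_eventually)
    qed
    then show ?thesis using u(2) by (intro exI[of _ u] conjI allI ballI)
  qed
qed

text \<open>w / \<zeta> tends to 1/beta. So z_0 can be read off from u, while the slot of \<epsilon>
  is the same for all solutions and confines u to a slice.\<close>

lemma laurent_special_slots:
  assumes ls: "laurent_solution D z0 A"
    and lim: "\<And>v. ((\<lambda>\<zeta>. H (proj (lP z0 A \<zeta>)) $ v / \<zeta> ^ wt D v) \<longlongrightarrow> u $ v) (at 0)"
  shows "u $ zc D = z0 * inverse (beta D) ^ rw D" "u $ ec D = inverse (beta D) ^ sw D"
proof -
  have "isCont (lroot A) 0" using laurent_analytic(2)[OF ls] analytic_at_imp_isCont by blast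
  then have rt: "(lroot A \<longlongrightarrow> inverse (beta D)) (at 0)"
    using lroot_facts(2)[OF ls] by (simp add: isCont_def)
  have "((\<lambda>\<zeta>. (z0 + \<zeta>) * lroot A \<zeta> ^ rw D) \<longlongrightarrow> (z0 + 0) * inverse (beta D) ^ rw D) (at 0)"
    by (intro tendsto_mult tendsto_add tendsto_const tendsto_ident_at tendsto_power rt)
  moreover have "(z0 + \<zeta>) * lroot A \<zeta> ^ rw D = H (proj (lP z0 A \<zeta>)) $ zc D / \<zeta> ^ wt D (zc D)" if "\<zeta> \<noteq> 0" for \<zeta>
    using that by (simp add: H_nth proj_nth lP_def lZ_def lw_def slots_facts(2) power_mult_distrib)
  then have "\<forall>\<^sub>F \<zeta> in at 0. (z0 + \<zeta>) * lroot A \<zeta> ^ rw D = H (proj (lP z0 A \<zeta>)) $ zc D / \<zeta> ^ wt D (zc D)"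
    by (simp add: eventually_at_filter)
  ultimately have "((\<lambda>\<zeta>. H (proj (lP z0 A \<zeta>)) $ zc D / \<zeta> ^ wt D (zc D)) \<longlongrightarrow> (z0 + 0) * inverse (beta D) ^ rw D) (at 0)"
    by (rule Lim_transform_eventually)
  from tendsto_unique[OF at_neq_bot lim this] show "u $ zc D = z0 * inverse (beta D) ^ rw D" by simp
  have "((\<lambda>\<zeta>. lroot A \<zeta> ^ sw D) \<longlongrightarrow> inverse (beta D) ^ sw D) (at 0)"
    by (intro tendsto_power rt)
  moreover have "lroot A \<zeta> ^ sw D = H (proj (lP z0 A \<zeta>)) $ ec D / \<zeta> ^ wt D (ec D)" if "\<zeta> \<noteq> 0" for \<zeta>
    using that by (simp add: H_nth proj_nth lP_def lE_def lw_def slots_facts(3) power_mult_distrib)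
  then have "\<forall>\<^sub>F \<zeta> in at 0. lroot A \<zeta> ^ sw D = H (proj (lP z0 A \<zeta>)) $ ec D / \<zeta> ^ wt D (ec D)"
    by (simp add: eventually_at_filter)
  ultimately have "((\<lambda>\<zeta>. H (proj (lP z0 A \<zeta>)) $ ec D / \<zeta> ^ wt D (ec D)) \<longlongrightarrow> inverse (beta D) ^ sw D) (at 0)"
    by (rule Lim_transform_eventually)
  from tendsto_unique[OF at_neq_bot lim this] show "u $ ec D = inverse (beta D) ^ sw D" .
qed

text \<open>Equal coefficients give equal curves in the variable \<tau>. Undoing the
  reparametrization shows that the chart points and w agree as functions of \<zeta>, and from these
  the original series are recovered.\<close>

lemma laurent_unique:
  assumes ls1: "laurent_solution D z1 A1" and ls2: "laurent_solution D z2 A2"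
    and lim1: "\<And>v. ((\<lambda>\<zeta>. H (proj (lP z1 A1 \<zeta>)) $ v / \<zeta> ^ wt D v) \<longlongrightarrow> u $ v) (at 0)"
    and lim2: "\<And>v. ((\<lambda>\<zeta>. H (proj (lP z2 A2 \<zeta>)) $ v / \<zeta> ^ wt D v) \<longlongrightarrow> u $ v) (at 0)"
  shows "z1 = z2 \<and> (\<forall>i n. n \<ge> 1 \<longrightarrow> A1 i n = A2 i n)"
proof (rule laurent_curve[OF ls1], rule laurent_curve[OF ls2])
  fix \<kappa>1 \<kappa>2
  assume k1: "\<kappa>1 analytic_on {0}" "\<kappa>1 0 = 0" "deriv \<kappa>1 0 = 1"
    "\<forall>\<^sub>F \<zeta> in nhds 0. \<kappa>1 (beta D * lw A1 \<zeta>) = \<zeta>" "\<forall>\<^sub>F t in nhds 0. beta D * lw A1 (\<kappa>1 t) = t"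
    "\<forall>\<^sub>F t in nhds 0. lP z1 A1 (\<kappa>1 t) = graph_point D (proj (lP z1 A1 (\<kappa>1 t)))"
    "solution (\<lambda>t. proj (lP z1 A1 (\<kappa>1 t)))"
    and k2: "\<kappa>2 analytic_on {0}" "\<kappa>2 0 = 0" "deriv \<kappa>2 0 = 1"
    "\<forall>\<^sub>F \<zeta> in nhds 0. \<kappa>2 (beta D * lw A2 \<zeta>) = \<zeta>" "\<forall>\<^sub>F t in nhds 0. beta D * lw A2 (\<kappa>2 t) = t"
    "\<forall>\<^sub>F t in nhds 0. lP z2 A2 (\<kappa>2 t) = graph_point D (proj (lP z2 A2 (\<kappa>2 t)))"
    "solution (\<lambda>t. proj (lP z2 A2 (\<kappa>2 t)))"
  have z: "z1 = z2"
    using laurent_special_slots(1)[OF ls1 lim1] laurent_special_slots(1)[OF ls2 lim2] beta_nz by simp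
  have "\<forall>\<^sub>F t in nhds 0. proj (lP z1 A1 (\<kappa>1 t)) = proj (lP z2 A2 (\<kappa>2 t))"
    by (rule solution_unique[OF k1(7) k2(7) limit_reparametrized(2)[OF k1(1-3) lim1] limit_reparametrized(2)[OF k2(1-3) lim2]])
  then have Peq: "\<forall>\<^sub>F t in nhds 0. lP z1 A1 (\<kappa>1 t) = lP z2 A2 (\<kappa>2 t)"
    using k1(6) k2(6) by eventually_elim metis
  \<comment> \<open>w is determined by t, so after cancelling w^r equality of the Z components reads
    z_1 + \<kappa>1 = z_2 + \<kappa>2.\<close>
  have "\<forall>\<^sub>F t in at 0. \<kappa>1 t = \<kappa>2 t"
    using eventually_nhds_imp_at[OF Peq] eventually_nhds_imp_at[OF k1(5)] eventually_nhds_imp_at[OF k2(5)]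
      eventually_neq_at_within[of "0::complex" 0 UNIV]
  proof eventually_elim
    case (elim t)
    have w: "lw A1 (\<kappa>1 t) = lw A2 (\<kappa>2 t)" "lw A2 (\<kappa>2 t) \<noteq> 0"
    proof -
      have "beta D * lw A1 (\<kappa>1 t) = beta D * lw A2 (\<kappa>2 t)" using elim(2,3) by simp
      then show "lw A1 (\<kappa>1 t) = lw A2 (\<kappa>2 t)" using beta_nz by simp
      show "lw A2 (\<kappa>2 t) \<noteq> 0" using elim(3,4) by auto
    qed
    have "(z1 + \<kappa>1 t) * lw A1 (\<kappa>1 t) ^ rw D = (z2 + \<kappa>2 t) * lw A2 (\<kappa>2 t) ^ rw D"
      using elim(1) by (simp add: lP_def lZ_def)
    then show ?case using w z by simp
  qed
  then have keq: "\<forall>\<^sub>F t in nhds 0. \<kappa>1 t = \<kappa>2 t"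
    unfolding eventually_nhds_iff_at using k1(2) k2(2) by simp
  define f where "f \<zeta> = beta D * lw A1 \<zeta>" for \<zeta>
  have f_tend: "(f \<longlongrightarrow> 0) (nhds 0)"
  proof -
    have "f analytic_on {0}" unfolding f_def by (intro analytic_on_mult analytic_on_const laurent_analytic(3)[OF ls1])
    then have "isCont f 0" using analytic_at_imp_isCont by blast
    from isCont_tendsto_nhds[OF this] show ?thesis by (simp add: f_def lw_0)
  qed
  have near: "\<forall>\<^sub>F \<zeta> in nhds 0. lP z1 A1 \<zeta> = lP z2 A2 \<zeta> \<and> lw A1 \<zeta> = lw A2 \<zeta>"
    using k1(4) eventually_compose_filterlim[OF keq f_tend] eventually_compose_filterlim[OF Peq f_tend]
      eventually_compose_filterlim[OF k2(5) f_tend]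
  proof eventually_elim
    case (elim \<zeta>)
    have a: "\<kappa>1 (f \<zeta>) = \<zeta>" "\<kappa>2 (f \<zeta>) = \<zeta>" using elim(1,2) by (simp_all add: f_def)
    have "beta D * lw A2 \<zeta> = f \<zeta>" using elim(4) unfolding a .
    then have "lw A1 \<zeta> = lw A2 \<zeta>" using beta_nz by (simp add: f_def)
    moreover have "lP z1 A1 \<zeta> = lP z2 A2 \<zeta>" using elim(3) unfolding a .
    ultimately show ?case by simp
  qed
  have psi: "\<forall>\<^sub>F \<zeta> in at 0. lpsi A1 i \<zeta> = lpsi A2 i \<zeta>" for i
    using eventually_nhds_imp_at[OF near] eventually_nhds_imp_at[OF lroot_facts(3)[OF ls1]]
      eventually_nhds_imp_at[OF lroot_facts(3)[OF ls2]] eventually_neq_at_within[of "0::complex" 0 UNIV]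
  proof eventually_elim
    case (elim \<zeta>)
    have rt: "lroot A1 \<zeta> = lroot A2 \<zeta>" using elim(1,4) by (simp add: lw_def)
    have "lxi A1 \<zeta> = lxi A2 \<zeta>" using elim(1) by (simp add: lP_def)
    then have X: "lX A1 \<zeta> = lX A2 \<zeta>" using X_of_lxi by metis
    show ?case
    \<comment> \<open>X_j is constantly 1 and carries no information; the series of x_j is recovered
      from the root w / \<zeta> instead.\<close>
    proof (cases "i = jj D")
      case True
      have "lroot A2 \<zeta> ^ pw D (jj D) * lpsi A1 (jj D) \<zeta> = lroot A2 \<zeta> ^ pw D (jj D) * lpsi A2 (jj D) \<zeta>"
        using elim(2,3) rt by simp
      moreover have "lroot A2 \<zeta> ^ pw D (jj D) \<noteq> 0" using elim(3) by simp
      ultimately show ?thesis unfolding True by (rule mult_left_cancel[THEN iffD1, rotated])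
    next
      case False
      have "lX A1 \<zeta> $ i = lX A2 \<zeta> $ i" using X by simp
      then show ?thesis using False elim(3) rt by (simp add: lX_def)
    qed
  qed
  have "A1 i n = A2 i n" if n: "n \<ge> 1" for i n
  proof -
    have e: "(\<lambda>\<zeta>. lpsi A1 i \<zeta> - lpsi A2 i \<zeta>) has_fps_expansion lfps A1 i - lfps A2 i"
      by (intro has_fps_expansion_diff laurent_solution_expansion(1)[OF ls1] laurent_solution_expansion(1)[OF ls2])
    have "\<forall>\<^sub>F \<zeta> in at 0. (lpsi A1 i \<zeta> - lpsi A2 i \<zeta>) / \<zeta> ^ n = 0"
      using psi[of i] by eventually_elim simp
    then have "((\<lambda>\<zeta>. (lpsi A1 i \<zeta> - lpsi A2 i \<zeta>) / \<zeta> ^ n) \<longlongrightarrow> 0) (at 0)"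
      by (rule tendsto_eventually)
    from has_fps_expansion_leading_unique(2)[OF e this] show ?thesis
      using n by (simp add: lfps_def)
  qed
  then show ?thesis using z by simp
qed

text \<open>The number m - k + 1 of parameters equals the number of slots other than that of
  \<epsilon>, whose coefficient is constant. Omitting this slot makes the dimensions equal, so
  invariance of domain gives an open set inside the slice.\<close>

lemma laurent_family_imp_G1_zero:
  assumes fam: "has_laurent_family D TYPE('q::finite)" and v: "v \<in> Uslots D"
  shows "G1 v = 0"
proof -
  have card: "CARD('q) = card (Uset D) + 1" and
    ex: "\<exists>(q0 :: 'q) (\<Omega> :: (complex^'q) set) A.
        open \<Omega> \<and> \<Omega> \<noteq> {} \<and>
        (\<forall>i n. 1 \<le> n \<longrightarrow> holo_on (\<lambda>\<theta>. A \<theta> i n) \<Omega>) \<and>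
        (\<forall>\<theta>\<in>\<Omega>. laurent_solution D (\<theta> $ q0) (A \<theta>)) \<and>
        (\<forall>\<theta>\<in>\<Omega>. \<forall>\<theta>'\<in>\<Omega>. \<theta> $ q0 = \<theta>' $ q0 \<and> (\<forall>i n. 1 \<le> n \<longrightarrow> A \<theta> i n = A \<theta>' i n) \<longrightarrow> \<theta> = \<theta>')"
    using fam unfolding has_laurent_family_def by (rule conjunct1, rule conjunct2)
  obtain q0 :: 'q and \<Omega> :: "(complex^'q) set" and A where \<Omega>: "open \<Omega>" "\<Omega> \<noteq> {}"
    and holo: "\<forall>i n. 1 \<le> n \<longrightarrow> holo_on (\<lambda>\<theta>. A \<theta> i n) \<Omega>"
    and ls0: "\<forall>\<theta>\<in>\<Omega>. laurent_solution D (\<theta> $ q0) (A \<theta>)"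
    and free: "\<forall>\<theta>\<in>\<Omega>. \<forall>\<theta>'\<in>\<Omega>. \<theta> $ q0 = \<theta>' $ q0 \<and> (\<forall>i n. 1 \<le> n \<longrightarrow> A \<theta> i n = A \<theta>' i n) \<longrightarrow> \<theta> = \<theta>'"
    using ex by (elim exE conjE) (rule that)
  have ls: "laurent_solution D (\<theta> $ q0) (A \<theta>)" if "\<theta> \<in> \<Omega>" for \<theta> using ls0 that by (rule bspec)
  have contA: "continuous_on \<Omega> (\<lambda>\<theta>. A \<theta> i n)" if "n \<ge> 1" for i n
    using holo that unfolding holo_on_iff by (intro continuous_at_imp_continuous_on ballI) (blast intro: cdiff_continuous)
  have contz: "continuous_on \<Omega> (\<lambda>\<theta>. \<theta> $ q0)" by (intro continuous_intros)
  note fm = laurent_families[OF contz contA laurent_solution_expansion(1)[OF ls]]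
  have fproj: "fps_family \<Omega> (\<lambda>\<theta> \<zeta>. proj (lP (\<theta> $ q0) (A \<theta>) \<zeta>) $ a)" for a
    by (cases a rule: slot_cases) (use fm(5-7) in \<open>simp_all add: proj_nth lP_def\<close>)
  have fH: "fps_family \<Omega> (\<lambda>\<theta> \<zeta>. H (proj (lP (\<theta> $ q0) (A \<theta>) \<zeta>)) $ a)" for a
    by (cases "a \<in> Uslots D") (simp_all add: near_id_def fproj fps_family_peval)
  have "\<forall>\<theta>\<in>\<Omega>. \<exists>u::complex^'b. (\<forall>v. ((\<lambda>\<zeta>. H (proj (lP (\<theta> $ q0) (A \<theta>) \<zeta>)) $ v / \<zeta> ^ wt D v) \<longlongrightarrow> u $ v) (at 0)) \<and>
    (\<forall>v\<in>Uslots D. peval (G1 v) (\<lambda>a. u $ a) = 0)"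
    by (rule ballI, rule laurent_leading_coefficients[OF ls])
  from bchoice[OF this] obtain u :: "complex^'q \<Rightarrow> complex^'b" where
    U: "\<forall>\<theta>\<in>\<Omega>. (\<forall>v. ((\<lambda>\<zeta>. H (proj (lP (\<theta> $ q0) (A \<theta>) \<zeta>)) $ v / \<zeta> ^ wt D v) \<longlongrightarrow> u \<theta> $ v) (at 0)) \<and>
    (\<forall>v\<in>Uslots D. peval (G1 v) (\<lambda>a. u \<theta> $ a) = 0)" ..
  have u: "((\<lambda>\<zeta>. H (proj (lP (\<theta> $ q0) (A \<theta>) \<zeta>)) $ v / \<zeta> ^ wt D v) \<longlongrightarrow> u \<theta> $ v) (at 0)" if "\<theta> \<in> \<Omega>" for \<theta> v
    by (rule spec[OF bspec[OF U that, THEN conjunct1]])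
  have u0: "peval (G1 v) (\<lambda>a. u \<theta> $ a) = 0" if "\<theta> \<in> \<Omega>" for \<theta>
    by (rule bspec[OF bspec[OF U that, THEN conjunct2] v])
  have uec: "u \<theta> $ ec D = inverse (beta D) ^ sw D" if "\<theta> \<in> \<Omega>" for \<theta>
    by (rule laurent_special_slots(2)[OF ls[OF that] u[OF that]])
  have ucont: "continuous_on \<Omega> (\<lambda>\<theta>. u \<theta> $ v)" for v
    by (rule fps_family_leading_continuous[OF fH u])
  have "card (Uslots D) = card (Uset D)" using bij_betw_same_card[OF slots_facts(4)] by simp
  moreover have "- {ec D} = insert (zc D) (Uslots D)" "zc D \<notin> Uslots D"
    using slots_facts(1) by (auto simp: Uslots_def)
  ultimately have "CARD('q) = card (- {ec D})" using card by simp
  \<comment> \<open>An enumeration of the slots other than that of \<epsilon> by the parameter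
    indices; it identifies the slice with the parameter space.\<close>
  then obtain b where b: "bij_betw b (UNIV :: 'q set) (- {ec D})"
    using finite_same_card_bij[of "UNIV :: 'q set" "- {ec D}"] by auto
  have bsurj: "\<exists>a. c = b a" if "c \<noteq> ec D" for c
    using b that unfolding bij_betw_def by blast
  define \<Psi> where "\<Psi> \<theta> = (\<chi> a. u \<theta> $ b a)" for \<theta>
  have \<Psi>_cont: "continuous_on \<Omega> \<Psi>"
    unfolding \<Psi>_def by (intro continuous_on_vec_lambda ucont)
  have \<Psi>_eq: "y = u \<theta>" if "\<theta> \<in> \<Omega>" "y $ ec D = inverse (beta D) ^ sw D" "(\<chi> a. y $ b a) = \<Psi> \<theta>" for y \<theta>
    unfolding vec_eq_iff
  proof
    fix c show "y $ c = u \<theta> $ c"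
    proof (cases "c = ec D")
      case True then show ?thesis using that(2) uec[OF that(1)] by simp
    next
      case False
      then obtain a where a: "c = b a" using bsurj by blast
      have "(\<chi> a. y $ b a) $ a = \<Psi> \<theta> $ a" using that(3) by simp
      then show ?thesis by (simp add: \<Psi>_def a)
    qed
  qed
  have "inj_on \<Psi> \<Omega>"
  proof (rule inj_onI)
    fix \<theta> \<theta>' assume t: "\<theta> \<in> \<Omega>" "\<theta>' \<in> \<Omega>" and eq: "\<Psi> \<theta> = \<Psi> \<theta>'"
    have "u \<theta> = u \<theta>'"
      by (rule \<Psi>_eq[OF t(2) uec[OF t(1)]]) (use eq in \<open>simp add: \<Psi>_def\<close>)
    then have l2: "((\<lambda>\<zeta>. H (proj (lP (\<theta>' $ q0) (A \<theta>') \<zeta>)) $ v / \<zeta> ^ wt D v) \<longlongrightarrow> u \<theta> $ v) (at 0)" for v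
      using u[OF t(2), of v] by simp
    from laurent_unique[OF ls[OF t(1)] ls[OF t(2)] u[OF t(1)] l2]
    show "\<theta> = \<theta>'" using free[rule_format, OF t] by blast
  qed
  then have opn: "open (\<Psi> ` \<Omega>)" by (rule invariance_of_domain[OF \<Psi>_cont \<Omega>(1)])
  obtain \<theta>0 where \<theta>0: "\<theta>0 \<in> \<Omega>" using \<Omega>(2) by blast
  obtain r where r: "r > 0" "ball (\<Psi> \<theta>0) r \<subseteq> \<Psi> ` \<Omega>"
    using opn \<theta>0 by (meson imageI open_contains_ball)
  have nz: "u \<theta>0 $ ec D \<noteq> 0" using uec[OF \<theta>0] beta_nz by simp
  \<comment> \<open>The norm after omitting a slot is estimated by the sum of the
    \<open>CARD('q)\<close> components, hence the division.\<close>
  have rq: "r / CARD('q) > 0" using r(1) by simp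
  show ?thesis
  proof (rule weighted_homogeneous_eq_0[of "G1 v" "wt D" "wt D v", OF G1_resonant[OF v] wt_pos nz rq])
    fix y assume y: "norm (y - u \<theta>0) < r / CARD('q)" "y $ ec D = u \<theta>0 $ ec D"
    have "norm ((\<chi> a. y $ b a) - \<Psi> \<theta>0) \<le> (\<Sum>a\<in>UNIV. norm (((\<chi> a. y $ b a) - \<Psi> \<theta>0) $ a))"
      by (rule norm_vec_le_sum)
    also have "\<dots> \<le> (\<Sum>a\<in>(UNIV::'q set). norm (y - u \<theta>0))"
    proof (rule sum_mono)
      fix a
      have "norm ((y - u \<theta>0) $ b a) \<le> norm (y - u \<theta>0)" by (rule Finite_Cartesian_Product.norm_nth_le)
      then show "norm (((\<chi> a. y $ b a) - \<Psi> \<theta>0) $ a) \<le> norm (y - u \<theta>0)" by (simp add: \<Psi>_def)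
    qed
    also have "\<dots> = CARD('q) * norm (y - u \<theta>0)" by simp
    also have "\<dots> < r" using y(1) by (simp add: pos_less_divide_eq mult.commute)
    finally have "(\<chi> a. y $ b a) \<in> \<Psi> ` \<Omega>"
      using r(2) by (auto simp: dist_norm norm_minus_commute)
    then obtain \<theta> where \<theta>: "\<theta> \<in> \<Omega>" "(\<chi> a. y $ b a) = \<Psi> \<theta>" by blast
    have "y = u \<theta>" by (rule \<Psi>_eq[OF \<theta>(1) _ \<theta>(2)]) (simp add: y(2) uec[OF \<theta>0])
    then show "peval (G1 v) (\<lambda>a. y $ a) = 0" using u0[OF \<theta>(1)] by simp
  qed
qed

end

section \<open>Holomorphic extension of the blown-up system\<close>

theorem proposition3p7:
  fixes D :: "('m::finite, 'v::finite) kov" and B0 :: "(complex^'v) set"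
  assumes "assumption_A1 D" and "assumption_A2 D" and "assumption_A3 D"
    and "indicial_root D"
    and "kov_exponents D"
    and "G_determined D"
    and "unstable_slots D"
    and "positive_integer_exponents D"
    and "splitting D"
    and "unstable_manifold D B0"
  shows "\<exists>N0. \<forall>N\<ge>N0. \<forall>h G1 G2 B. B \<subseteq> B0 \<longrightarrow> normal_form D N h G1 G2 B \<longrightarrow>
    transforms_into_blowup_system D h G1 G2 B \<and>
    (\<forall>v\<in>Uslots D. holo_near_divisor D (blowup_domain D h B)
        (\<lambda>a. a $ ec D powi (- 1 - int (wt D v)) * G2 v (blowup D a))) \<and>
    (\<forall>v\<in>Uslots D. \<exists>P. (\<forall>n\<in>Poly_Mapping.keys P. Poly_Mapping.lookup n (ec D) = 0) \<and>
        (\<forall>a. a $ ec D \<noteq> 0 \<longrightarrow>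
           a $ ec D powi (- 1 - int (wt D v)) * peval (G1 v) (\<lambda>b. blowup D a $ b)
             = a $ ec D powi (- 1) * peval P (\<lambda>b. a $ b))) \<and>
    (\<forall>a\<in>divisor D. 1 / F_blowup D h B a \<noteq> 0) \<and>
    (has_laurent_family D TYPE('q::finite) \<or>
     semisimple (red_matrix D) \<and> analytically_linearizable D \<longrightarrow>
       (\<forall>v\<in>Uslots D. G1 v = 0) \<and>
       (\<forall>v. holo_near_divisor D (blowup_domain D h B) (\<lambda>a. blowup_rhs D h G1 G2 B a $ v)) \<and>
       (\<forall>a\<in>divisor D. foliation_nonsingular_at D (blowup_domain D h B)
                          (blowup_rhs D h G1 G2 B) a))"
\<comment> \<open>Any bound on all weights, increased by 2, would serve; the sum of the weights is
  one that depends on \<open>D\<close> only.\<close>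
proof (intro exI[of _ "(\<Sum>v\<in>UNIV. wt D v) + 2"] allI impI)
  fix N :: nat and h G1 :: "'v \<Rightarrow> 'v mpoly" and G2 :: "'v \<Rightarrow> complex^'v \<Rightarrow> complex" and B :: "(complex^'v) set"
  assume N: "(\<Sum>v\<in>UNIV. wt D v) + 2 \<le> N" and B: "B \<subseteq> B0" and nf: "normal_form D N h G1 G2 B"
  have "wt D v + 2 \<le> N" for v
  proof -
    have "wt D v \<le> (\<Sum>v\<in>UNIV. wt D v)" by (rule member_le_sum) simp_all
    then show ?thesis using N by simp
  qed
  then interpret normal_form_system D B0 N h G1 G2 B
    by unfold_locales (rule assms B nf | assumption)+
  have G1: "G1 v = 0" if "has_laurent_family D TYPE('q) \<or> semisimple (red_matrix D) \<and> analytically_linearizable D"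
    and "v \<in> Uslots D" for v
    using that(1) laurent_family_imp_G1_zero[OF _ that(2)] linearizable_imp_G1_zero[OF _ _ that(2)] by blast
  show "transforms_into_blowup_system D h G1 G2 B \<and>
    (\<forall>v\<in>Uslots D. holo_near_divisor D (blowup_domain D h B)
        (\<lambda>a. a $ ec D powi (- 1 - int (wt D v)) * G2 v (blowup D a))) \<and>
    (\<forall>v\<in>Uslots D. \<exists>P. (\<forall>n\<in>Poly_Mapping.keys P. Poly_Mapping.lookup n (ec D) = 0) \<and>
        (\<forall>a. a $ ec D \<noteq> 0 \<longrightarrow>
           a $ ec D powi (- 1 - int (wt D v)) * peval (G1 v) (\<lambda>b. blowup D a $ b)
             = a $ ec D powi (- 1) * peval P (\<lambda>b. a $ b))) \<and>
    (\<forall>a\<in>divisor D. 1 / F_blowup D h B a \<noteq> 0) \<and>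
    (has_laurent_family D TYPE('q::finite) \<or>
     semisimple (red_matrix D) \<and> analytically_linearizable D \<longrightarrow>
       (\<forall>v\<in>Uslots D. G1 v = 0) \<and>
       (\<forall>v. holo_near_divisor D (blowup_domain D h B) (\<lambda>a. blowup_rhs D h G1 G2 B a $ v)) \<and>
       (\<forall>a\<in>divisor D. foliation_nonsingular_at D (blowup_domain D h B)
                          (blowup_rhs D h G1 G2 B) a))"
    by (intro conjI ballI impI allI transforms_into_blowup G2_holo_near_divisor G1_blowup_polynomial inverse_F_blowup_nz
        conclusion_of_G1_zero G1)
qed

end
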